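(* Let $\Omega\subset\mathbb{R}^n$ be a bounded domain with $C^1$ boundary, let $1<p<\infty$, $k\in\{0,1,2,\dots\}$, and let $f\in W^{p,k}(\Omega,Cl_n)$. Then for every $\epsilon>0$ there exists a $Cl_n$-valued function $\Psi=\sum_A e_A\psi_A$ on $\Omega$ which is $C^\infty$ up to the boundary, i.e. $\Psi\in C^\infty(\Omega\cup\partial\Omega,Cl_n)$, such that $$\|f-\Psi\|_{W^{p,k}(\Omega\cup\partial\Omega,Cl_n)}<\epsilon .$$
   Context: $Cl_n$ is the $2^n$-dimensional real Clifford algebra generated by $\mathbb{R}^n$ with $x^2=-\|x\|^2$ for $x\in\mathbb{R}^n$; with $e_1,\dots,e_n$ the standard orthonormal basis of $\mathbb{R}^n$, it has basis $e_A$ indexed by subsets $A\subseteq\{1,\dots,n\}$ (ordered products of the $e_i$, $i\in A$, with $e_\emptyset=e_0$ the identity). A function $f:\Omega\to Cl_n$ is written $f=\sum_A e_A f_A$ with real-valued components $f_A$, and $f$ belongs to a function space iff every component $f_A$ belongs to the corresponding real-valued space. $W^{p,k}(\Omega,\mathbb{R})$ is the usual Sobolev space of functions whose weak derivatives $D^jf$ of order $|j|\le k$ are all in $L^p(\Omega)$, with norm $\|f\|_{W^{p,k}(\Omega,\mathbb{R})}=\left(\sum_{|j|\le k}\|D^jf\|_{L^p(\Omega)}^p\right)^{1/p}$, and $\|f\|_{W^{p,k}(\Omega,Cl_n)}=\left(\sum_A\|f_A\|_{W^{p,k}(\Omega,\mathbb{R})}^p\right)^{1/p}$. The notation $W^{p,k}(\Omega\cup\partial\Omega,Cl_n)$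 denotes the same norm (the boundary has measure zero), used to stress that the approximant is smooth up to the boundary. $C^\infty(\Omega\cup\partial\Omega,Cl_n)$ is the set of $C^\infty$ functions on $\Omega$ all of whose partial derivatives extend continuously to $\overline\Omega=\Omega\cup\partial\Omega$. *)

theory Defs
  imports "HOL-Analysis.Analysis"
begin

section \<open>The real Clifford algebra \<open>Cl\<^sub>n\<close>\<close>

text \<open>
  An element is the family of its real components \<open>x\<^sub>A\<close> with respect to the basis \<open>e\<^sub>A\<close>.
  The index type plays the role of \<open>{1, \<dots>, n}\<close>; its order fixes the order of the factors in
  \<open>e\<^sub>A = e\<^bsub>i1\<^esub> \<cdots> e\<^bsub>ik\<^esub>\<close>, \<open>i1 < \<cdots> < ik\<close>.
\<close>

typedef 'n clifford = "UNIV :: ('n set \<Rightarrow> real) set"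
  morphisms cl_comp Clifford by simp

lemma cl_comp_Clifford [simp]: "cl_comp (Clifford f) A = f A"
  by (simp add: Clifford_inverse)

lemma cl_eqI: "(\<And>A. cl_comp x A = cl_comp y A) \<Longrightarrow> x = y"
  by (metis cl_comp_inject ext)

text \<open>
  Moving the factors of \<open>e\<^sub>B\<close> into place in \<open>e\<^sub>A e\<^sub>B\<close> costs a sign for every pair \<open>b < a\<close>
  (anticommutation) and one for every pair \<open>b = a\<close> (as \<open>e\<^sub>a\<^sup>2 = -1\<close>), so that
  \<open>e\<^sub>A e\<^sub>B = cl_sign A B \<cdot> e\<^bsub>sym_diff A B\<^esub>\<close>.
\<close>

definition cl_sign :: "'n::linorder set \<Rightarrow> 'n set \<Rightarrow> real" where
  "cl_sign A B = (\<Prod>a\<in>A. \<Prod>b\<in>B. if b \<le> a then -1 else 1)"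

instantiation clifford :: (type) real_vector
begin
definition "0 = Clifford (\<lambda>A. 0)"
definition "x + y = Clifford (\<lambda>A. cl_comp x A + cl_comp y A)"
definition "- x = Clifford (\<lambda>A. - cl_comp x A)"
definition "x - y = Clifford (\<lambda>A. cl_comp x A - cl_comp y A)"
definition "c *\<^sub>R x = Clifford (\<lambda>A. c * cl_comp x A)"
instance
  by standard
    (auto intro!: cl_eqI simp: zero_clifford_def plus_clifford_def uminus_clifford_def
      minus_clifford_def scaleR_clifford_def algebra_simps)
end

lemma cl_comp_simps [simp]:
  "cl_comp 0 A = 0" "cl_comp (x + y) A = cl_comp x A + cl_comp y A"
  "cl_comp (- x) A = - cl_comp x A" "cl_comp (x - y) A = cl_comp x A - cl_comp y A"
  "cl_comp (c *\<^sub>R x) A = c * cl_comp x A"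
  by (simp_all add: zero_clifford_def plus_clifford_def uminus_clifford_def
      minus_clifford_def scaleR_clifford_def)

lemma cl_comp_sum [simp]: "cl_comp (sum f S) A = (\<Sum>s\<in>S. cl_comp (f s) A)"
  by (induction S rule: infinite_finite_induct) auto

lemma prod_sym_diff:
  fixes f :: "'a::finite \<Rightarrow> real"
  assumes "\<And>a. f a * f a = 1"
  shows "prod f (sym_diff A B) = prod f A * prod f B"
proof -
  have 1: "prod f A = prod f (A - B) * prod f (A \<inter> B)"
    by (subst prod.union_disjoint [symmetric]) (auto intro: prod.cong)
  have 2: "prod f B = prod f (B - A) * prod f (A \<inter> B)"
    by (subst prod.union_disjoint [symmetric]) (auto intro: prod.cong)
  have 3: "prod f (A \<inter> B) * prod f (A \<inter> B) = 1"
    using assms by (simp add: prod.distrib [symmetric])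
  have "prod f (sym_diff A B) = prod f (A - B) * prod f (B - A)"
    by (subst prod.union_disjoint [symmetric]) auto
  also have "\<dots> = prod f (A - B) * prod f (B - A) * (prod f (A \<inter> B) * prod f (A \<inter> B))"
    by (simp add: 3)
  also have "\<dots> = prod f A * prod f B"
    unfolding 1 2 by (simp only: mult_ac)
  finally show ?thesis .
qed

lemma cl_sign_sym_diff_left:
  fixes A B C :: "'n::{finite,linorder} set"
  shows "cl_sign (sym_diff A B) C = cl_sign A C * cl_sign B C"
  unfolding cl_sign_def
  by (rule prod_sym_diff) (simp add: prod.distrib [symmetric] if_distrib cong: if_cong)

lemma cl_sign_sym_diff_right:
  fixes A B C :: "'n::{finite,linorder} set"
  shows "cl_sign A (sym_diff B C) = cl_sign A B * cl_sign A C"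
  unfolding cl_sign_def prod.distrib [symmetric]
  by (intro prod.cong refl prod_sym_diff) auto

lemma cl_sign_empty [simp]: "cl_sign {} A = 1" "cl_sign A {} = 1"
  by (simp_all add: cl_sign_def)

definition cl_basis :: "'n set \<Rightarrow> 'n clifford" where
  "cl_basis A = Clifford (\<lambda>B. if B = A then 1 else 0)"

lemma cl_comp_basis [simp]: "cl_comp (cl_basis A) B = (if B = A then 1 else 0)"
  by (simp add: cl_basis_def)

instantiation clifford :: ("{finite,linorder}") real_algebra_1
begin
definition "1 = (cl_basis {} :: 'a clifford)"
definition "x * y = Clifford (\<lambda>C. \<Sum>A\<in>UNIV.
  cl_sign A (sym_diff A C) * cl_comp x A * cl_comp y (sym_diff A C))"
instance
proof
  fix x y z :: "'a clifford" and c :: real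
  have sd: "sym_diff A (sym_diff A B) = B" for A B :: "'a set" by auto
  have sda: "sym_diff (sym_diff A B) C = sym_diff A (sym_diff B C)" for A B C :: "'a set" by auto
  show "x * y * z = x * (y * z)"
  proof (rule cl_eqI)
    fix D
    let ?t = "\<lambda>A B. cl_sign A B * cl_sign (sym_diff A B) (sym_diff A (sym_diff B D))
        * cl_comp x A * cl_comp y B * cl_comp z (sym_diff A (sym_diff B D))"
    have "cl_comp (x * y * z) D = (\<Sum>E\<in>UNIV. \<Sum>A\<in>UNIV. cl_sign E (sym_diff E D)
        * (cl_sign A (sym_diff A E) * cl_comp x A * cl_comp y (sym_diff A E))
        * cl_comp z (sym_diff E D))"
      by (simp add: times_clifford_def sum_distrib_left sum_distrib_right)
    also have "\<dots> = (\<Sum>A\<in>UNIV. \<Sum>E\<in>UNIV. cl_sign E (sym_diff E D)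
        * (cl_sign A (sym_diff A E) * cl_comp x A * cl_comp y (sym_diff A E))
        * cl_comp z (sym_diff E D))"
      by (rule sum.swap)
    also have "\<dots> = (\<Sum>A\<in>UNIV. \<Sum>B\<in>UNIV. ?t A B)"
    proof (rule sum.cong [OF refl])
      fix A :: "'a set"
      show "(\<Sum>E\<in>UNIV. cl_sign E (sym_diff E D)
        * (cl_sign A (sym_diff A E) * cl_comp x A * cl_comp y (sym_diff A E))
        * cl_comp z (sym_diff E D)) = (\<Sum>B\<in>UNIV. ?t A B)"
        by (rule sum.reindex_bij_witness [of _ "sym_diff A" "sym_diff A"])
          (simp_all only: sd sda UNIV_I mult_ac)
    qed
    also have "\<dots> = (\<Sum>A\<in>UNIV. \<Sum>B\<in>UNIV. cl_sign A (sym_diff A D) * cl_comp x A *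
        (cl_sign B (sym_diff B (sym_diff A D)) * cl_comp y B
          * cl_comp z (sym_diff B (sym_diff A D))))"
    proof (intro sum.cong refl)
      fix A B :: "'a set"
      have "cl_sign A B * cl_sign (sym_diff A B) (sym_diff A (sym_diff B D))
        = cl_sign A B * cl_sign A B * cl_sign A A * cl_sign A D * cl_sign B A * cl_sign B B * cl_sign B D"
        by (simp only: cl_sign_sym_diff_left cl_sign_sym_diff_right mult_ac)
      moreover have "cl_sign A B * cl_sign A B = 1"
        unfolding cl_sign_sym_diff_right [symmetric] by simp
      ultimately have "cl_sign A B * cl_sign (sym_diff A B) (sym_diff A (sym_diff B D))
        = cl_sign A (sym_diff A D) * cl_sign B (sym_diff B (sym_diff A D))"
        by (simp only: cl_sign_sym_diff_left cl_sign_sym_diff_right mult_ac mult_1_left)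
      moreover have "sym_diff B (sym_diff A D) = sym_diff A (sym_diff B D)" by auto
      ultimately show "?t A B = cl_sign A (sym_diff A D) * cl_comp x A *
        (cl_sign B (sym_diff B (sym_diff A D)) * cl_comp y B
          * cl_comp z (sym_diff B (sym_diff A D)))"
        by (simp only: mult_ac)
    qed
    also have "\<dots> = cl_comp (x * (y * z)) D"
      by (simp add: times_clifford_def sum_distrib_left)
    finally show "cl_comp (x * y * z) D = cl_comp (x * (y * z)) D" .
  qed
  show "1 * x = x"
    by (rule cl_eqI)
      (simp add: times_clifford_def one_clifford_def if_distrib if_distribR cong: if_cong)
  show "x * 1 = x"
  proof (rule cl_eqI)
    fix C :: "'a set"
    have "cl_sign A (sym_diff A C) * cl_comp x A * cl_comp 1 (sym_diff A C)
        = (if A = C then cl_comp x C else 0)" for A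
    proof (cases "A = C")
      case False
      then have "sym_diff A C \<noteq> {}" by auto
      with False show ?thesis by (simp only: one_clifford_def cl_comp_basis if_False mult_zero_right)
    qed (simp add: one_clifford_def)
    then show "cl_comp (x * 1) C = cl_comp x C"
      by (simp add: times_clifford_def)
  qed
  show "(x + y) * z = x * z + y * z" "x * (y + z) = x * y + x * z"
    by (auto intro!: cl_eqI simp: times_clifford_def algebra_simps sum.distrib)
  show "c *\<^sub>R x * y = c *\<^sub>R (x * y)" "x * c *\<^sub>R y = c *\<^sub>R (x * y)"
    by (auto intro!: cl_eqI simp: times_clifford_def sum_distrib_left mult_ac)
  have "cl_comp 0 {} \<noteq> cl_comp (1 :: 'a clifford) {}"
    by (simp add: one_clifford_def)
  then show "(0 :: 'a clifford) \<noteq> 1" by metis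
qed
end

definition cl_vec :: "real^'n \<Rightarrow> 'n clifford" where
  "cl_vec x = (\<Sum>i\<in>UNIV. (x $ i) *\<^sub>R cl_basis {i})"

lemma cl_expansion:
  fixes x :: "'n::finite clifford"
  shows "x = (\<Sum>A\<in>UNIV. cl_comp x A *\<^sub>R cl_basis A)"
  by (rule cl_eqI) (simp add: if_distrib cong: if_cong)

lemma cl_basis_mult:
  fixes A B :: "'n::{finite,linorder} set"
  shows "cl_basis A * cl_basis B = cl_sign A B *\<^sub>R cl_basis (sym_diff A B)"
proof (rule cl_eqI)
  fix C :: "'n set"
  have "cl_sign D (sym_diff D C) * cl_comp (cl_basis A) D * cl_comp (cl_basis B) (sym_diff D C)
      = (if D = A then cl_sign A (sym_diff A C) * cl_comp (cl_basis B) (sym_diff A C) else 0)" for D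
    by (cases "D = A") simp_all
  then have *: "cl_comp (cl_basis A * cl_basis B) C
      = cl_sign A (sym_diff A C) * cl_comp (cl_basis B) (sym_diff A C)"
    by (simp add: times_clifford_def del: cl_comp_basis)
  show "cl_comp (cl_basis A * cl_basis B) C
      = cl_comp (cl_sign A B *\<^sub>R cl_basis (sym_diff A B)) C"
  proof (cases "C = sym_diff A B")
    case True
    have "sym_diff A (sym_diff A B) = B" by auto
    with * have "cl_comp (cl_basis A * cl_basis B) C = cl_sign A B"
      unfolding True by (metis cl_comp_basis mult.right_neutral)
    with True show ?thesis
      by (metis cl_comp_basis cl_comp_simps(5) mult.right_neutral)
  next
    case False
    have "sym_diff A (sym_diff A C) = C" by auto
    with False have "sym_diff A C \<noteq> B" by metis
    with * have "cl_comp (cl_basis A * cl_basis B) C = 0"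
      by (metis cl_comp_basis mult_zero_right)
    moreover have "cl_comp (cl_basis (sym_diff A B)) C = 0"
      using False unfolding cl_comp_basis by (rule if_not_P)
    ultimately show ?thesis by (simp only: cl_comp_simps mult_zero_right)
  qed
qed

lemma cl_vec_square:
  fixes x :: "real^'n::{finite,linorder}"
  shows "cl_vec x * cl_vec x = - ((norm x)\<^sup>2 *\<^sub>R 1)"
proof (rule cl_eqI)
  fix C :: "'n set"
  let ?e = "\<lambda>i j. cl_comp (cl_basis {i} * cl_basis {j}) C :: real"
  let ?S = "\<Sum>i\<in>UNIV. \<Sum>j\<in>UNIV. x $ i * x $ j * ?e i j"
  have "cl_comp (cl_vec x * cl_vec x) C = (\<Sum>i\<in>UNIV. \<Sum>j\<in>UNIV. x $ i * x $ j * ?e j i)"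
    by (simp add: cl_vec_def sum_distrib_left sum_distrib_right mult.assoc)
  moreover have "(\<Sum>i\<in>UNIV. \<Sum>j\<in>UNIV. x $ i * x $ j * ?e j i) = ?S"
    by (subst sum.swap) (simp add: mult_ac)
  ultimately have "2 * cl_comp (cl_vec x * cl_vec x) C
      = (\<Sum>i\<in>UNIV. \<Sum>j\<in>UNIV. x $ i * x $ j * (?e i j + ?e j i))"
    by (simp add: distrib_left sum.distrib)
  also have "\<dots> = (\<Sum>i\<in>UNIV. \<Sum>j\<in>UNIV. if j = i then - 2 * (x $ i)\<^sup>2 * cl_comp 1 C else 0)"
  proof (intro sum.cong refl)
    fix i j :: 'n
    have "?e i j + ?e j i = (if j = i then - 2 * cl_comp 1 C else 0)"
    proof (cases "j = i")
      case True
      then show ?thesis by (simp add: cl_basis_mult cl_sign_def one_clifford_def)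
    next
      case False
      have "cl_basis {j} * cl_basis {i} = cl_sign {j} {i} *\<^sub>R cl_basis (sym_diff {i} {j})"
        by (metis Un_commute cl_basis_mult)
      moreover have "cl_sign {i} {j} + cl_sign {j} {i} = 0"
        using False by (auto simp: cl_sign_def)
      ultimately have "?e i j + ?e j i = 0"
        unfolding cl_basis_mult [of "{i}"] by (simp only: cl_comp_simps distrib_right [symmetric] mult_zero_left)
      with False show ?thesis by simp
    qed
    then show "x $ i * x $ j * (?e i j + ?e j i)
        = (if j = i then - 2 * (x $ i)\<^sup>2 * cl_comp 1 C else 0)"
      by (auto simp: power2_eq_square)
  qed
  also have "\<dots> = - 2 * (norm x)\<^sup>2 * cl_comp 1 C"
    by (simp add: norm_vec_def L2_set_def sum_nonneg sum_distrib_left sum_distrib_right sum_negf)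
  finally show "cl_comp (cl_vec x * cl_vec x) C = cl_comp (- ((norm x)\<^sup>2 *\<^sub>R 1)) C"
    by simp
qed

lemma cl_basis_ordered_product:
  fixes A :: "'n::{finite,linorder} set"
  shows "cl_basis A = prod_list (map (\<lambda>i. cl_basis {i}) (sorted_list_of_set A))"
proof (induction "card A" arbitrary: A)
  case 0
  then show ?case by (simp add: one_clifford_def)
next
  case (Suc k)
  let ?m = "Min A"
  from Suc(2) have "A \<noteq> {}" by auto
  then have m: "?m \<in> A" by simp
  then have sd: "sym_diff {?m} (A - {?m}) = A" by blast
  have "\<not> b \<le> ?m" if "b \<in> A - {?m}" for b
  proof
    assume "b \<le> ?m"
    moreover have "?m \<le> b" using that by (intro Min_le) auto
    ultimately show False using that by (blast dest: order_antisym)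
  qed
  then have sgn: "cl_sign {?m} (A - {?m}) = 1"
    by (simp add: cl_sign_def)
  have k: "k = card (A - {?m})"
    using Suc(2) m by simp
  have list: "sorted_list_of_set A = ?m # sorted_list_of_set (A - {?m})"
    using \<open>A \<noteq> {}\<close> by (intro sorted_list_of_set_nonempty) simp_all
  have "cl_basis A = cl_sign {?m} (A - {?m}) *\<^sub>R cl_basis (sym_diff {?m} (A - {?m}))"
    unfolding sgn sd by (rule scaleR_one [symmetric])
  also have "\<dots> = cl_basis {?m} * cl_basis (A - {?m})"
    by (rule cl_basis_mult [symmetric])
  also have "\<dots> = prod_list (map (\<lambda>i. cl_basis {i}) (?m # sorted_list_of_set (A - {?m})))"
    unfolding list.map prod_list.Cons Suc(1) [OF k, symmetric] by (rule refl)
  finally show ?case unfolding list [symmetric] .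
qed


section \<open>Partial derivatives and smooth functions\<close>

definition partial :: "'n::finite \<Rightarrow> (real^'n \<Rightarrow> real) \<Rightarrow> real^'n \<Rightarrow> real" where
  "partial i f x = deriv (\<lambda>t. f (x + t *\<^sub>R axis i 1)) 0"

text \<open>
  Only meaningful at interior points of a set on which the partial derivatives involved exist.
  A multi-index is a function \<open>'n \<Rightarrow> nat\<close>; the order of the index type just fixes one of the
  orders of differentiation, which is immaterial for smooth functions.
\<close>

definition multi_partial :: "('n::{finite,linorder} \<Rightarrow> nat) \<Rightarrow> (real^'n::_ \<Rightarrow> real) \<Rightarrow> real^'n::_ \<Rightarrow> real" where
  "multi_partial j f = foldr (\<lambda>i. partial i ^^ j i) (sorted_list_of_set UNIV) f"

abbreviation multi_order :: "('n::finite \<Rightarrow> nat) \<Rightarrow> nat" where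
  "multi_order j \<equiv> \<Sum>i\<in>UNIV. j i"

definition C_inf_on :: "(real^'n) set \<Rightarrow> (real^'n \<Rightarrow> real) set" where
  "C_inf_on \<Omega> = {f. \<forall>is. foldr partial is f differentiable_on \<Omega>}"

definition C_inf_upto_boundary :: "(real^'n::{finite,linorder}) set \<Rightarrow> (real^'n::_ \<Rightarrow> real) set" where
  "C_inf_upto_boundary \<Omega> = {f \<in> C_inf_on \<Omega>.
     \<forall>j. \<exists>g. continuous_on (closure \<Omega>) g \<and> (\<forall>x\<in>\<Omega>. g x = multi_partial j f x)}"

definition test_functions :: "(real^'n) set \<Rightarrow> (real^'n \<Rightarrow> real) set" where
  "test_functions \<Omega> = {\<phi> \<in> C_inf_on UNIV.
     compact (closure {x. \<phi> x \<noteq> 0}) \<and> closure {x. \<phi> x \<noteq> 0} \<subseteq> \<Omega>}"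


section \<open>Bounded domains with \<open>C\<^sup>1\<close> boundary\<close>

text \<open>
  Near every boundary point, \<open>\<Omega>\<close> is the part of a ball above the graph of a \<open>C\<^sup>1\<close> function in
  suitable orthonormal coordinates: the unit vector \<open>v\<close> is the last coordinate direction, and a
  function of the remaining \<open>n - 1\<close> coordinates is a function on the whole space that is constant
  along \<open>v\<close>.
\<close>

definition C1_boundary :: "(real^'n) set \<Rightarrow> bool" where
  "C1_boundary \<Omega> \<longleftrightarrow> (\<forall>x0 \<in> frontier \<Omega>. \<exists>r>0. \<exists>v \<gamma> \<gamma>'. norm v = 1 \<and>
     (\<forall>x. GDERIV \<gamma> x :> \<gamma>' x) \<and> continuous_on UNIV \<gamma>' \<and>
     (\<forall>x t. \<gamma> (x + t *\<^sub>R v) = \<gamma> x) \<and>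
     \<Omega> \<inter> ball x0 r = {x \<in> ball x0 r. x \<bullet> v > \<gamma> x})"

definition is_domain :: "(real^'n) set \<Rightarrow> bool" where
  "is_domain \<Omega> \<longleftrightarrow> open \<Omega> \<and> connected \<Omega> \<and> \<Omega> \<noteq> {}"


section \<open>Sobolev spaces\<close>

definition locally_integrable :: "(real^'n) set \<Rightarrow> (real^'n \<Rightarrow> real) \<Rightarrow> bool" where
  "locally_integrable \<Omega> f \<longleftrightarrow> (\<forall>K. compact K \<and> K \<subseteq> \<Omega> \<longrightarrow> integrable (lebesgue_on K) f)"

definition has_weak_deriv ::
  "(real^'n::{finite,linorder}) set \<Rightarrow> ('n \<Rightarrow> nat) \<Rightarrow> (real^'n::_ \<Rightarrow> real) \<Rightarrow> (real^'n::_ \<Rightarrow> real) \<Rightarrow> bool" where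
  "has_weak_deriv \<Omega> j f g \<longleftrightarrow> locally_integrable \<Omega> f \<and> locally_integrable \<Omega> g \<and>
     (\<forall>\<phi> \<in> test_functions \<Omega>.
        (LINT x|lebesgue_on \<Omega>. f x * multi_partial j \<phi> x)
          = (-1) ^ multi_order j * (LINT x|lebesgue_on \<Omega>. g x * \<phi> x))"

text \<open>Weak derivatives are unique only up to null sets, which the norm below does not see.\<close>

definition weak_deriv ::
  "(real^'n::{finite,linorder}) set \<Rightarrow> ('n \<Rightarrow> nat) \<Rightarrow> (real^'n::_ \<Rightarrow> real) \<Rightarrow> real^'n::_ \<Rightarrow> real" where
  "weak_deriv \<Omega> j f = (SOME g. has_weak_deriv \<Omega> j f g)"

definition Lp_space :: "real \<Rightarrow> (real^'n) set \<Rightarrow> (real^'n \<Rightarrow> real) set" where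
  "Lp_space p \<Omega> = {f \<in> borel_measurable (lebesgue_on \<Omega>).
     integrable (lebesgue_on \<Omega>) (\<lambda>x. \<bar>f x\<bar> powr p)}"

definition Lp_norm :: "real \<Rightarrow> (real^'n) set \<Rightarrow> (real^'n \<Rightarrow> real) \<Rightarrow> real" where
  "Lp_norm p \<Omega> f = (LINT x|lebesgue_on \<Omega>. \<bar>f x\<bar> powr p) powr (1 / p)"

definition sobolev :: "real \<Rightarrow> nat \<Rightarrow> (real^'n::{finite,linorder}) set \<Rightarrow> (real^'n::_ \<Rightarrow> real) set" where
  "sobolev p k \<Omega> = {f. \<forall>j. multi_order j \<le> k \<longrightarrow> (\<exists>g \<in> Lp_space p \<Omega>. has_weak_deriv \<Omega> j f g)}"

text \<open>The norms are real-valued and hence only meaningful on the corresponding Sobolev space.\<close>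

definition sobolev_norm ::
  "real \<Rightarrow> nat \<Rightarrow> (real^'n::{finite,linorder}) set \<Rightarrow> (real^'n::_ \<Rightarrow> real) \<Rightarrow> real" where
  "sobolev_norm p k \<Omega> f =
     (\<Sum>j | multi_order j \<le> k. Lp_norm p \<Omega> (weak_deriv \<Omega> j f) powr p) powr (1 / p)"

lemma finite_multi_indices: "finite {j :: 'n::finite \<Rightarrow> nat. multi_order j \<le> k}"
proof (rule finite_subset)
  have "j i \<le> multi_order j" for j and i :: 'n
    by (rule member_le_sum) auto
  then show "{j :: 'n \<Rightarrow> nat. multi_order j \<le> k} \<subseteq> PiE UNIV (\<lambda>_. {..k})"
    by (auto intro: le_trans)
qed (simp add: finite_PiE)


section \<open>Spaces of \<open>Cl\<^sub>n\<close>-valued functions\<close>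

definition cl_sobolev ::
  "real \<Rightarrow> nat \<Rightarrow> (real^'n::{finite,linorder}) set \<Rightarrow> (real^'n::_ \<Rightarrow> 'n clifford) set" where
  "cl_sobolev p k \<Omega> = {f. \<forall>A. (\<lambda>x. cl_comp (f x) A) \<in> sobolev p k \<Omega>}"

definition cl_sobolev_norm ::
  "real \<Rightarrow> nat \<Rightarrow> (real^'n::{finite,linorder}) set \<Rightarrow> (real^'n::_ \<Rightarrow> 'n clifford) \<Rightarrow> real" where
  "cl_sobolev_norm p k \<Omega> f =
     (\<Sum>A\<in>UNIV. sobolev_norm p k \<Omega> (\<lambda>x. cl_comp (f x) A) powr p) powr (1 / p)"

definition cl_C_inf_upto_boundary ::
  "(real^'n::{finite,linorder}) set \<Rightarrow> (real^'n::_ \<Rightarrow> 'n clifford) set" where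
  "cl_C_inf_upto_boundary \<Omega> = {f. \<forall>A. (\<lambda>x. cl_comp (f x) A) \<in> C_inf_upto_boundary \<Omega>}"

end

theory Submission
  imports Defs "HOL-Library.Sublist"
begin

text \<open>
  The boundary enters only through the segment property: near a boundary point, a small shift in
  the direction \<open>v\<close> of the graph moves the closure of \<open>\<Omega>\<close> into \<open>\<Omega>\<close>. Convolving with a mollifier
  whose support is a small ball around the opposite shift instead of the origin therefore gives functions
  that are smooth on the whole space and whose derivatives on \<open>\<Omega>\<close> near that point are the mollified weak
  derivatives, which converge in \<open>L\<^sup>p\<close> by continuity of translation. These local approximations are
  glued by a partition of unity. No binomial Leibniz formula is needed: it suffices that the derivatives
  of the glued functions converge to something, because by the fundamental lemma of the
  calculus of variations the limits must be the weak derivatives.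
\<close>

section \<open>Calculus of smooth functions\<close>

text \<open>The obstacle is the boundary: a Sobolev function extended by zero usually has no weak
  derivatives across it, so mollification commutes with differentiation only at points x for which
  the support of y |-> \<open>\<kappa> (x - y)\<close> stays inside \<Omega>. Boundedness of
  \<Omega> puts L^p inside L^1; hence one may convolve over the whole space, differentiate under the
  integral sign, and pass to the limit in pairings with test functions. Errors are measured by p-th
  powers of norms, in \<open>ennreal\<close> and on Borel functions. Only convergence to 0 matters,
  so |a + b|^p <= 2^p (|a|^p + |b|^p) can serve as the triangle inequality. Higher derivatives are
  lists of directions, treated one entry at a time. Since \<open>weak_deriv\<close> is a choice
  among functions that agree almost everywhere, the Sobolev norm of a difference can be computed
  only after weak derivatives are known to be unique.\<close>

lemma partial_eqI:
  assumes "(f has_derivative f') (at x)"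
  shows "partial i f x = f' (axis i 1)"
proof -
  have "((\<lambda>t. x + t *\<^sub>R axis i 1) has_derivative (\<lambda>t. t *\<^sub>R axis i 1)) (at 0)"
    by (auto intro!: derivative_eq_intros)
  then have "((\<lambda>t. f (x + t *\<^sub>R axis i 1)) has_derivative (\<lambda>t. f' (t *\<^sub>R axis i 1))) (at 0)"
    by (rule has_derivative_compose) (use assms in simp)
  moreover have "(\<lambda>t. f' (t *\<^sub>R axis i 1)) = (\<lambda>t. f' (axis i 1) * t)"
    using has_derivative_linear[OF assms] by (simp add: linear_cmul mult.commute)
  ultimately have "((\<lambda>t. f (x + t *\<^sub>R axis i 1)) has_field_derivative f' (axis i 1)) (at 0)"
    by (simp add: has_field_derivative_def)
  then show ?thesis
    unfolding partial_def by (rule DERIV_imp_deriv)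
qed

lemma partial_cong_open:
  assumes "open U" "x \<in> U" "\<And>y. y \<in> U \<Longrightarrow> f y = g y"
  shows "partial i f x = partial i g x"
proof -
  have "isCont (\<lambda>t::real. x + t *\<^sub>R axis i 1) 0" by (intro continuous_intros)
  then have "\<forall>\<^sub>F t in nhds 0. x + t *\<^sub>R axis i 1 \<in> U"
    using assms(1,2) by (simp add: continuous_at_open eventually_nhds)
  then have "\<forall>\<^sub>F t in nhds 0. f (x + t *\<^sub>R axis i 1) = g (x + t *\<^sub>R axis i 1)"
    by eventually_elim (use assms(3) in simp)
  then show ?thesis
    unfolding partial_def by (intro deriv_cong_ev) auto
qed

lemma partials_cong_open:
  assumes "open U" "\<And>y. y \<in> U \<Longrightarrow> f y = g y" "x \<in> U"
  shows "foldr partial is f x = foldr partial is g x"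
  using assms(3)
proof (induction "is" arbitrary: x)
  case (Cons i "is")
  then show ?case by (auto intro!: partial_cong_open[OF assms(1)])
qed (use assms(2) in simp)

lemma has_derivative_partials:
  assumes "f differentiable (at x)"
  shows "(f has_derivative (\<lambda>h. \<Sum>i\<in>UNIV. h $ i * partial i f x)) (at x)"
proof -
  from assms obtain f' where f': "(f has_derivative f') (at x)"
    by (auto simp: differentiable_def)
  have "f' h = (\<Sum>i\<in>UNIV. h $ i * partial i f x)" for h
  proof -
    have "f' h = f' (\<Sum>i\<in>UNIV. h $ i *\<^sub>R axis i 1)"
      by (metis basis_expansion scalar_mult_eq_scaleR)
    also have "\<dots> = (\<Sum>i\<in>UNIV. h $ i * f' (axis i 1))"
      using has_derivative_linear[OF f'] by (simp add: linear_sum linear_cmul)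
    finally show ?thesis by (simp add: partial_eqI[OF f'])
  qed
  then have "f' = (\<lambda>h. \<Sum>i\<in>UNIV. h $ i * partial i f x)" by (rule ext)
  with f' show ?thesis by simp
qed

text \<open>Smooth functions form the largest class of differentiable functions that is closed under
  partial derivatives, so any such class \<open>X\<close> may serve as a witness.\<close>

lemma C_inf_coinduct:
  assumes "f \<in> X"
    and "\<And>f. f \<in> X \<Longrightarrow> f differentiable_on UNIV" "\<And>f i. f \<in> X \<Longrightarrow> partial i f \<in> X"
  shows "f \<in> C_inf_on UNIV"
proof -
  have "foldr partial is f \<in> X" for "is"
    by (induction "is") (use assms in auto)
  then show ?thesis using assms(2) by (auto simp: C_inf_on_def)
qed

lemma C_inf_differentiable: "f \<in> C_inf_on UNIV \<Longrightarrow> f differentiable (at x)"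
  unfolding C_inf_on_def differentiable_on_def
  by (drule CollectD, drule spec[of _ "[]"]) simp

lemma C_inf_partial: "f \<in> C_inf_on UNIV \<Longrightarrow> partial i f \<in> C_inf_on UNIV"
  unfolding C_inf_on_def
proof (intro CollectI allI)
  fix "is" assume "f \<in> {f. \<forall>is. foldr partial is f differentiable_on UNIV}"
  \<comment> \<open>\<open>foldr\<close> applies the last list entry first, so appending
    \<open>i\<close> makes it the innermost derivative.\<close>
  then have "foldr partial (is @ [i]) f differentiable_on UNIV" by blast
  then show "foldr partial is (partial i f) differentiable_on UNIV" by simp
qed

lemma C_inf_partials: "f \<in> C_inf_on UNIV \<Longrightarrow> foldr partial is f \<in> C_inf_on UNIV"
  by (induction "is") (auto intro: C_inf_partial)

lemma C_inf_has_derivative: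
  "f \<in> C_inf_on UNIV \<Longrightarrow> (f has_derivative (\<lambda>h. \<Sum>i\<in>UNIV. h $ i * partial i f x)) (at x)"
  by (intro has_derivative_partials C_inf_differentiable)

lemma C_inf_continuous: "f \<in> C_inf_on UNIV \<Longrightarrow> continuous_on S f"
  by (meson C_inf_has_derivative continuous_at_imp_continuous_on has_derivative_continuous)

lemma C_inf_borel: "f \<in> C_inf_on UNIV \<Longrightarrow> f \<in> borel_measurable borel"
  by (intro borel_measurable_continuous_onI C_inf_continuous)

inductive_set alg_closure :: "('a \<Rightarrow> real) set \<Rightarrow> ('a \<Rightarrow> real) set" for X where
  base: "f \<in> X \<Longrightarrow> f \<in> alg_closure X"
| const: "(\<lambda>_. c) \<in> alg_closure X"
| add: "f \<in> alg_closure X \<Longrightarrow> g \<in> alg_closure X \<Longrightarrow> (\<lambda>x. f x + g x) \<in> alg_closure X"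
| mult: "f \<in> alg_closure X \<Longrightarrow> g \<in> alg_closure X \<Longrightarrow> (\<lambda>x. f x * g x) \<in> alg_closure X"

lemma partial_const: "partial i (\<lambda>_. c) = (\<lambda>_. 0)"
  by (rule ext, subst partial_eqI) (auto intro: derivative_intros)

lemma partial_add_at:
  assumes "f differentiable (at x)" "g differentiable (at x)"
  shows "partial i (\<lambda>x. f x + g x) x = partial i f x + partial i g x"
  by (subst partial_eqI[OF has_derivative_add[OF assms[THEN has_derivative_partials]]])
    (simp add: axis_def if_distrib if_distribR cong: if_cong)

lemma partial_mult_at:
  assumes "f differentiable (at x)" "g differentiable (at x)"
  shows "partial i (\<lambda>x. f x * g x) x = partial i f x * g x + f x * partial i g x"
  by (subst partial_eqI[OF has_derivative_mult[OF assms[THEN has_derivative_partials]]])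
    (simp add: axis_def if_distrib if_distribR cong: if_cong)

text \<open>Coinduction up to sums and products: the derivatives of the generators need only lie in
  the algebra which the generators generate.\<close>

lemma alg_closure_C_inf:
  assumes "\<And>f. f \<in> X \<Longrightarrow> f differentiable_on UNIV"
    and "\<And>f i. f \<in> X \<Longrightarrow> partial i f \<in> alg_closure X"
    and "f \<in> alg_closure X"
  shows "f \<in> C_inf_on UNIV"
proof (rule C_inf_coinduct[OF assms(3)])
  have "f differentiable_on UNIV \<and> (\<forall>i. partial i f \<in> alg_closure X)"
    if "f \<in> alg_closure X" for f
    using that
  proof induction
    case (base f) then show ?case using assms by auto
  next
    case (const c) show ?case by (simp add: partial_const alg_closure.const)
  next
    case (add f g)
    then have "partial i (\<lambda>x. f x + g x) = (\<lambda>x. partial i f x + partial i g x)" for i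
      by (auto simp: differentiable_on_def intro!: partial_add_at)
    with add show ?case by (auto intro!: alg_closure.add)
  next
    case (mult f g)
    then have "partial i (\<lambda>x. f x * g x) = (\<lambda>x. partial i f x * g x + f x * partial i g x)" for i
      by (auto simp: differentiable_on_def intro!: partial_mult_at)
    with mult show ?case by (auto intro!: alg_closure.add alg_closure.mult)
  qed
  then show "\<And>f. f \<in> alg_closure X \<Longrightarrow> f differentiable_on UNIV"
    "\<And>f i. f \<in> alg_closure X \<Longrightarrow> partial i f \<in> alg_closure X" by auto
qed

lemma C_inf_alg_closure: "f \<in> alg_closure (C_inf_on UNIV) \<Longrightarrow> f \<in> C_inf_on UNIV"
  by (rule alg_closure_C_inf)
    (auto intro: alg_closure.base C_inf_partial C_inf_differentiable simp: differentiable_on_def)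

lemma C_inf_const [intro, simp]: "(\<lambda>_. c) \<in> C_inf_on UNIV"
  by (rule C_inf_alg_closure[OF alg_closure.const])

lemma C_inf_add: "f \<in> C_inf_on UNIV \<Longrightarrow> g \<in> C_inf_on UNIV \<Longrightarrow> (\<lambda>x. f x + g x) \<in> C_inf_on UNIV"
  by (rule C_inf_alg_closure[OF alg_closure.add[OF alg_closure.base alg_closure.base]])

lemma C_inf_mult: "f \<in> C_inf_on UNIV \<Longrightarrow> g \<in> C_inf_on UNIV \<Longrightarrow> (\<lambda>x. f x * g x) \<in> C_inf_on UNIV"
  by (rule C_inf_alg_closure[OF alg_closure.mult[OF alg_closure.base alg_closure.base]])

lemma C_inf_diff: "f \<in> C_inf_on UNIV \<Longrightarrow> g \<in> C_inf_on UNIV \<Longrightarrow> (\<lambda>x. f x - g x) \<in> C_inf_on UNIV"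
  using C_inf_add[OF _ C_inf_mult[OF C_inf_const, of g "-1"], of f] by simp

lemma C_inf_sum: "(\<And>a. a \<in> A \<Longrightarrow> f a \<in> C_inf_on UNIV) \<Longrightarrow> (\<lambda>x. \<Sum>a\<in>A. f a x) \<in> C_inf_on UNIV"
  by (induction A rule: infinite_finite_induct) (auto intro: C_inf_add)

lemma C_inf_prod: "(\<And>a. a \<in> A \<Longrightarrow> f a \<in> C_inf_on UNIV) \<Longrightarrow> (\<lambda>x. \<Prod>a\<in>A. f a x) \<in> C_inf_on UNIV"
  by (induction A rule: infinite_finite_induct) (auto intro: C_inf_mult)

lemma partial_add:
  assumes "f \<in> C_inf_on UNIV" "g \<in> C_inf_on UNIV"
  shows "partial i (\<lambda>x. f x + g x) = (\<lambda>x. partial i f x + partial i g x)"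
  using assms by (auto intro!: partial_add_at C_inf_differentiable)

lemma partial_mult:
  assumes "f \<in> C_inf_on UNIV" "g \<in> C_inf_on UNIV"
  shows "partial i (\<lambda>x. f x * g x) = (\<lambda>x. partial i f x * g x + f x * partial i g x)"
  using assms by (auto intro!: partial_mult_at C_inf_differentiable)

lemma partials_add:
  assumes "f \<in> C_inf_on UNIV" "g \<in> C_inf_on UNIV"
  shows "foldr partial is (\<lambda>x. f x + g x) = (\<lambda>x. foldr partial is f x + foldr partial is g x)"
  using assms by (induction "is") (simp_all add: partial_add C_inf_partials)

lemma partials_const_0: "foldr partial is (\<lambda>_. 0) = (\<lambda>_. 0)"
  by (induction "is") (simp_all add: partial_const)

lemma partials_sum:
  assumes "\<And>a. a \<in> A \<Longrightarrow> f a \<in> C_inf_on UNIV"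
  shows "foldr partial is (\<lambda>x. \<Sum>a\<in>A. f a x) = (\<lambda>x. \<Sum>a\<in>A. foldr partial is (f a) x)"
  using assms
  by (induction A rule: infinite_finite_induct) (simp_all add: partials_const_0 partials_add C_inf_sum)

section \<open>Affine substitutions, needed for the reflected kernel y |->
  \<open>\<kappa> (x - y)\<close>\<close>

lemma has_derivative_affine:
  assumes "f differentiable (at (a + b *\<^sub>R x))"
  shows "((\<lambda>x. f (a + b *\<^sub>R x)) has_derivative
    (\<lambda>h. \<Sum>i\<in>UNIV. (b *\<^sub>R h) $ i * partial i f (a + b *\<^sub>R x))) (at x)"
  by (rule has_derivative_compose[where f = "\<lambda>x. a + b *\<^sub>R x", OF _ has_derivative_partials[OF assms]])
    (auto intro!: derivative_eq_intros)

lemma partial_affine: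
  assumes "f \<in> C_inf_on UNIV"
  shows "partial i (\<lambda>x. f (a + b *\<^sub>R x)) = (\<lambda>x. b * partial i f (a + b *\<^sub>R x))"
  by (rule ext, subst partial_eqI[OF has_derivative_affine[OF C_inf_differentiable[OF assms]]])
    (simp add: axis_def if_distrib if_distribR cong: if_cong)

lemma C_inf_affine:
  assumes "f \<in> C_inf_on UNIV"
  shows "(\<lambda>x. f (a + b *\<^sub>R x)) \<in> C_inf_on UNIV"
proof (rule alg_closure_C_inf[where X = "{\<lambda>x. f (a + b *\<^sub>R x) | f. f \<in> C_inf_on UNIV}"])
  fix g i assume "g \<in> {\<lambda>x. f (a + b *\<^sub>R x) | f. f \<in> C_inf_on UNIV}"
  then obtain f where f: "g = (\<lambda>x. f (a + b *\<^sub>R x))" "f \<in> C_inf_on UNIV" by blast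
  show "g differentiable_on UNIV"
    using has_derivative_affine[OF C_inf_differentiable[OF f(2)]]
    unfolding f(1) differentiable_on_def differentiable_def by blast
  show "partial i g \<in> alg_closure {\<lambda>x. f (a + b *\<^sub>R x) | f. f \<in> C_inf_on UNIV}"
    unfolding f(1) partial_affine[OF f(2)]
    using C_inf_partial[OF f(2)]
    by (intro alg_closure.mult alg_closure.const alg_closure.base) auto
qed (use assms in \<open>auto intro: alg_closure.base\<close>)

lemma partials_affine:
  assumes "f \<in> C_inf_on UNIV"
  shows "foldr partial is (\<lambda>x. f (a + b *\<^sub>R x)) = (\<lambda>x. b ^ length is * foldr partial is f (a + b *\<^sub>R x))"
proof (induction "is")
  case (Cons i "is")
  have g: "foldr partial is f \<in> C_inf_on UNIV" using assms by (rule C_inf_partials)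
  have "partial i (\<lambda>x. b ^ length is * foldr partial is f (a + b *\<^sub>R x))
      = (\<lambda>x. b ^ length is * partial i (\<lambda>x. foldr partial is f (a + b *\<^sub>R x)) x)"
    using partial_mult[OF C_inf_const[of "b ^ length is"] C_inf_affine[OF g]]
    by (simp add: partial_const)
  then show ?case using Cons g by (simp add: partial_affine mult_ac)
qed simp

text \<open>Flattens a multi-index into the directions that \<open>multi_partial\<close> applies, in
  the same order. Lists allow induction on single derivatives, which multi-indices do not offer
  directly.\<close>

definition multi_list :: "('n::{finite,linorder} \<Rightarrow> nat) \<Rightarrow> 'n list" where
  "multi_list j = concat (map (\<lambda>i. replicate (j i) i) (sorted_list_of_set UNIV))"

lemma multi_partial_eq: "multi_partial j f = foldr partial (multi_list j) f"
proof -
  have "foldr (\<lambda>i. partial i ^^ j i) L f = foldr partial (concat (map (\<lambda>i. replicate (j i) i) L)) f" for L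
    by (induction L) simp_all
  then show ?thesis unfolding multi_partial_def multi_list_def by blast
qed

lemma length_multi_list: "length (multi_list j) = multi_order j"
proof -
  have "length (multi_list j) = sum_list (map j (sorted_list_of_set UNIV))"
    by (simp add: multi_list_def length_concat comp_def)
  also have "\<dots> = multi_order j"
    by (simp add: sum_list_distinct_conv_sum_set)
  finally show ?thesis .
qed

lemma subseq_replicateD:
  assumes "subseq xs (replicate n a)"
  shows "\<exists>m\<le>n. xs = replicate m a"
proof (intro exI conjI)
  show "length xs \<le> n" using list_emb_length[OF assms] by simp
  have "\<forall>x\<in>set xs. x = a" 
    by (intro ballI) (erule list_emb_set[OF assms], simp)
  then show "xs = replicate (length xs) a" by (metis replicate_length_same)
qed

text \<open>In the product rule, the derivatives that fall on one factor form a subsequence of the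
  list. Such a subsequence again consists of sorted blocks, so it comes from a multi-index of no
  larger order and the hypotheses on weak derivatives apply to it.\<close>

lemma subseq_multi_list:
  assumes "subseq js (multi_list j)"
  shows "\<exists>j'. js = multi_list j' \<and> multi_order j' \<le> multi_order j"
proof -
  have "\<exists>j'. js = concat (map (\<lambda>i. replicate (j' i) i) L) \<and> (\<forall>i. j' i \<le> j i)"
    if "distinct L" "subseq js (concat (map (\<lambda>i. replicate (j i) i) L))" for L
    using that
  proof (induction L arbitrary: js)
    case Nil
    then show ?case by (auto intro!: exI[of _ "\<lambda>_. 0"])
  next
    case (Cons a L)
    then obtain xs ys where js: "js = xs @ ys" "subseq xs (replicate (j a) a)"
      "subseq ys (concat (map (\<lambda>i. replicate (j i) i) L))"
      by (auto elim!: subseq_appendE)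
    obtain m where m: "m \<le> j a" "xs = replicate m a" using subseq_replicateD[OF js(2)] by blast
    obtain j' where j': "ys = concat (map (\<lambda>i. replicate (j' i) i) L)" "\<forall>i. j' i \<le> j i"
      using Cons js(3) by auto
    \<comment> \<open>Distinctness keeps \<open>a\<close> out of \<open>L\<close>, so changing
      \<open>j'\<close> at \<open>a\<close> leaves the remaining blocks alone.\<close>
    have eq: "map (\<lambda>i. replicate (j' i) i) L = map (\<lambda>i. replicate ((j'(a := m)) i) i) L"
      using Cons.prems(1) by (intro map_cong) auto
    have "js = concat (map (\<lambda>i. replicate ((j'(a := m)) i) i) (a # L))"
      unfolding js(1) m(2) j'(1) eq by simp
    moreover have "\<forall>i. (j'(a := m)) i \<le> j i" using m(1) j'(2) by simp
    ultimately show ?case by blast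
  qed
  from this[of "sorted_list_of_set UNIV"] assms obtain j' where
    "js = multi_list j'" "\<forall>i. j' i \<le> j i"
    unfolding multi_list_def by auto
  then show ?thesis by (intro exI[of _ j']) (simp add: sum_mono)
qed

section \<open>Mollifiers\<close>

text \<open>The classical flat function e^(-1/s) is the case k = 0. The factors s^(-k) are included
  because its derivatives produce them: the linear span of the family is closed under
  differentiation.\<close>

definition flat_exp :: "nat \<Rightarrow> real \<Rightarrow> real" where
  "flat_exp k s = (if s > 0 then inverse s ^ k * exp (- inverse s) else 0)"

lemma flat_exp_simps: "s \<le> 0 \<Longrightarrow> flat_exp k s = 0" "s > 0 \<Longrightarrow> flat_exp k s > 0" "flat_exp k s \<ge> 0"
  by (auto simp: flat_exp_def)

text \<open>Away from 0 this is the product rule. The content lies at s = 0, where exponential decay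
  beats every power of 1/s, so that both sides vanish.\<close>

lemma DERIV_flat_exp:
  "(flat_exp k has_field_derivative - real k * flat_exp (k + 1) s + flat_exp (k + 2) s) (at s)"
proof -
  consider "s > 0" | "s < 0" | "s = 0" by linarith
  then show ?thesis
  proof cases
    case 1
    have D: "((\<lambda>s. inverse s ^ k * exp (- inverse s)) has_field_derivative
        - (real k * (inverse s ^ (k - 1) * (inverse s)\<^sup>2)) * exp (- inverse s)
        + inverse s ^ (k + 2) * exp (- inverse s)) (at s)"
      using 1 by (auto intro!: derivative_eq_intros simp: power2_eq_square algebra_simps)
    \<comment> \<open>For k = 0 the truncated exponent k - 1 is harmless, because the factor k
      vanishes.\<close>
    have eq: "real k * (inverse s ^ (k - 1) * (inverse s)\<^sup>2) = real k * inverse s ^ (k + 1)"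
      by (cases k) (simp_all add: power2_eq_square)
    have "((\<lambda>s. inverse s ^ k * exp (- inverse s)) has_field_derivative
        - real k * flat_exp (k + 1) s + flat_exp (k + 2) s) (at s)"
      using D[unfolded eq] 1 by (simp add: flat_exp_def mult.assoc)
    then show ?thesis
      by (rule has_field_derivative_transform_within_open[where S = "{0<..}"])
        (use 1 in \<open>auto simp: flat_exp_def\<close>)
  next
    case 2
    have "((\<lambda>s. 0) has_field_derivative - real k * flat_exp (k + 1) s + flat_exp (k + 2) s) (at s)"
      using 2 by (auto simp: flat_exp_def)
    then show ?thesis
      by (rule has_field_derivative_transform_within_open[where S = "{..<0}"])
        (use 2 in \<open>auto simp: flat_exp_def\<close>)
  next
    case 3
    \<comment> \<open>With h = 1/x the right-hand difference quotient at 0 becomes x^(k+1) / e^x,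
      which is why the exponential limit is taken for \<open>Suc k\<close>.\<close>
    have "((\<lambda>x. inverse (inverse x) ^ k * exp (- inverse (inverse x)) / inverse x) \<longlongrightarrow> (0::real)) at_top"
      using tendsto_power_div_exp_0[of "Suc k"]
      by (rule Lim_transform_eventually)
        (auto intro!: eventually_at_top_linorderI[of 1] simp: exp_minus field_simps)
    then have "((\<lambda>h. inverse h ^ k * exp (- inverse h) / h) \<longlongrightarrow> 0) (at_right (0::real))"
      by (subst filterlim_at_right_to_top) simp
    then have "((\<lambda>h. flat_exp k h / h) \<longlongrightarrow> 0) (at_right 0)"
      by (rule Lim_transform_eventually)
        (auto simp: flat_exp_def eventually_at_filter)
    moreover have "((\<lambda>h. flat_exp k h / h) \<longlongrightarrow> 0) (at_left 0)"
      by (rule Lim_transform_eventually[OF tendsto_const])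
        (auto simp: flat_exp_def eventually_at_filter)
    ultimately have "((\<lambda>h. flat_exp k h / h) \<longlongrightarrow> 0) (at 0)"
      by (simp add: filterlim_split_at)
    then show ?thesis
      using 3 by (simp add: DERIV_def flat_exp_def)
  qed
qed

lemma has_derivative_flat_exp_coord:
  "((\<lambda>x::real^'n. flat_exp k (a + b * x $ i)) has_derivative
     (\<lambda>h. (- real k * flat_exp (k + 1) (a + b * x $ i) + flat_exp (k + 2) (a + b * x $ i)) * (b * h $ i))) (at x)"
proof -
  have "((\<lambda>x::real^'n. a + b * x $ i) has_derivative (\<lambda>h. b * h $ i)) (at x)"
    by (auto intro!: derivative_eq_intros bounded_linear_imp_has_derivative bounded_linear_vec_nth)
  from has_derivative_compose[OF this DERIV_flat_exp[THEN DERIV_D, unfolded DERIV_def[symmetric],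
      unfolded has_field_derivative_def]]
  show ?thesis by simp
qed

text \<open>The generators must range over all \<open>k\<close>, since one derivative leads to the
  indices k + 1 and k + 2.\<close>

lemma C_inf_flat_exp_coord: "(\<lambda>x. flat_exp k (a + b * x $ i)) \<in> C_inf_on UNIV"
proof (rule alg_closure_C_inf[where X = "{\<lambda>x. flat_exp k (a + b * x $ i) | k a b i. True}"])
  fix f :: "real^'n \<Rightarrow> real" and j :: 'n
  assume "f \<in> {\<lambda>x. flat_exp k (a + b * x $ i) | k a b i. True}"
  then obtain k a b i where f: "f = (\<lambda>x. flat_exp k (a + b * x $ i))" by blast
  show "f differentiable_on UNIV"
    unfolding f differentiable_on_def differentiable_def using has_derivative_flat_exp_coord by blast
  have "partial j f = (\<lambda>x. b * axis j 1 $ i * (- real k * flat_exp (k + 1) (a + b * x $ i) + flat_exp (k + 2) (a + b * x $ i)))"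
    unfolding f by (rule ext, subst partial_eqI[OF has_derivative_flat_exp_coord]) simp
  moreover have "\<dots> \<in> alg_closure {\<lambda>x. flat_exp k (a + b * x $ i) | k a b i. True}"
    by (intro alg_closure.mult alg_closure.add alg_closure.const alg_closure.base) blast+
  ultimately show "partial j f \<in> alg_closure {\<lambda>x. flat_exp k (a + b * x $ i) | k a b i. True}" by simp
qed (blast intro: alg_closure.base)

text \<open>The centre \<open>w\<close> is arbitrary, so that one convolution both translates and mollifies.\<close>

definition mollifier :: "real^'n \<Rightarrow> real \<Rightarrow> (real^'n \<Rightarrow> real) set" where
  "mollifier w \<delta> = {\<kappa> \<in> C_inf_on UNIV. (\<forall>z. 0 \<le> \<kappa> z) \<and> (\<forall>z. \<kappa> z \<noteq> 0 \<longrightarrow> dist z w \<le> \<delta>) \<and>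
     integral\<^sup>L lborel \<kappa> = 1}"

lemma C_inf_bounded_support_integrable:
  assumes "f \<in> C_inf_on UNIV" "\<And>x. f x \<noteq> 0 \<Longrightarrow> x \<in> cball a r"
  shows "integrable lborel f"
proof -
  have "integrable lborel (\<lambda>x. indicator (cball a r) x *\<^sub>R f x)"
    using borel_integrable_compact[OF compact_cball C_inf_continuous[OF assms(1)], of a r]
    by (simp add: set_integrable_def)
  moreover have "(\<lambda>x. indicator (cball a r) x *\<^sub>R f x) = f"
    using assms(2) by (fastforce simp: indicator_def)
  ultimately show ?thesis by simp
qed

text \<open>A product of one-dimensional bumps, one per coordinate, is positive exactly on an open
  cube around \<open>w\<close>; dividing by its integral normalises it. With a product of
  coordinates, closure of smooth functions under multiplication is enough, and no composition with
  the norm has to be differentiated.\<close>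

lemma mollifier_exists:
  fixes w :: "real^'n"
  assumes "\<delta> > 0"
  shows "mollifier w \<delta> \<noteq> {}"
proof -
  \<comment> \<open>The cube has half-width 1/b = \<delta>/n, so its points differ from
    \<open>w\<close> by at most \<delta> in the sum norm and hence in the Euclidean norm.\<close>
  define b where "b = real CARD('n) / \<delta>"
  have b: "b > 0" using assms by (simp add: b_def)
  define \<beta> where "\<beta> z = (\<Prod>i\<in>UNIV. flat_exp 0 (1 - b * w $ i + b * z $ i) * flat_exp 0 (1 + b * w $ i + (- b) * z $ i))" for z
  have smooth: "\<beta> \<in> C_inf_on UNIV"
    unfolding \<beta>_def by (intro C_inf_prod C_inf_mult C_inf_flat_exp_coord)
  have nonneg: "\<beta> z \<ge> 0" for z
    unfolding \<beta>_def by (intro prod_nonneg mult_nonneg_nonneg ballI flat_exp_simps(3))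
  have supp: "z \<in> cball w \<delta>" if "\<beta> z \<noteq> 0" for z
  proof -
    have "\<bar>(z - w) $ i\<bar> \<le> \<delta> / real CARD('n)" for i
    proof -
      have "flat_exp 0 (1 - b * w $ i + b * z $ i) \<noteq> 0" "flat_exp 0 (1 + b * w $ i + (- b) * z $ i) \<noteq> 0"
        using that by (auto simp: \<beta>_def)
      then have "0 < 1 - b * w $ i + b * z $ i" "0 < 1 + b * w $ i + (- b) * z $ i"
        by (metis flat_exp_simps(1) not_le)+
      then have "\<bar>b * (z - w) $ i\<bar> \<le> 1" by (simp add: abs_le_iff algebra_simps)
      then have "b * \<bar>(z - w) $ i\<bar> \<le> 1" using b by (simp add: abs_mult)
      then show ?thesis using b assms by (simp add: b_def field_simps)
    qed
    then have "(\<Sum>i\<in>UNIV. \<bar>(z - w) $ i\<bar>) \<le> (\<Sum>i\<in>(UNIV::'n set). \<delta> / real CARD('n))"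
      by (intro sum_mono)
    also have "\<dots> = \<delta>" by simp
    finally have "norm (z - w) \<le> \<delta>" using norm_le_l1_cart[of "z - w"] by linarith
    then show ?thesis by (simp add: dist_norm norm_minus_commute)
  qed
  have int: "integrable lborel \<beta>"
    by (rule C_inf_bounded_support_integrable[OF smooth supp])
  have "integral\<^sup>L lborel \<beta> \<noteq> 0"
  proof
    assume "integral\<^sup>L lborel \<beta> = 0"
    then have "AE x in lborel. \<beta> x = 0"
      using integral_nonneg_eq_0_iff_AE[OF int] nonneg by simp
    \<comment> \<open>If the integral were 0, the function would vanish almost everywhere; but it is
      positive on an open set containing \<open>w\<close>, and a nonempty open set is not
      negligible.\<close>
    moreover have "open (\<beta> -` {0<..})"
      using C_inf_continuous[OF smooth] by (intro open_vimage) auto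
    moreover have "w \<in> \<beta> -` {0<..}"
      by (auto simp: \<beta>_def intro!: zero_less_power mult_pos_pos flat_exp_simps(2))
    ultimately have "\<not> negligible (\<beta> -` {0<..})"
      by (intro open_not_negligible) auto
    moreover have "{x \<in> space lborel. \<beta> x \<noteq> 0} \<in> null_sets lborel"
      using \<open>AE x in lborel. \<beta> x = 0\<close> C_inf_borel[OF smooth]
      by (subst AE_iff_null[symmetric]) auto
    then have "negligible {x. \<beta> x \<noteq> 0}"
      by (simp add: negligible_iff_null_sets null_sets_completionI)
    then have "negligible (\<beta> -` {0<..})" by (rule negligible_subset) auto
    ultimately show False by simp
  qed
  then have pos: "integral\<^sup>L lborel \<beta> > 0"
    using integral_nonneg_AE[of \<beta> lborel] nonneg by fastforce
  have "(\<lambda>z. inverse (integral\<^sup>L lborel \<beta>) * \<beta> z) \<in> mollifier w \<delta>"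
    using pos supp nonneg
    by (auto simp: mollifier_def dist_commute intro!: C_inf_mult smooth)
  then show ?thesis by blast
qed

section \<open>Convolution\<close>

lemma distr_lborel_reflect: "distr lborel borel (\<lambda>y. x - y) = (lborel :: 'a::euclidean_space measure)"
  using lborel_affine[of "-1" x] by (simp add: density_1)

lemma integral_lborel_reflect:
  fixes x :: "'a::euclidean_space" and g :: "'a \<Rightarrow> real"
  assumes "g \<in> borel_measurable borel"
  shows "(LINT y|lborel. g (x - y)) = (LINT y|lborel. g y)"
  using integral_distr[of "\<lambda>y. x - y" lborel borel g] assms by (simp add: distr_lborel_reflect)

lemma integrable_lborel_reflect:
  fixes x :: "'a::euclidean_space" and g :: "'a \<Rightarrow> real"
  assumes "integrable lborel g"
  shows "integrable lborel (\<lambda>y. g (x - y))"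
  using integrable_distr_eq[of "\<lambda>y. x - y" lborel borel g] assms by (simp add: distr_lborel_reflect)

text \<open>Off a closed set the function vanishes on an open neighbourhood of each point, and
  derivatives depend only on such neighbourhoods.\<close>

lemma partials_closed_support:
  assumes "closed S" "\<And>x. f x \<noteq> 0 \<Longrightarrow> x \<in> S" "foldr partial is f x \<noteq> 0"
  shows "x \<in> S"
proof (rule ccontr)
  assume "x \<notin> S"
  then have "foldr partial is f x = foldr partial is (\<lambda>_. 0) x"
    using assms(1,2) by (intro partials_cong_open[where U = "- S"]) auto
  with assms(3) show False by (simp add: partials_const_0)
qed

lemma partial_closed_support:
  assumes "closed S" "\<And>x. f x \<noteq> 0 \<Longrightarrow> x \<in> S" "partial i f x \<noteq> 0"
  shows "x \<in> S"
  using partials_closed_support[of S f "[i]" x] assms by simp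

lemma C_inf_bounded:
  assumes "f \<in> C_inf_on UNIV" "\<And>x. f x \<noteq> 0 \<Longrightarrow> x \<in> cball a r"
  shows "\<exists>B\<ge>0. \<forall>x. \<bar>f x\<bar> \<le> B"
proof -
  have "compact (f ` cball a r)"
    by (intro compact_continuous_image C_inf_continuous assms compact_cball)
  then have "bounded (f ` cball a r)" by (rule compact_imp_bounded)
  then obtain B where B: "\<And>x. x \<in> cball a r \<Longrightarrow> \<bar>f x\<bar> \<le> B"
    by (force simp: bounded_iff)
  have "\<bar>f x\<bar> \<le> max B 0" for x
    using B[of x] assms(2)[of x] by (cases "f x = 0") auto
  then show ?thesis by (intro exI[of _ "max B 0"]) simp
qed

text \<open>Supplies the domination needed to differentiate a convolution: the increment and its
  linear part are bounded by the same multiple of \<open>norm h\<close>, uniformly in the base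
  point.\<close>

lemma C_inf_Lipschitz:
  assumes f: "f \<in> C_inf_on UNIV" "\<And>x. f x \<noteq> 0 \<Longrightarrow> x \<in> cball a r"
  shows "\<exists>B\<ge>0. \<forall>x h. \<bar>f (x + h) - f x\<bar> \<le> B * norm h \<and>
    \<bar>\<Sum>i\<in>UNIV. h $ i * partial i f x\<bar> \<le> B * norm h"
proof -
  have "\<exists>B. B \<ge> 0 \<and> (\<forall>x. \<bar>partial i f x\<bar> \<le> B)" for i
  proof -
    have "x \<in> cball a r" if "partial i f x \<noteq> 0" for x
      using partial_closed_support[OF closed_cball f(2) that] .
    then show ?thesis using C_inf_bounded[OF C_inf_partial[OF f(1)]] by metis
  qed
  then obtain B where B: "\<And>i. B i \<ge> 0" "\<And>i x. \<bar>partial i f x\<bar> \<le> B i" by metis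
  have bd: "\<bar>\<Sum>i\<in>UNIV. h $ i * partial i f x\<bar> \<le> sum B UNIV * norm h" for x h
  proof -
    have "\<bar>\<Sum>i\<in>UNIV. h $ i * partial i f x\<bar> \<le> (\<Sum>i\<in>UNIV. \<bar>h $ i * partial i f x\<bar>)"
      by (rule sum_abs)
    also have "\<dots> \<le> (\<Sum>i\<in>UNIV. norm h * B i)"
      by (intro sum_mono) (auto simp: abs_mult intro!: mult_mono B component_le_norm_cart)
    finally show ?thesis by (simp add: sum_distrib_left mult.commute[of _ "norm h"])
  qed
  have "\<bar>f (x + h) - f x\<bar> \<le> sum B UNIV * norm h" for x h
  proof -
    have "onorm (\<lambda>h. \<Sum>i\<in>UNIV. h $ i * partial i f y) \<le> sum B UNIV" for y
      by (rule onorm_bound) (use bd B(1) in \<open>auto intro: sum_nonneg\<close>)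
    then have "norm (f (x + h) - f x) \<le> sum B UNIV * norm (x + h - x)"
      by (intro differentiable_bound[OF convex_UNIV, of f "\<lambda>x h. \<Sum>i\<in>UNIV. h $ i * partial i f x"])
        (auto intro: C_inf_has_derivative[OF f(1)])
    then show ?thesis by simp
  qed
  moreover have "sum B UNIV \<ge> 0" by (intro sum_nonneg B(1))
  ultimately show ?thesis using bd by blast
qed

definition conv :: "(real^'n \<Rightarrow> real) \<Rightarrow> (real^'n \<Rightarrow> real) \<Rightarrow> real^'n \<Rightarrow> real" where
  "conv \<kappa> f x = (LINT y|lborel. \<kappa> (x - y) * f y)"

lemma conv_integrable:
  assumes "\<kappa> \<in> C_inf_on UNIV" "\<And>x. \<kappa> x \<noteq> 0 \<Longrightarrow> x \<in> cball a r" "integrable lborel f"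
  shows "integrable lborel (\<lambda>y. \<kappa> (x - y) * f y)"
proof -
  obtain B where B: "B \<ge> 0" "\<And>x. \<bar>\<kappa> x\<bar> \<le> B" using C_inf_bounded[OF assms(1,2)] by blast
  have [measurable]: "\<kappa> \<in> borel_measurable borel" "f \<in> borel_measurable borel"
    using C_inf_borel[OF assms(1)] assms(3) by auto
  show ?thesis
    by (rule Bochner_Integration.integrable_bound[where f = "\<lambda>y. B * f y"])
      (use assms(3) B in \<open>auto simp: abs_mult intro!: mult_right_mono\<close>)
qed

text \<open>Differentiation under the integral sign. The remainder quotient of the kernel tends to 0
  pointwise and is at most 2B, so 2B|f| dominates the integrands.\<close>

lemma conv_has_derivative:
  assumes "\<kappa> \<in> C_inf_on UNIV" "\<And>x. \<kappa> x \<noteq> 0 \<Longrightarrow> x \<in> cball a r" "integrable lborel f"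
  shows "(conv \<kappa> f has_derivative (\<lambda>h. \<Sum>i\<in>UNIV. h $ i * conv (partial i \<kappa>) f x)) (at x)"
proof -
  obtain B where B: "B \<ge> 0" "\<And>x h. \<bar>\<kappa> (x + h) - \<kappa> x\<bar> \<le> B * norm h"
    "\<And>x h. \<bar>\<Sum>i\<in>UNIV. h $ i * partial i \<kappa> x\<bar> \<le> B * norm h"
    using C_inf_Lipschitz[OF assms(1,2)] by blast
  have [measurable]: "\<kappa> \<in> borel_measurable borel" "f \<in> borel_measurable borel"
    "\<And>i. partial i \<kappa> \<in> borel_measurable borel"
    using assms(3) by (auto intro!: C_inf_borel C_inf_partial assms(1))
  have supp: "x \<in> cball a r" if "partial i \<kappa> x \<noteq> 0" for i x
    using partial_closed_support[OF closed_cball assms(2) that] .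
  note int = conv_integrable[OF assms] conv_integrable[OF C_inf_partial[OF assms(1)] supp assms(3)]
  \<comment> \<open>First-order Taylor remainder of the kernel at x - y, relative to the length of
    h.\<close>
  let ?R = "\<lambda>h y. (\<kappa> (x + h - y) - \<kappa> (x - y) - (\<Sum>i\<in>UNIV. h $ i * partial i \<kappa> (x - y))) / norm h"
  have lim: "((\<lambda>h. (conv \<kappa> f (x + h) - conv \<kappa> f x - (\<Sum>i\<in>UNIV. h $ i * conv (partial i \<kappa>) f x)) / norm h)
      \<longlongrightarrow> 0) (at 0)"
    unfolding tendsto_at_iff_sequentially comp_def
  proof (intro allI impI)
    \<comment> \<open>Dominated convergence speaks about sequences, so the limit at 0 is tested
      along null sequences.\<close>
    fix X :: "nat \<Rightarrow> real^'a" assume X: "\<forall>n. X n \<in> UNIV - {0}" "X \<longlonglongrightarrow> 0"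
    have "(\<lambda>n. LINT y|lborel. ?R (X n) y * f y) \<longlonglongrightarrow> (LINT y|(lborel :: (real^'a) measure). 0)"
    proof (rule integral_dominated_convergence[where f = "\<lambda>_. 0" and w = "\<lambda>y. 2 * B * \<bar>f y\<bar>"])
      show "integrable lborel (\<lambda>y. 2 * B * \<bar>f y\<bar>)" using assms(3) by auto
      show "AE y in lborel. (\<lambda>n. ?R (X n) y * f y) \<longlonglongrightarrow> 0"
      proof (rule AE_I2)
        fix y
        have "((\<lambda>h. (\<kappa> (x - y + h) - \<kappa> (x - y) - (\<Sum>i\<in>UNIV. h $ i * partial i \<kappa> (x - y))) / norm h) \<longlongrightarrow> 0) (at 0)"
          using C_inf_has_derivative[OF assms(1), of "x - y"]
          by (subst tendsto_norm_zero_iff[symmetric]) (simp add: has_derivative_at)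
        with X have "(\<lambda>n. ?R (X n) y) \<longlonglongrightarrow> 0"
          unfolding tendsto_at_iff_sequentially comp_def by (simp add: algebra_simps)
        then show "(\<lambda>n. ?R (X n) y * f y) \<longlonglongrightarrow> 0" by (rule tendsto_mult_left_zero)
      qed
      show "AE y in lborel. norm (?R (X n) y * f y) \<le> 2 * B * \<bar>f y\<bar>" for n
      proof (rule AE_I2)
        fix y
        have "\<bar>\<kappa> (x + X n - y) - \<kappa> (x - y) - (\<Sum>i\<in>UNIV. X n $ i * partial i \<kappa> (x - y))\<bar> \<le> 2 * B * norm (X n)"
          using B(2)[of "x - y" "X n"] B(3)[of "X n" "x - y"] by (simp add: algebra_simps)
        then have "\<bar>?R (X n) y\<bar> \<le> 2 * B"
          using X(1) by (simp add: field_simps)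
        then show "norm (?R (X n) y * f y) \<le> 2 * B * \<bar>f y\<bar>"
          by (simp only: real_norm_def abs_mult) (rule mult_right_mono, auto)
      qed
    qed measurable
    moreover have eq: "(LINT y|lborel. ?R (X n) y * f y) =
        (conv \<kappa> f (x + X n) - conv \<kappa> f x - (\<Sum>i\<in>UNIV. X n $ i * conv (partial i \<kappa>) f x)) / norm (X n)" for n
    proof -
      have "(\<lambda>y. ?R (X n) y * f y) = (\<lambda>y. (\<kappa> (x + X n - y) * f y - \<kappa> (x - y) * f y
          - (\<Sum>i\<in>UNIV. X n $ i * (partial i \<kappa> (x - y) * f y))) / norm (X n))"
        by (simp add: left_diff_distrib diff_divide_distrib sum_distrib_right mult.assoc)
      then show ?thesis
        unfolding conv_def using int by simp
    qed
    ultimately show "(\<lambda>n. (conv \<kappa> f (x + X n) - conv \<kappa> f x - (\<Sum>i\<in>UNIV. X n $ i * conv (partial i \<kappa>) f x)) / norm (X n))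
      \<longlonglongrightarrow> 0" by (simp only: eq integral_zero)
  qed
  have "bounded_linear (\<lambda>h. \<Sum>i\<in>UNIV. h $ i * conv (partial i \<kappa>) f x)"
    by (intro bounded_linear_sum bounded_linear_mult_const bounded_linear_vec_nth)
  moreover have "((\<lambda>h. norm (conv \<kappa> f (x + h) - conv \<kappa> f x - (\<Sum>i\<in>UNIV. h $ i * conv (partial i \<kappa>) f x)) / norm h)
      \<longlongrightarrow> 0) (at 0)"
    using tendsto_norm_zero[OF lim] by simp
  ultimately show ?thesis by (simp add: has_derivative_at)
qed

lemma partial_conv:
  assumes "\<kappa> \<in> C_inf_on UNIV" "\<And>x. \<kappa> x \<noteq> 0 \<Longrightarrow> x \<in> cball a r" "integrable lborel f"
  shows "partial i (conv \<kappa> f) = conv (partial i \<kappa>) f"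
  by (rule ext, subst partial_eqI[OF conv_has_derivative[OF assms]])
    (simp_all add: axis_def if_distrib if_distribR cong: if_cong)

text \<open>Every derivative falls on the kernel, whose derivatives stay smooth and supported in the
  same ball. Convolutions of the fixed \<open>f\<close> with such kernels therefore form a class to
  which coinduction applies.\<close>

lemma C_inf_conv:
  assumes "\<kappa> \<in> C_inf_on UNIV" "\<And>x. \<kappa> x \<noteq> 0 \<Longrightarrow> x \<in> cball a r" "integrable lborel f"
  shows "conv \<kappa> f \<in> C_inf_on UNIV"
proof (rule C_inf_coinduct[where X = "{conv \<kappa> f | \<kappa>. \<kappa> \<in> C_inf_on UNIV \<and> (\<forall>x. \<kappa> x \<noteq> 0 \<longrightarrow> x \<in> cball a r)}"])
  fix g i assume "g \<in> {conv \<kappa> f | \<kappa>. \<kappa> \<in> C_inf_on UNIV \<and> (\<forall>x. \<kappa> x \<noteq> 0 \<longrightarrow> x \<in> cball a r)}"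
  then obtain \<kappa> where g: "g = conv \<kappa> f" "\<kappa> \<in> C_inf_on UNIV" "\<And>x. \<kappa> x \<noteq> 0 \<Longrightarrow> x \<in> cball a r" by blast
  show "g differentiable_on UNIV"
    unfolding g(1) differentiable_on_def differentiable_def
    using conv_has_derivative[OF g(2,3) assms(3)] by blast
  have "x \<in> cball a r" if "partial i \<kappa> x \<noteq> 0" for x
    using partial_closed_support[OF closed_cball g(3) that] .
  then show "partial i g \<in> {conv \<kappa> f | \<kappa>. \<kappa> \<in> C_inf_on UNIV \<and> (\<forall>x. \<kappa> x \<noteq> 0 \<longrightarrow> x \<in> cball a r)}"
    using C_inf_partial[OF g(2), of i] partial_conv[OF g(2,3) assms(3)] g(1) by blast
qed (use assms in blast)

lemma partials_conv:
  assumes "\<kappa> \<in> C_inf_on UNIV" "\<And>x. \<kappa> x \<noteq> 0 \<Longrightarrow> x \<in> cball a r" "integrable lborel f"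
  shows "foldr partial is (conv \<kappa> f) = conv (foldr partial is \<kappa>) f"
proof (induction "is")
  case (Cons i "is")
  have supp: "x \<in> cball a r" if "foldr partial is \<kappa> x \<noteq> 0" for x
    using partials_closed_support[OF closed_cball assms(2) that] .
  show ?case
    using Cons partial_conv[OF C_inf_partials[OF assms(1), of "is"] supp assms(3)] by simp
qed simp

text \<open>Convolving \<open>f\<close> with the indicator of a large ball gives a function that is
  constant near 0, namely equal to the integral of \<open>f\<close>. Its derivative at 0 vanishes;
  moved onto \<open>f\<close>, that derivative is the integral of the partial derivative. This takes
  the place of Fubini combined with the fundamental theorem of calculus.\<close>

lemma integral_partial_eq_0:
  assumes f: "f \<in> C_inf_on UNIV" "\<And>x. f x \<noteq> 0 \<Longrightarrow> x \<in> cball 0 r"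
  shows "(LINT x|lborel. partial i f x) = 0"
proof -
  \<comment> \<open>The extra 1 leaves room for x to vary: if |x| < 1 and |x - y| <= r, then |y| <=
    r + 1.\<close>
  define B where "B = cball (0::real^'a) (r + 1)"
  let ?g = "indicator B :: real^'a \<Rightarrow> real"
  have int: "integrable lborel ?g"
    using emeasure_compact_finite[OF compact_cball] by (simp add: B_def integrable_indicator_iff less_top)
  have meas [measurable]: "f \<in> borel_measurable borel" "partial i f \<in> borel_measurable borel"
    by (intro C_inf_borel C_inf_partial f(1))+
  have supp: "x \<in> cball 0 r" if "partial i f x \<noteq> 0" for x
    using partial_closed_support[OF closed_cball f(2) that] .
  have "conv f ?g x = (LINT y|lborel. f y)" if x: "x \<in> ball 0 1" for x
  proof -
    have "f (x - y) * ?g y = f (x - y)" for y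
    proof (cases "f (x - y) = 0")
      case False
      then have "norm (x - y) \<le> r" using f(2) by auto
      then have "norm y \<le> r + 1" using x norm_triangle_ineq4[of x "x - y"] by simp
      then show ?thesis by (simp add: B_def)
    qed simp
    then show ?thesis unfolding conv_def by (simp only: integral_lborel_reflect[OF meas(1)])
  qed
  then have "partial i (conv f ?g) 0 = partial i (\<lambda>_. LINT y|lborel. f y) 0"
    by (intro partial_cong_open[where U = "ball 0 1"]) auto
  then have "conv (partial i f) ?g 0 = 0"
    by (simp add: partial_conv[OF f int] partial_const)
  moreover have "partial i f (0 - y) * ?g y = partial i f (0 - y)" for y
    using supp[of "0 - y"] by (cases "partial i f (0 - y) = 0") (auto simp: B_def)
  then have "conv (partial i f) ?g 0 = (LINT y|lborel. partial i f (0 - y))"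
    unfolding conv_def by (simp only:)
  ultimately show ?thesis
    by (simp only: integral_lborel_reflect[OF meas(2)])
qed

section \<open>Convergence of mollifications in \<open>L\<^sup>p\<close>\<close>

lemma powr_add_le:
  fixes a b :: real
  assumes "p \<ge> 0"
  shows "\<bar>a + b\<bar> powr p \<le> 2 powr p * (\<bar>a\<bar> powr p + \<bar>b\<bar> powr p)"
proof -
  have "\<bar>a + b\<bar> powr p \<le> (2 * max \<bar>a\<bar> \<bar>b\<bar>) powr p"
    by (rule powr_mono2) (use assms in auto)
  also have "\<dots> = 2 powr p * max \<bar>a\<bar> \<bar>b\<bar> powr p" by (simp add: powr_mult)
  also have "\<dots> \<le> 2 powr p * (\<bar>a\<bar> powr p + \<bar>b\<bar> powr p)"
    by (intro mult_left_mono) (auto simp: max_def)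
  finally show ?thesis .
qed

lemma powr_tangent:
  fixes a s :: real
  assumes "p \<ge> 1" "a > 0" "s \<ge> 0"
  shows "a powr p + p * a powr (p - 1) * (s - a) \<le> s powr p"
proof (cases "s = 0")
  \<comment> \<open>At s = 0 the claim is (1 - p) a^p <= 0.\<close>
  case True
  have "a powr (p - 1) * a = a powr p"
    using assms by (metis powr_mult_base mult.commute add.commute diff_add_cancel less_imp_le)
  then show ?thesis using True assms by (simp add: mult.assoc algebra_simps)
next
  case False
  have "(\<lambda>x. x powr p) s - (\<lambda>x. x powr p) a \<ge> (p * a powr (p - 1)) * (s - a)"
    by (rule convex_on_imp_above_tangent[OF powr_convex[OF assms(1)]])
      (use assms False in \<open>auto intro!: derivative_eq_intros simp: interior_open\<close>)
  then show ?thesis by simp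
qed

text \<open>The kernel is a probability density, so one integrates the tangent of s^p at a, the
  absolute value of the mean, against it. The right-hand side may be infinite; that case and a = 0
  are trivial, and splitting them off leaves a tangent point a > 0 and integrable functions.\<close>

lemma jensen_powr:
  fixes \<kappa> u :: "'a::euclidean_space \<Rightarrow> real"
  assumes \<kappa>: "integrable lborel \<kappa>" "\<And>z. \<kappa> z \<ge> 0" "integral\<^sup>L lborel \<kappa> = 1"
    and u: "u \<in> borel_measurable borel" "integrable lborel (\<lambda>z. \<kappa> z * u z)" and p: "p \<ge> 1"
  shows "ennreal (\<bar>LINT z|lborel. \<kappa> z * u z\<bar> powr p) \<le> (\<integral>\<^sup>+z. ennreal (\<kappa> z * \<bar>u z\<bar> powr p) \<partial>lborel)"
proof (cases "(\<integral>\<^sup>+z. ennreal (\<kappa> z * \<bar>u z\<bar> powr p) \<partial>lborel) = \<infinity> \<or> (LINT z|lborel. \<kappa> z * u z) = 0")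
  case False
  define a where "a = \<bar>LINT z|lborel. \<kappa> z * u z\<bar>"
  have a: "a > 0" using False by (simp add: a_def)
  have [measurable]: "\<kappa> \<in> borel_measurable borel" "u \<in> borel_measurable borel" using \<kappa> u by auto
  have int: "integrable lborel (\<lambda>z. \<kappa> z * \<bar>u z\<bar> powr p)"
    by (rule integrableI_nonneg) (use False \<kappa>(2) in \<open>auto simp: less_top\<close>)
  have int': "integrable lborel (\<lambda>z. \<kappa> z * \<bar>u z\<bar>)"
    using integrable_abs[OF u(2)] \<kappa>(2) by (simp add: abs_mult)
  have "a \<le> (LINT z|lborel. \<kappa> z * \<bar>u z\<bar>)"
    unfolding a_def using integral_norm_bound[of lborel "\<lambda>z. \<kappa> z * u z"] \<kappa>(2) by (simp add: abs_mult)
  \<comment> \<open>The added linear term is nonnegative because a is at most the weighted mean of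
    |u|.\<close>
  then have "a powr p \<le> a powr p * 1 + p * a powr (p - 1) * ((LINT z|lborel. \<kappa> z * \<bar>u z\<bar>) - a * 1)"
    using p by simp
  also have "\<dots> = (LINT z|lborel. a powr p * \<kappa> z + p * a powr (p - 1) * (\<kappa> z * \<bar>u z\<bar> - a * \<kappa> z))"
    using \<kappa>(1) int' by (simp add: \<kappa>(3))
  also have "\<dots> \<le> (LINT z|lborel. \<kappa> z * \<bar>u z\<bar> powr p)"
  proof (rule integral_mono[OF _ int])
    show "integrable lborel (\<lambda>z. a powr p * \<kappa> z + p * a powr (p - 1) * (\<kappa> z * \<bar>u z\<bar> - a * \<kappa> z))"
      using \<kappa>(1) int' by auto
    fix z
    have "\<kappa> z * (a powr p + p * a powr (p - 1) * (\<bar>u z\<bar> - a)) \<le> \<kappa> z * \<bar>u z\<bar> powr p"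
      by (intro mult_left_mono powr_tangent p a \<kappa>(2)) auto
    then show "a powr p * \<kappa> z + p * a powr (p - 1) * (\<kappa> z * \<bar>u z\<bar> - a * \<kappa> z) \<le> \<kappa> z * \<bar>u z\<bar> powr p"
      by (simp add: algebra_simps)
  qed
  finally have "ennreal (a powr p) \<le> ennreal (LINT z|lborel. \<kappa> z * \<bar>u z\<bar> powr p)"
    by (rule ennreal_leI)
  then show ?thesis
    using nn_integral_eq_integral[OF int] \<kappa>(2) by (simp add: a_def)
qed auto

text \<open>The p-th power of the norm, with values in \<open>ennreal\<close>: estimates carry no
  integrability conditions and Tonelli's theorem applies at once.\<close>

definition Lp_pow :: "real \<Rightarrow> (real^'n) set \<Rightarrow> (real^'n \<Rightarrow> real) \<Rightarrow> ennreal" where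
  "Lp_pow p S u = (\<integral>\<^sup>+x\<in>S. ennreal (\<bar>u x\<bar> powr p) \<partial>lborel)"

lemma Lp_pow_cong: "(\<And>x. x \<in> S \<Longrightarrow> u x = v x) \<Longrightarrow> Lp_pow p S u = Lp_pow p S v"
  unfolding Lp_pow_def by (intro nn_integral_cong) (simp split: split_indicator)

lemma Lp_pow_mono: "S \<subseteq> T \<Longrightarrow> Lp_pow p S u \<le> Lp_pow p T u"
  unfolding Lp_pow_def by (intro nn_integral_mono) (auto split: split_indicator)

text \<open>Stands in for Minkowski's inequality. The factor 2^p does no harm in arguments about
  convergence to 0.\<close>

lemma Lp_pow_add:
  assumes [measurable]: "S \<in> sets borel" "u \<in> borel_measurable borel" "v \<in> borel_measurable borel"
    and "p \<ge> 0"
  shows "Lp_pow p S (\<lambda>x. u x + v x) \<le> ennreal (2 powr p) * (Lp_pow p S u + Lp_pow p S v)"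
proof -
  have "Lp_pow p S (\<lambda>x. u x + v x)
      \<le> (\<integral>\<^sup>+x. ennreal (2 powr p) * (ennreal (\<bar>u x\<bar> powr p) * indicator S x + ennreal (\<bar>v x\<bar> powr p) * indicator S x) \<partial>lborel)"
    unfolding Lp_pow_def
  proof (rule nn_integral_mono)
    fix x
    have "ennreal (\<bar>u x + v x\<bar> powr p) \<le> ennreal (2 powr p) * (ennreal (\<bar>u x\<bar> powr p) + ennreal (\<bar>v x\<bar> powr p))"
      using powr_add_le[OF assms(4)] by (simp add: ennreal_leI flip: ennreal_plus ennreal_mult)
    then show "ennreal (\<bar>u x + v x\<bar> powr p) * indicator S x
      \<le> ennreal (2 powr p) * (ennreal (\<bar>u x\<bar> powr p) * indicator S x + ennreal (\<bar>v x\<bar> powr p) * indicator S x)"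
      by (simp split: split_indicator)
  qed
  also have "\<dots> = ennreal (2 powr p) * (Lp_pow p S u + Lp_pow p S v)"
    unfolding Lp_pow_def by (simp add: nn_integral_cmult nn_integral_add)
  finally show ?thesis .
qed

lemma Lp_pow_mult:
  assumes [measurable]: "S \<in> sets borel" "u \<in> borel_measurable borel"
    and "p \<ge> 0" "B \<ge> 0" "\<And>x. x \<in> S \<Longrightarrow> \<bar>c x\<bar> \<le> B"
  shows "Lp_pow p S (\<lambda>x. c x * u x) \<le> ennreal (B powr p) * Lp_pow p S u"
proof -
  have "Lp_pow p S (\<lambda>x. c x * u x) \<le> (\<integral>\<^sup>+x. ennreal (B powr p) * (ennreal (\<bar>u x\<bar> powr p) * indicator S x) \<partial>lborel)"
    unfolding Lp_pow_def
    by (intro nn_integral_mono)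
      (use assms(3-5) in \<open>auto simp: abs_mult powr_mult intro!: mult_right_mono powr_mono2
        split: split_indicator simp flip: ennreal_mult intro!: ennreal_leI\<close>)
  also have "\<dots> = ennreal (B powr p) * Lp_pow p S u"
    unfolding Lp_pow_def by (simp add: nn_integral_cmult)
  finally show ?thesis .
qed

lemma Lp_pow_minus_commute: "Lp_pow p S (\<lambda>x. u x - v x) = Lp_pow p S (\<lambda>x. v x - u x)"
  unfolding Lp_pow_def by (simp add: abs_minus_commute)

section \<open>Continuity of translation in L^1 and L^p\<close>

lemma distr_lborel_shift: "distr lborel borel (\<lambda>x. x - h) = (lborel :: 'a::euclidean_space measure)"
proof -
  have "(\<lambda>x. x - h) = (+) (- h)" by (rule ext) simp
  then show ?thesis by (simp only: lborel_distr_plus)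
qed

lemma nn_integral_lborel_shift:
  fixes h :: "'a::euclidean_space"
  assumes "g \<in> borel_measurable borel"
  shows "(\<integral>\<^sup>+x. g (x - h) \<partial>lborel) = (\<integral>\<^sup>+x. g x \<partial>lborel)"
  using nn_integral_distr[of "\<lambda>x. x - h" lborel borel g] assms by (simp add: distr_lborel_shift)

lemma Lp_pow_shift:
  assumes "u \<in> borel_measurable borel"
  shows "Lp_pow p UNIV (\<lambda>x. u (x - h)) = Lp_pow p UNIV u"
  unfolding Lp_pow_def
  using nn_integral_lborel_shift[of "\<lambda>x. ennreal (\<bar>u x\<bar> powr p)" h] assms by simp

text \<open>The symmetric difference of a set and its translate is covered by two copies of
  \<open>U - K\<close> where \<open>K \<subseteq> A \<subseteq> U\<close> with \<open>K\<close> compact and \<open>U\<close> open.\<close>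

lemma indicator_shift_continuous:
  fixes A :: "'a::euclidean_space set"
  assumes A: "A \<in> sets borel" "emeasure lborel A < \<infinity>" and e: "e > 0"
  shows "\<exists>d>0. \<forall>h. norm h < d \<longrightarrow> (\<integral>\<^sup>+x. ennreal \<bar>indicator A (x - h) - indicator A x\<bar> \<partial>lborel) \<le> ennreal e"
proof -
  \<comment> \<open>Three pieces of measure below e/6 will cover U - K, and U - K enters the final
    bound twice.\<close>
  obtain U where U: "open U" "A \<subseteq> U" "emeasure lborel (U - A) < ennreal (e / 6)"
    using outer_regular_lborel[OF A(1), of "e / 6"] e by auto
  \<comment> \<open>Inner regularity will only yield a closed set, so A is first cut down by a large
    ball; this makes the closed set compact.\<close>
  have lim: "(\<lambda>n. emeasure lborel (A - cball 0 (real n))) \<longlonglongrightarrow> emeasure lborel (\<Inter>n. A - cball 0 (real n))"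
  proof (rule Lim_emeasure_decseq)
    have "emeasure lborel (A - cball 0 (real n)) \<le> emeasure lborel A" for n
      using A(1) by (intro emeasure_mono) auto
    then show "emeasure lborel (A - cball 0 (real n)) \<noteq> \<infinity>" for n
      using A(2) by (metis infinity_ennreal_def leD top.not_eq_extremum)
  qed (use A(1) in \<open>auto simp: decseq_def\<close>)
  have empty: "(\<Inter>n. A - cball 0 (real n)) = {}"
    using real_arch_simple by auto
  have "\<forall>\<^sub>F n in sequentially. emeasure lborel (A - cball 0 (real n)) < ennreal (e / 6)"
    by (rule order_tendstoD(2)[OF lim[unfolded empty emeasure_empty]]) (use e in simp)
  then obtain N where N: "emeasure lborel (A - cball 0 (real N)) < ennreal (e / 6)"
    by (auto simp: eventually_sequentially)
  have AN: "A \<inter> cball 0 (real N) \<in> sets lebesgue" using A(1) by auto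
  have "e / 6 > 0" using e by simp
  then obtain K where K: "closed K" "K \<subseteq> A \<inter> cball 0 (real N)"
    "emeasure lebesgue (A \<inter> cball 0 (real N) - K) < ennreal (e / 6)"
    by (rule sets_lebesgue_inner_closed[OF AN]) (rule that)
  have "A \<inter> cball 0 (real N) - K \<in> sets lborel" using K(1) A(1) by auto
  then have K3: "emeasure lborel (A \<inter> cball 0 (real N) - K) < ennreal (e / 6)"
    using K(3) by (simp only: emeasure_completion main_part sets_completionI_sets)
  have "emeasure lborel (U - K) \<le> emeasure lborel ((U - A) \<union> ((A - cball 0 (real N)) \<union> (A \<inter> cball 0 (real N) - K)))"
    using U(1) K(1) A(1) by (intro emeasure_mono) auto
  also have "\<dots> \<le> emeasure lborel (U - A) + (emeasure lborel (A - cball 0 (real N)) + emeasure lborel (A \<inter> cball 0 (real N) - K))"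
    using U(1) K(1) A(1) by (intro order_trans[OF emeasure_subadditive] add_left_mono) auto
  also have "\<dots> \<le> ennreal (e / 6) + (ennreal (e / 6) + ennreal (e / 6))"
    using U(3) N K3 by (intro add_mono) auto
  also have "\<dots> = ennreal (e / 2)" using e by (simp flip: ennreal_plus)
  finally have UK: "emeasure lborel (U - K) \<le> ennreal (e / 2)" .
  have "bounded K" using K(2) by (intro bounded_subset[OF bounded_cball]) auto
  then have "compact K" using K(1) by (simp add: compact_eq_bounded_closed)
  moreover have "K \<subseteq> U" using K(2) U(2) by blast
  ultimately obtain d where d: "d > 0" "(\<Union>x\<in>K. cball x d) \<subseteq> U"
    using compact_subset_open_imp_cball_epsilon_subset[OF _ U(1)] by metis
  have [measurable]: "U - K \<in> sets borel" "A \<in> sets borel" using U(1) K(1) A(1) by auto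
  have "(\<integral>\<^sup>+x. ennreal \<bar>indicator A (x - h) - indicator A x\<bar> \<partial>lborel) \<le> ennreal e" if "norm h < d" for h
  proof -
    have "ennreal \<bar>indicator A (x - h) - indicator A x\<bar> \<le> indicator (U - K) (x - h) + indicator (U - K) x" for x
    proof -
      \<comment> \<open>Suppose exactly one of x - h and x lies in A. If the one in A is outside K,
        it lies in U - K. If it is in K, the other point is within distance d of K, hence in U, and
        it is not in K because K is contained in A.\<close>
      have "x \<in> U" if "x - h \<in> K" using d(2) that \<open>norm h < d\<close> by (force simp: dist_norm)
      moreover have "x - h \<in> U" if "x \<in> K" using d(2) that \<open>norm h < d\<close> by (force simp: dist_norm)
      ultimately show ?thesis using U(2) K(2) by (auto simp: indicator_def)
    qed
    then have "(\<integral>\<^sup>+x. ennreal \<bar>indicator A (x - h) - indicator A x\<bar> \<partial>lborel)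
        \<le> (\<integral>\<^sup>+x. indicator (U - K) (x - h) + indicator (U - K) x \<partial>lborel)"
      by (rule nn_integral_mono)
    also have "\<dots> = (\<integral>\<^sup>+x. indicator (U - K) (x - h) \<partial>lborel) + (\<integral>\<^sup>+x. indicator (U - K) x \<partial>lborel)"
      by (intro nn_integral_add) measurable
    also have "\<dots> = emeasure lborel (U - K) + emeasure lborel (U - K)"
      by (simp add: nn_integral_lborel_shift[of "indicator (U - K)"])
    also have "\<dots> \<le> ennreal (e / 2) + ennreal (e / 2)" by (intro add_mono UK)
    also have "\<dots> = ennreal e" using e by (simp flip: ennreal_plus)
    finally show ?thesis .
  qed
  with d(1) show ?thesis by blast
qed

text \<open>Density argument: the claim holds for indicators, survives scalar multiples and sums,
  and passes to L^1 limits because translation preserves the L^1 distance.\<close>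

lemma L1_shift_continuous:
  fixes f :: "'a::euclidean_space \<Rightarrow> real"
  assumes "integrable lborel f"
  shows "\<forall>e>0. \<exists>d>0. \<forall>h. norm h < d \<longrightarrow> (\<integral>\<^sup>+x. ennreal \<bar>f (x - h) - f x\<bar> \<partial>lborel) \<le> ennreal e"
  using assms
proof (induction rule: integrable_induct)
  case (base A c)
  show ?case
  proof (intro allI impI)
    fix e :: real assume e: "e > 0"
    \<comment> \<open>Adding 1 keeps the tolerance positive when c = 0.\<close>
    obtain d where d: "d > 0" "\<And>h. norm h < d \<Longrightarrow>
        (\<integral>\<^sup>+x. ennreal \<bar>indicator A (x - h) - indicator A x\<bar> \<partial>lborel) \<le> ennreal (e / (\<bar>c\<bar> + 1))"
      using indicator_shift_continuous[of A "e / (\<bar>c\<bar> + 1)"] base e by auto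
    have [measurable]: "A \<in> sets borel" using base by simp
    have "(\<integral>\<^sup>+x. ennreal \<bar>indicator A (x - h) *\<^sub>R c - indicator A x *\<^sub>R c\<bar> \<partial>lborel) \<le> ennreal e" if "norm h < d" for h
    proof -
      have "(\<integral>\<^sup>+x. ennreal \<bar>indicator A (x - h) *\<^sub>R c - indicator A x *\<^sub>R c\<bar> \<partial>lborel)
          = (\<integral>\<^sup>+x. ennreal \<bar>c\<bar> * ennreal \<bar>indicator A (x - h) - indicator A x\<bar> \<partial>lborel)"
        by (intro nn_integral_cong) (auto simp: indicator_def)
      also have "\<dots> = ennreal \<bar>c\<bar> * (\<integral>\<^sup>+x. ennreal \<bar>indicator A (x - h) - indicator A x\<bar> \<partial>lborel)"
        by (intro nn_integral_cmult) measurable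
      also have "\<dots> \<le> ennreal \<bar>c\<bar> * ennreal (e / (\<bar>c\<bar> + 1))"
        by (intro mult_left_mono d that) auto
      also have "\<dots> = ennreal (\<bar>c\<bar> * (e / (\<bar>c\<bar> + 1)))" using e by (simp flip: ennreal_mult)
      also have "\<dots> \<le> ennreal e" using e by (intro ennreal_leI) (simp add: field_simps)
      finally show ?thesis .
    qed
    with d(1) show "\<exists>d>0. \<forall>h. norm h < d \<longrightarrow>
        (\<integral>\<^sup>+x. ennreal \<bar>indicator A (x - h) *\<^sub>R c - indicator A x *\<^sub>R c\<bar> \<partial>lborel) \<le> ennreal e" by blast
  qed
next
  case (add f g)
  show ?case
  proof (intro allI impI)
    fix e :: real assume "e > 0"
    then have e: "e / 2 > 0" by simp
    obtain d1 where d1: "d1 > 0" "\<And>h. norm h < d1 \<Longrightarrow> (\<integral>\<^sup>+x. ennreal \<bar>f (x - h) - f x\<bar> \<partial>lborel) \<le> ennreal (e / 2)"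
      using add.IH(1) e by blast
    obtain d2 where d2: "d2 > 0" "\<And>h. norm h < d2 \<Longrightarrow> (\<integral>\<^sup>+x. ennreal \<bar>g (x - h) - g x\<bar> \<partial>lborel) \<le> ennreal (e / 2)"
      using add.IH(2) e by blast
    have [measurable]: "f \<in> borel_measurable borel" "g \<in> borel_measurable borel" using add.hyps by auto
    have "(\<integral>\<^sup>+x. ennreal \<bar>f (x - h) + g (x - h) - (f x + g x)\<bar> \<partial>lborel) \<le> ennreal e" if "norm h < min d1 d2" for h
    proof -
      have "(\<integral>\<^sup>+x. ennreal \<bar>f (x - h) + g (x - h) - (f x + g x)\<bar> \<partial>lborel)
          \<le> (\<integral>\<^sup>+x. ennreal \<bar>f (x - h) - f x\<bar> + ennreal \<bar>g (x - h) - g x\<bar> \<partial>lborel)"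
        by (intro nn_integral_mono) (auto simp flip: ennreal_plus intro!: ennreal_leI)
      also have "\<dots> = (\<integral>\<^sup>+x. ennreal \<bar>f (x - h) - f x\<bar> \<partial>lborel) + (\<integral>\<^sup>+x. ennreal \<bar>g (x - h) - g x\<bar> \<partial>lborel)"
        by (intro nn_integral_add) measurable
      also have "\<dots> \<le> ennreal (e / 2) + ennreal (e / 2)" using that by (intro add_mono d1 d2) auto
      also have "\<dots> = ennreal e" using \<open>e > 0\<close> by (simp flip: ennreal_plus)
      finally show ?thesis .
    qed
    with d1(1) d2(1) show "\<exists>d>0. \<forall>h. norm h < d \<longrightarrow>
        (\<integral>\<^sup>+x. ennreal \<bar>f (x - h) + g (x - h) - (f x + g x)\<bar> \<partial>lborel) \<le> ennreal e"
      by (intro exI[of _ "min d1 d2"]) auto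
  qed
next
  case (lim f s)
  show ?case
  proof (intro allI impI)
    fix e :: real assume "e > 0"
    then have e: "e / 3 > 0" by simp
    have [measurable]: "f \<in> borel_measurable borel" "\<And>i. s i \<in> borel_measurable borel" using lim.hyps by auto
    have "(\<lambda>i. \<integral>\<^sup>+x. norm (f x - s i x) \<partial>lborel) \<longlonglongrightarrow> 0"
    proof (rule nn_integral_dominated_convergence_norm[where w = "\<lambda>x. 2 * norm (f x)"])
      have "integrable lborel (\<lambda>x. 2 * norm (f x))" using lim.hyps by auto
      then show "(\<integral>\<^sup>+ x. ennreal (2 * norm (f x)) \<partial>lborel) < \<infinity>"
        unfolding integrable_iff_bounded by (simp add: abs_mult)
    qed (use lim.hyps in auto)
    then have "\<forall>\<^sub>F i in sequentially. (\<integral>\<^sup>+x. norm (f x - s i x) \<partial>lborel) < ennreal (e / 3)"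
      by (rule order_tendstoD) (use e in \<open>simp add: zero_less_iff_neq_zero\<close>)
    then obtain i where i: "(\<integral>\<^sup>+x. norm (f x - s i x) \<partial>lborel) < ennreal (e / 3)"
      by (auto simp: eventually_sequentially)
    obtain d where d: "d > 0" "\<And>h. norm h < d \<Longrightarrow> (\<integral>\<^sup>+x. ennreal \<bar>s i (x - h) - s i x\<bar> \<partial>lborel) \<le> ennreal (e / 3)"
      using lim.IH[of i] e by blast
    have "(\<integral>\<^sup>+x. ennreal \<bar>f (x - h) - f x\<bar> \<partial>lborel) \<le> ennreal e" if "norm h < d" for h
    proof -
      have "(\<integral>\<^sup>+x. ennreal \<bar>f (x - h) - f x\<bar> \<partial>lborel)
          \<le> (\<integral>\<^sup>+x. ennreal \<bar>f (x - h) - s i (x - h)\<bar> + (ennreal \<bar>s i (x - h) - s i x\<bar> + ennreal \<bar>f x - s i x\<bar>) \<partial>lborel)"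
        by (intro nn_integral_mono) (auto simp flip: ennreal_plus intro!: ennreal_leI)
      also have "\<dots> = (\<integral>\<^sup>+x. ennreal \<bar>f (x - h) - s i (x - h)\<bar> \<partial>lborel)
          + ((\<integral>\<^sup>+x. ennreal \<bar>s i (x - h) - s i x\<bar> \<partial>lborel) + (\<integral>\<^sup>+x. ennreal \<bar>f x - s i x\<bar> \<partial>lborel))"
        by (simp add: nn_integral_add)
      also have "(\<integral>\<^sup>+x. ennreal \<bar>f (x - h) - s i (x - h)\<bar> \<partial>lborel) = (\<integral>\<^sup>+x. ennreal \<bar>f x - s i x\<bar> \<partial>lborel)"
        using nn_integral_lborel_shift[of "\<lambda>x. ennreal \<bar>f x - s i x\<bar>" h] by simp
      also have "(\<integral>\<^sup>+x. ennreal \<bar>f x - s i x\<bar> \<partial>lborel)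
          + ((\<integral>\<^sup>+x. ennreal \<bar>s i (x - h) - s i x\<bar> \<partial>lborel) + (\<integral>\<^sup>+x. ennreal \<bar>f x - s i x\<bar> \<partial>lborel))
          \<le> ennreal (e / 3) + (ennreal (e / 3) + ennreal (e / 3))"
        using i d(2)[OF that] by (intro add_mono) auto
      also have "\<dots> = ennreal e" using \<open>e > 0\<close> by (simp flip: ennreal_plus)
      finally show ?thesis .
    qed
    with d(1) show "\<exists>d>0. \<forall>h. norm h < d \<longrightarrow> (\<integral>\<^sup>+x. ennreal \<bar>f (x - h) - f x\<bar> \<partial>lborel) \<le> ennreal e" by blast
  qed
qed

text \<open>Dominated convergence with |f|^p as dominating function. Truncation is what reduces
  translations in L^p to translations in L^1.\<close>

lemma Lp_truncation:
  fixes f :: "real^'n \<Rightarrow> real"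
  assumes [measurable]: "f \<in> borel_measurable borel" and fin: "Lp_pow p UNIV f < \<infinity>" and p: "p \<ge> 1" and e: "e > 0"
  shows "\<exists>M>0. Lp_pow p UNIV (\<lambda>x. f x - max (- M) (min M (f x))) \<le> ennreal e"
proof -
  have "(\<lambda>n. \<integral>\<^sup>+x. ennreal (\<bar>f x - max (- real n) (min (real n) (f x))\<bar> powr p) \<partial>lborel) \<longlonglongrightarrow> (\<integral>\<^sup>+x. 0 \<partial>(lborel :: (real^'n) measure))"
  proof (rule nn_integral_dominated_convergence[where w = "\<lambda>x. ennreal (\<bar>f x\<bar> powr p)"])
    show "AE x in lborel. (\<lambda>n. ennreal (\<bar>f x - max (- real n) (min (real n) (f x))\<bar> powr p)) \<longlonglongrightarrow> 0"
    proof (rule AE_I2)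
      fix x
      obtain N where N: "\<bar>f x\<bar> \<le> real N" using real_arch_simple by blast
      have "\<forall>\<^sub>F n in sequentially. ennreal (\<bar>f x - max (- real n) (min (real n) (f x))\<bar> powr p) = 0"
        using eventually_ge_at_top[of N]
      proof eventually_elim
        case (elim n)
        then have "\<bar>f x\<bar> \<le> real n" using N by linarith
        then have "f x - max (- real n) (min (real n) (f x)) = 0" by linarith
        then show ?case by simp
      qed
      then show "(\<lambda>n. ennreal (\<bar>f x - max (- real n) (min (real n) (f x))\<bar> powr p)) \<longlonglongrightarrow> 0"
        by (rule tendsto_eventually)
    qed
    show "AE x in lborel. ennreal (\<bar>f x - max (- real n) (min (real n) (f x))\<bar> powr p) \<le> ennreal (\<bar>f x\<bar> powr p)" for n
      using p by (intro AE_I2 ennreal_leI powr_mono2) auto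
    show "(\<integral>\<^sup>+x. ennreal (\<bar>f x\<bar> powr p) \<partial>lborel) < \<infinity>" using fin by (simp add: Lp_pow_def)
  qed measurable
  then have lim: "(\<lambda>n. \<integral>\<^sup>+x. ennreal (\<bar>f x - max (- real n) (min (real n) (f x))\<bar> powr p) \<partial>lborel) \<longlonglongrightarrow> 0" by simp
  have "\<forall>\<^sub>F n in sequentially. (\<integral>\<^sup>+x. ennreal (\<bar>f x - max (- real n) (min (real n) (f x))\<bar> powr p) \<partial>lborel) < ennreal e"
    by (rule order_tendstoD(2)[OF lim]) (use e in simp)
  then obtain N where "\<And>n. n \<ge> N \<Longrightarrow> (\<integral>\<^sup>+x. ennreal (\<bar>f x - max (- real n) (min (real n) (f x))\<bar> powr p) \<partial>lborel) < ennreal e"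
    by (auto simp: eventually_sequentially)
  \<comment> \<open>The successor guarantees that the truncation level is positive.\<close>
  from this[of "Suc N"] show ?thesis
    by (intro exI[of _ "real (Suc N)"]) (simp add: Lp_pow_def less_imp_le del: of_nat_Suc)
qed

text \<open>For the truncation g the L^p error is controlled by the L^1 error of f. The two
  truncation errors, at x - h and at x, have the same size by translation invariance.\<close>

lemma Lp_shift_continuous:
  fixes f :: "real^'n \<Rightarrow> real"
  assumes int: "integrable lborel f" and fin: "Lp_pow p UNIV f < \<infinity>" and p: "p \<ge> 1" and e: "e > 0"
  shows "\<exists>d>0. \<forall>h. norm h < d \<longrightarrow> Lp_pow p UNIV (\<lambda>x. f (x - h) - f x) \<le> ennreal e"
proof -
  have f [measurable]: "f \<in> borel_measurable borel" using int by auto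
  define C where "C = (2::real) powr p"
  have C: "C \<ge> 1" using p by (simp add: C_def ge_one_powr_ge_zero)
  \<comment> \<open>Two uses of the triangle inequality with factor C turn three errors of size a
    into C (a + C (a + a)) <= 3 C^2 a, by C >= 1; this is at most e.\<close>
  define a where "a = e / (4 * C\<^sup>2)"
  have a: "a > 0" using e C by (simp add: a_def)
  obtain M where M: "M > 0" "Lp_pow p UNIV (\<lambda>x. f x - max (- M) (min M (f x))) \<le> ennreal a"
    using Lp_truncation[OF f fin p a] by blast
  define g where "g x = max (- M) (min M (f x))" for x
  have [measurable]: "g \<in> borel_measurable borel" unfolding g_def by measurable
  have "a / (2 * M) powr (p - 1) > 0" using a M by simp
  then obtain d where d: "d > 0" "\<And>h. norm h < d \<Longrightarrow>
      (\<integral>\<^sup>+x. ennreal \<bar>f (x - h) - f x\<bar> \<partial>lborel) \<le> ennreal (a / (2 * M) powr (p - 1))"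
    using L1_shift_continuous[OF int] by blast
  have "Lp_pow p UNIV (\<lambda>x. f (x - h) - f x) \<le> ennreal e" if h: "norm h < d" for h
  proof -
    have "Lp_pow p UNIV (\<lambda>x. g (x - h) - g x) \<le> (\<integral>\<^sup>+x. ennreal ((2 * M) powr (p - 1)) * ennreal \<bar>f (x - h) - f x\<bar> \<partial>lborel)"
      unfolding Lp_pow_def
    proof (rule nn_integral_mono)
      fix x
      let ?D = "\<bar>g (x - h) - g x\<bar>"
      \<comment> \<open>The power p - 1 is bounded through |g| <= M; the remaining single factor is
        bounded through truncation being 1-Lipschitz.\<close>
      have "?D powr p = ?D powr (p - 1) * ?D"
        using powr_add[of ?D "p - 1" 1] by simp
      also have "\<dots> \<le> (2 * M) powr (p - 1) * \<bar>f (x - h) - f x\<bar>"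
        using M(1) p by (intro mult_mono powr_mono2) (auto simp: g_def)
      finally show "ennreal (?D powr p) * indicator UNIV x \<le> ennreal ((2 * M) powr (p - 1)) * ennreal \<bar>f (x - h) - f x\<bar>"
        by (simp add: ennreal_leI flip: ennreal_mult)
    qed
    also have "\<dots> = ennreal ((2 * M) powr (p - 1)) * (\<integral>\<^sup>+x. ennreal \<bar>f (x - h) - f x\<bar> \<partial>lborel)"
      by (intro nn_integral_cmult) measurable
    also have "\<dots> \<le> ennreal ((2 * M) powr (p - 1)) * ennreal (a / (2 * M) powr (p - 1))"
      by (intro mult_left_mono d h) auto
    also have "\<dots> = ennreal a" using a M(1) by (simp flip: ennreal_mult)
    finally have gg: "Lp_pow p UNIV (\<lambda>x. g (x - h) - g x) \<le> ennreal a" .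
    have fg: "Lp_pow p UNIV (\<lambda>x. f x - g x) \<le> ennreal a" using M(2) by (simp add: g_def)
    then have gf: "Lp_pow p UNIV (\<lambda>x. g x - f x) \<le> ennreal a"
      by (subst Lp_pow_minus_commute)
    have fgh: "Lp_pow p UNIV (\<lambda>x. f (x - h) - g (x - h)) \<le> ennreal a"
      using fg Lp_pow_shift[of "\<lambda>x. f x - g x" p h] by simp
    have "Lp_pow p UNIV (\<lambda>x. f (x - h) - f x)
        = Lp_pow p UNIV (\<lambda>x. (f (x - h) - g (x - h)) + ((g (x - h) - g x) + (g x - f x)))" by simp
    also have "\<dots> \<le> ennreal C * (Lp_pow p UNIV (\<lambda>x. f (x - h) - g (x - h))
        + Lp_pow p UNIV (\<lambda>x. (g (x - h) - g x) + (g x - f x)))"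
      unfolding C_def using p by (intro Lp_pow_add) auto
    also have "\<dots> \<le> ennreal C * (ennreal a + ennreal C * (ennreal a + ennreal a))"
      unfolding C_def using p
      by (intro mult_left_mono add_mono fgh order_trans[OF Lp_pow_add] gg gf) auto
    also have "\<dots> = ennreal (C * (a + C * (a + a)))"
      using a C by (simp flip: ennreal_plus ennreal_mult)
    also have "\<dots> \<le> ennreal e"
    proof (rule ennreal_leI)
      have "C * a \<le> C\<^sup>2 * a" using C a by (simp add: power2_eq_square)
      moreover have "C\<^sup>2 * a \<ge> 0" using a by simp
      moreover have "C * (a + C * (a + a)) = C * a + 2 * (C\<^sup>2 * a)" by (simp add: power2_eq_square algebra_simps)
      ultimately have "C * (a + C * (a + a)) \<le> 4 * C\<^sup>2 * a" by linarith
      also have "\<dots> = e" using C by (simp add: a_def)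
      finally show "C * (a + C * (a + a)) \<le> e" .
    qed
    finally show ?thesis .
  qed
  with d(1) show ?thesis by blast
qed

section \<open>Mollification error in L^p\<close>

lemma mollifierD:
  assumes "\<kappa> \<in> mollifier w \<delta>"
  shows "\<kappa> \<in> C_inf_on UNIV" "\<kappa> z \<ge> 0" "\<kappa> z \<noteq> 0 \<Longrightarrow> z \<in> cball w \<delta>" "integral\<^sup>L lborel \<kappa> = 1"
    "integrable lborel \<kappa>" "\<kappa> \<in> borel_measurable borel"
proof -
  show *: "\<kappa> \<in> C_inf_on UNIV" "\<kappa> z \<ge> 0" "\<And>z. \<kappa> z \<noteq> 0 \<Longrightarrow> z \<in> cball w \<delta>" "integral\<^sup>L lborel \<kappa> = 1" for z
    using assms by (auto simp: mollifier_def dist_commute)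
  show "integrable lborel \<kappa>" by (rule C_inf_bounded_support_integrable[OF *(1,3)])
  show "\<kappa> \<in> borel_measurable borel" by (rule C_inf_borel[OF *(1)])
qed

lemma conv_commute:
  assumes [measurable]: "\<kappa> \<in> borel_measurable borel" "f \<in> borel_measurable borel"
  shows "conv \<kappa> f x = (LINT z|lborel. \<kappa> z * f (x - z))"
  unfolding conv_def using integral_lborel_reflect[of "\<lambda>z. \<kappa> z * f (x - z)" x] by simp

text \<open>The error at x is the average of f(x - z) - f(x) with weight \<kappa>(z). Jensen moves
  the p-th power inside the average, and Tonelli leaves an average of translation errors over the
  support of the kernel.\<close>

lemma Lp_pow_conv_diff:
  fixes f :: "real^'n \<Rightarrow> real"
  assumes \<kappa>: "\<kappa> \<in> mollifier w \<delta>" and f: "integrable lborel f" and p: "p \<ge> 1"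
    and le: "\<And>h. h \<in> cball w \<delta> \<Longrightarrow> Lp_pow p UNIV (\<lambda>x. f (x - h) - f x) \<le> e"
  shows "Lp_pow p UNIV (\<lambda>x. conv \<kappa> f x - f x) \<le> e"
proof -
  note \<kappa>' = mollifierD[OF \<kappa>]
  have [measurable]: "\<kappa> \<in> borel_measurable borel" "f \<in> borel_measurable borel"
    using \<kappa>'(6) f by auto
  have int: "integrable lborel (\<lambda>z. \<kappa> z * f (x - z))" for x
    using integrable_lborel_reflect[OF conv_integrable[OF \<kappa>'(1,3) f, of x], of x] by simp
  have "Lp_pow p UNIV (\<lambda>x. conv \<kappa> f x - f x) = (\<integral>\<^sup>+x. ennreal (\<bar>conv \<kappa> f x - f x\<bar> powr p) \<partial>lborel)"
    by (simp add: Lp_pow_def)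
  also have "\<dots> \<le> (\<integral>\<^sup>+x. (\<integral>\<^sup>+z. ennreal (\<kappa> z * \<bar>f (x - z) - f x\<bar> powr p) \<partial>lborel) \<partial>lborel)"
  proof (rule nn_integral_mono)
    fix x
    have int': "integrable lborel (\<lambda>z. \<kappa> z * (f (x - z) - f x))"
      using int[of x] \<kappa>'(5) by (simp add: right_diff_distrib)
    have "conv \<kappa> f x - f x = (LINT z|lborel. \<kappa> z * (f (x - z) - f x))"
      using int[of x] \<kappa>'(5) by (simp add: right_diff_distrib conv_commute \<kappa>'(4))
    then show "ennreal (\<bar>conv \<kappa> f x - f x\<bar> powr p) \<le> (\<integral>\<^sup>+z. ennreal (\<kappa> z * \<bar>f (x - z) - f x\<bar> powr p) \<partial>lborel)"
      using jensen_powr[OF \<kappa>'(5,2,4) _ int' p] by simp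
  qed
  also have "\<dots> = (\<integral>\<^sup>+z. (\<integral>\<^sup>+x. ennreal (\<kappa> z * \<bar>f (x - z) - f x\<bar> powr p) \<partial>lborel) \<partial>lborel)"
    by (rule lborel_pair.Fubini') simp
  also have "\<dots> \<le> (\<integral>\<^sup>+z. ennreal (\<kappa> z) * e \<partial>lborel)"
  proof (rule nn_integral_mono)
    fix z
    have "(\<integral>\<^sup>+x. ennreal (\<kappa> z * \<bar>f (x - z) - f x\<bar> powr p) \<partial>lborel)
        = (\<integral>\<^sup>+x. ennreal (\<kappa> z) * ennreal (\<bar>f (x - z) - f x\<bar> powr p) \<partial>lborel)"
      using \<kappa>'(2) by (simp add: ennreal_mult)
    also have "\<dots> = ennreal (\<kappa> z) * Lp_pow p UNIV (\<lambda>x. f (x - z) - f x)"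
      unfolding Lp_pow_def by (simp add: nn_integral_cmult)
    also have "\<dots> \<le> ennreal (\<kappa> z) * e"
    proof (cases "\<kappa> z = 0")
      case False
      then show ?thesis by (intro mult_left_mono le \<kappa>'(3)) auto
    qed simp
    finally show "(\<integral>\<^sup>+x. ennreal (\<kappa> z * \<bar>f (x - z) - f x\<bar> powr p) \<partial>lborel) \<le> ennreal (\<kappa> z) * e" .
  qed
  also have "\<dots> = (\<integral>\<^sup>+z. ennreal (\<kappa> z) \<partial>lborel) * e" by (simp add: nn_integral_multc)
  also have "(\<integral>\<^sup>+z. ennreal (\<kappa> z) \<partial>lborel) = 1"
    using nn_integral_eq_integral[OF \<kappa>'(5)] \<kappa>'(2,4) by simp
  finally show ?thesis by simp
qed

lemma ennreal_tendsto_0I: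
  assumes "\<And>e. e > 0 \<Longrightarrow> \<forall>\<^sub>F n in F. u n \<le> ennreal e"
  shows "(u \<longlongrightarrow> 0) F"
proof (rule order_tendstoI)
  fix a :: ennreal assume "0 < a"
  then obtain e where e: "e > 0" "ennreal e < a"
    by (metis ennreal_0 ennreal_less_zero_iff ennreal_rat_dense le_less_trans less_eq_real_def not_less)
  show "\<forall>\<^sub>F n in F. u n < a"
    using assms[OF e(1)] by eventually_elim (use e(2) in order)
qed simp

text \<open>The support of \<open>\<kappa> m\<close> lies within distance
  \<open>norm (w m) + \<delta> m\<close> of the origin, so eventually only short translations occur,
  whether or not the kernel is centred at 0.\<close>

lemma conv_tendsto_Lp:
  fixes f :: "real^'n \<Rightarrow> real"
  assumes f: "integrable lborel f" "Lp_pow p UNIV f < \<infinity>" and p: "p \<ge> 1"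
    and \<kappa>: "\<And>m. \<kappa> m \<in> mollifier (w m) (\<delta> m)" and lim: "(\<lambda>m. norm (w m) + \<delta> m) \<longlonglongrightarrow> 0"
  shows "(\<lambda>m. Lp_pow p UNIV (\<lambda>x. conv (\<kappa> m) f x - f x)) \<longlonglongrightarrow> 0"
proof (rule ennreal_tendsto_0I)
  fix e :: real assume "e > 0"
  obtain d where d: "d > 0" "\<And>h. norm h < d \<Longrightarrow> Lp_pow p UNIV (\<lambda>x. f (x - h) - f x) \<le> ennreal e"
    using Lp_shift_continuous[OF f p \<open>e > 0\<close>] by blast
  have "\<forall>\<^sub>F m in sequentially. norm (w m) + \<delta> m < d"
    using order_tendstoD(2)[OF lim d(1)] .
  then show "\<forall>\<^sub>F m in sequentially. Lp_pow p UNIV (\<lambda>x. conv (\<kappa> m) f x - f x) \<le> ennreal e"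
  proof eventually_elim
    case (elim m)
    show ?case
    proof (rule Lp_pow_conv_diff[OF \<kappa> f(1) p d(2)])
      fix h assume "h \<in> cball (w m) (\<delta> m)"
      then have "norm (h - w m) \<le> \<delta> m" by (simp add: dist_norm norm_minus_commute)
      with norm_triangle_ineq[of "h - w m" "w m"] elim show "norm h < d" by simp
    qed
  qed
qed

section \<open>Integration by parts and test functions\<close>

lemma DERIV_along_axis:
  assumes "f \<in> C_inf_on UNIV"
  shows "((\<lambda>s. f (a + s *\<^sub>R axis i 1)) has_field_derivative partial i f (a + s *\<^sub>R axis i 1)) (at s)"
proof -
  have "((\<lambda>s. a + s *\<^sub>R axis i 1) has_derivative (\<lambda>t. t *\<^sub>R axis i 1)) (at s)"
    by (auto intro!: derivative_eq_intros)
  from has_derivative_compose[OF this C_inf_has_derivative[OF assms]]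
  have "((\<lambda>s. f (a + s *\<^sub>R axis i 1)) has_derivative
      (\<lambda>t. \<Sum>k\<in>UNIV. (t *\<^sub>R axis i 1) $ k * partial k f (a + s *\<^sub>R axis i 1))) (at s)" .
  moreover have "(\<lambda>t. \<Sum>k\<in>UNIV. (t *\<^sub>R axis i 1) $ k * partial k f (a + s *\<^sub>R axis i 1))
      = (*) (partial i f (a + s *\<^sub>R axis i 1))"
    by (rule ext) (simp add: axis_def if_distrib if_distribR mult.commute cong: if_cong)
  ultimately show ?thesis by (simp add: has_field_derivative_def)
qed

text \<open>The mean value theorem is applied first in direction i, to the increment of f in
  direction j, and then in direction j to the partial derivative so obtained.\<close>

lemma second_difference:
  assumes f: "f \<in> C_inf_on UNIV" and h: "h > 0"
  shows "\<exists>\<xi>. norm (\<xi> - x) \<le> 2 * h \<and>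
    f (x + h *\<^sub>R axis i 1 + h *\<^sub>R axis j 1) - f (x + h *\<^sub>R axis i 1) - f (x + h *\<^sub>R axis j 1) + f x
      = h\<^sup>2 * partial j (partial i f) \<xi>"
proof -
  let ?g = "\<lambda>s. f (x + h *\<^sub>R axis j 1 + s *\<^sub>R axis i 1) - f (x + s *\<^sub>R axis i 1)"
  obtain s where s: "0 < s" "s < h" "?g h - ?g 0 = (h - 0) *
      (partial i f (x + h *\<^sub>R axis j 1 + s *\<^sub>R axis i 1) - partial i f (x + s *\<^sub>R axis i 1))"
    using MVT2[OF h, of ?g "\<lambda>s. partial i f (x + h *\<^sub>R axis j 1 + s *\<^sub>R axis i 1) - partial i f (x + s *\<^sub>R axis i 1)"]
      DERIV_diff[OF DERIV_along_axis[OF f] DERIV_along_axis[OF f]] by blast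
  let ?k = "\<lambda>t. partial i f (x + s *\<^sub>R axis i 1 + t *\<^sub>R axis j 1)"
  obtain t where t: "0 < t" "t < h" "?k h - ?k 0 = (h - 0) * partial j (partial i f) (x + s *\<^sub>R axis i 1 + t *\<^sub>R axis j 1)"
    using MVT2[OF h, of ?k "\<lambda>t. partial j (partial i f) (x + s *\<^sub>R axis i 1 + t *\<^sub>R axis j 1)"]
      DERIV_along_axis[OF C_inf_partial[OF f]] by blast
  have "norm (s *\<^sub>R axis i 1 + t *\<^sub>R axis j (1::real)) \<le> s * 1 + t * 1"
    by (rule order_trans[OF norm_triangle_ineq]) (use s t in simp)
  then have "norm (x + s *\<^sub>R axis i 1 + t *\<^sub>R axis j 1 - x) \<le> 2 * h"
    using s t by (simp add: add.assoc)
  moreover have "f (x + h *\<^sub>R axis i 1 + h *\<^sub>R axis j 1) - f (x + h *\<^sub>R axis i 1) - f (x + h *\<^sub>R axis j 1) + f x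
      = h\<^sup>2 * partial j (partial i f) (x + s *\<^sub>R axis i 1 + t *\<^sub>R axis j 1)"
    using s(3) t(3) by (simp add: power2_eq_square add.commute add.left_commute)
  ultimately show ?thesis by blast
qed

text \<open>The second difference is symmetric in i and j, so the two mixed derivatives agree at
  points tending to x. Continuity of both carries the equality to x.\<close>

lemma partial_commute:
  assumes f: "f \<in> C_inf_on UNIV"
  shows "partial i (partial j f) = partial j (partial i f)"
proof (rule ext)
  fix x
  define h where "h n = inverse (real (Suc n))" for n
  have h: "h n > 0" for n by (simp add: h_def)
  have h0: "(\<lambda>n. 2 * h n) \<longlonglongrightarrow> 0"
    unfolding h_def using tendsto_mult_right_zero[OF LIMSEQ_inverse_real_of_nat, of 2] by simp
  obtain \<xi> where \<xi>: "\<And>n. norm (\<xi> n - x) \<le> 2 * h n"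
    "\<And>n. f (x + h n *\<^sub>R axis i 1 + h n *\<^sub>R axis j 1) - f (x + h n *\<^sub>R axis i 1) - f (x + h n *\<^sub>R axis j 1) + f x
      = (h n)\<^sup>2 * partial j (partial i f) (\<xi> n)"
    using second_difference[OF f h, where x = x and i = i and j = j] by metis
  obtain \<eta> where \<eta>: "\<And>n. norm (\<eta> n - x) \<le> 2 * h n"
    "\<And>n. f (x + h n *\<^sub>R axis j 1 + h n *\<^sub>R axis i 1) - f (x + h n *\<^sub>R axis j 1) - f (x + h n *\<^sub>R axis i 1) + f x
      = (h n)\<^sup>2 * partial i (partial j f) (\<eta> n)"
    using second_difference[OF f h, where x = x and i = j and j = i] by metis
  have eq: "partial j (partial i f) (\<xi> n) = partial i (partial j f) (\<eta> n)" for n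
  proof -
    have "(h n)\<^sup>2 * partial j (partial i f) (\<xi> n) = (h n)\<^sup>2 * partial i (partial j f) (\<eta> n)"
      using \<xi>(2)[of n] \<eta>(2)[of n] by (simp add: algebra_simps)
    then show ?thesis using h[of n] by simp
  qed
  have lim: "\<zeta> \<longlonglongrightarrow> x" if "\<And>n. norm (\<zeta> n - x) \<le> 2 * h n" for \<zeta>
    by (rule LIM_zero_cancel, rule Lim_null_comparison[OF _ h0]) (use that in simp)
  have "(\<lambda>n. partial j (partial i f) (\<xi> n)) \<longlonglongrightarrow> partial j (partial i f) x"
    by (rule continuous_on_tendsto_compose[OF C_inf_continuous[OF C_inf_partial[OF C_inf_partial[OF f]], of UNIV]
        lim[OF \<xi>(1)]]) simp_all
  moreover have "(\<lambda>n. partial j (partial i f) (\<xi> n)) \<longlonglongrightarrow> partial i (partial j f) x"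
    unfolding eq
    by (rule continuous_on_tendsto_compose[OF C_inf_continuous[OF C_inf_partial[OF C_inf_partial[OF f]], of UNIV]
        lim[OF \<eta>(1)]]) simp_all
  ultimately show "partial i (partial j f) x = partial j (partial i f) x"
    by (rule LIMSEQ_unique[symmetric])
qed

text \<open>Integration by parts removes the outermost derivative from one factor and makes it the
  innermost derivative of the other; this lemma brings it back outside.\<close>

lemma partials_partial_commute:
  "f \<in> C_inf_on UNIV \<Longrightarrow> foldr partial is (partial i f) = partial i (foldr partial is f)"
proof (induction "is")
  case (Cons j "is")
  then show ?case using partial_commute[OF C_inf_partials[OF Cons.prems, of "is"], of j i] by simp
qed simp

lemma C_inf_mult_integrable:
  assumes "f \<in> C_inf_on UNIV" "g \<in> C_inf_on UNIV" "\<And>x. g x \<noteq> 0 \<Longrightarrow> x \<in> cball a r"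
  shows "integrable lborel (\<lambda>x. f x * g x)"
  by (rule C_inf_bounded_support_integrable[OF C_inf_mult[OF assms(1,2)], of a r]) (use assms(3) in auto)

text \<open>Bounded support of \<open>g\<close> makes every product boundedly supported, so the
  integral of its partial derivative vanishes. The induction generalises over \<open>f\<close>,
  which collects the derivatives.\<close>

lemma integration_by_parts:
  assumes "f \<in> C_inf_on UNIV" "g \<in> C_inf_on UNIV" "\<And>x. g x \<noteq> 0 \<Longrightarrow> x \<in> cball 0 r"
  shows "(LINT x|lborel. f x * foldr partial is g x) = (-1) ^ length is * (LINT x|lborel. foldr partial is f x * g x)"
  using assms(1)
proof (induction "is" arbitrary: f)
  case (Cons i "is")
  let ?g = "foldr partial is g"
  have g: "?g \<in> C_inf_on UNIV" by (rule C_inf_partials[OF assms(2)])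
  have supp: "x \<in> cball 0 r" if "?g x \<noteq> 0" for x
    by (rule partials_closed_support[OF closed_cball assms(3) that])
  have supp': "x \<in> cball 0 r" if "partial i ?g x \<noteq> 0" for x
    by (rule partial_closed_support[OF closed_cball supp that])
  have "(LINT x|lborel. partial i (\<lambda>x. f x * ?g x) x) = 0"
    by (rule integral_partial_eq_0[OF C_inf_mult[OF Cons.prems g], of r]) (use supp in auto)
  then have "(LINT x|lborel. partial i f x * ?g x) + (LINT x|lborel. f x * partial i ?g x) = 0"
    using C_inf_mult_integrable[OF C_inf_partial[OF Cons.prems] g supp]
      C_inf_mult_integrable[OF Cons.prems C_inf_partial[OF g] supp']
    by (simp add: partial_mult[OF Cons.prems g])
  moreover have "(LINT x|lborel. partial i f x * ?g x)
      = (-1) ^ length is * (LINT x|lborel. partial i (foldr partial is f) x * g x)"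
    using Cons.IH[OF C_inf_partial[OF Cons.prems, of i]]
    by (simp add: partials_partial_commute[OF Cons.prems])
  ultimately show ?case by simp
qed simp

lemma test_functionsI:
  assumes "\<phi> \<in> C_inf_on UNIV" "\<And>y. \<phi> y \<noteq> 0 \<Longrightarrow> y \<in> K" "compact K" "K \<subseteq> \<Omega>"
  shows "\<phi> \<in> test_functions \<Omega>"
proof -
  have "closure {x. \<phi> x \<noteq> 0} \<subseteq> K"
    using assms(2,3) by (intro closure_minimal) (auto intro: compact_imp_closed)
  moreover from this have "compact (closure {x. \<phi> x \<noteq> 0})"
    using compact_Int_closed[OF assms(3) closed_closure, of "{x. \<phi> x \<noteq> 0}"] by (simp add: Int_absorb1)
  ultimately show ?thesis using assms(1,4) by (auto simp: test_functions_def)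
qed

lemma test_functionsD:
  assumes "\<phi> \<in> test_functions \<Omega>"
  shows "\<phi> \<in> C_inf_on UNIV" "\<exists>r. \<forall>x. \<phi> x \<noteq> 0 \<longrightarrow> x \<in> cball 0 r" "\<phi> x \<noteq> 0 \<Longrightarrow> x \<in> \<Omega>"
proof -
  have c: "closure {x. \<phi> x \<noteq> 0} \<subseteq> \<Omega>" "bounded (closure {x. \<phi> x \<noteq> 0})"
    using assms by (auto simp: test_functions_def compact_imp_bounded)
  show "\<phi> \<in> C_inf_on UNIV" using assms by (simp add: test_functions_def)
  show "\<phi> x \<noteq> 0 \<Longrightarrow> x \<in> \<Omega>" using subsetD[OF subset_trans[OF closure_subset c(1)], of x] by simp
  have "bounded {x. \<phi> x \<noteq> 0}" by (rule bounded_subset[OF c(2) closure_subset])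
  then show "\<exists>r. \<forall>x. \<phi> x \<noteq> 0 \<longrightarrow> x \<in> cball 0 r" by (auto simp: bounded_iff)
qed

lemma test_functions_partials:
  assumes "\<phi> \<in> test_functions \<Omega>"
  shows "foldr partial is \<phi> \<in> test_functions \<Omega>"
proof (rule test_functionsI[where K = "closure {x. \<phi> x \<noteq> 0}"])
  show "foldr partial is \<phi> \<in> C_inf_on UNIV" using test_functionsD(1)[OF assms] by (rule C_inf_partials)
  fix y assume "foldr partial is \<phi> y \<noteq> 0"
  then show "y \<in> closure {x. \<phi> x \<noteq> 0}"
    by (rule partials_closed_support[OF closed_closure, rotated]) (auto intro: subsetD[OF closure_subset])
qed (use assms in \<open>auto simp: test_functions_def\<close>)

section \<open>Partitions of unity\<close>

text \<open>Mollifying the indicator of the ball of radius 2r/3 at scale r/3 alters it only within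
  distance r/3 of the bounding sphere: the value 1 survives up to radius r/3, and nothing reaches
  beyond radius r.\<close>

lemma cutoff_exists:
  fixes x :: "real^'n"
  assumes r: "r > 0"
  shows "\<exists>\<beta>\<in>C_inf_on UNIV. (\<forall>y. \<beta> y \<noteq> 0 \<longrightarrow> y \<in> cball x r) \<and> (\<forall>y\<in>cball x (r / 3). \<beta> y = 1)"
proof -
  obtain \<kappa> where \<kappa>: "\<kappa> \<in> mollifier (0 :: real^'n) (r / 3)" using mollifier_exists[of "r / 3" 0] r by auto
  note \<kappa>' = mollifierD[OF \<kappa>]
  let ?I = "indicator (cball x (2 * r / 3)) :: real^'n \<Rightarrow> real"
  have int: "integrable lborel ?I"
    using emeasure_compact_finite[OF compact_cball] by (simp add: integrable_indicator_iff less_top)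
  have "y \<in> cball x r" if "conv \<kappa> ?I y \<noteq> 0" for y
  proof -
    have "\<exists>z. \<kappa> (y - z) * ?I z \<noteq> 0"
    proof (rule ccontr)
      assume "\<not> ?thesis"
      then have "(\<lambda>z. \<kappa> (y - z) * ?I z) = (\<lambda>z. 0)" by auto
      then have "conv \<kappa> ?I y = 0" unfolding conv_def by (simp only:) simp
      with that show False by simp
    qed
    then obtain z where "\<kappa> (y - z) \<noteq> 0" "z \<in> cball x (2 * r / 3)" by (auto simp: indicator_def split: if_splits)
    then have "norm (y - z) \<le> r / 3" "norm (z - x) \<le> 2 * r / 3"
      using \<kappa>'(3) by (auto simp: dist_norm norm_minus_commute)
    then show ?thesis using norm_triangle_ineq[of "y - z" "z - x"] by (simp add: dist_norm norm_minus_commute)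
  qed
  moreover have "conv \<kappa> ?I y = 1" if y: "y \<in> cball x (r / 3)" for y
  proof -
    have "\<kappa> (y - z) * ?I z = \<kappa> (y - z)" for z
    proof (cases "\<kappa> (y - z) = 0")
      case False
      then have "norm (z - y) \<le> r / 3" "norm (y - x) \<le> r / 3"
        using \<kappa>'(3) y by (auto simp: dist_norm norm_minus_commute)
      then show ?thesis using norm_triangle_ineq[of "z - y" "y - x"]
        by (auto simp: dist_norm norm_minus_commute indicator_def)
    qed simp
    then show ?thesis unfolding conv_def by (simp only: integral_lborel_reflect[OF \<kappa>'(6)] \<kappa>'(4))
  qed
  ultimately show ?thesis using C_inf_conv[OF \<kappa>'(1,3) int] by blast
qed

text \<open>Each new function is its cutoff times the product of 1 - \<beta> over those already
  treated, so the sum telescopes. Unlike normalising by the sum of the cutoffs, this involves no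
  division.\<close>

lemma partition_of_cutoffs:
  assumes "finite X" "\<And>x. x \<in> X \<Longrightarrow> \<beta> x \<in> C_inf_on UNIV"
  shows "\<exists>\<zeta>. (\<forall>x\<in>X. \<zeta> x \<in> C_inf_on UNIV \<and> (\<forall>y. \<zeta> x y \<noteq> 0 \<longrightarrow> \<beta> x y \<noteq> 0)) \<and>
    (\<forall>y. (\<Sum>x\<in>X. \<zeta> x y) = 1 - (\<Prod>x\<in>X. 1 - \<beta> x y))"
  using assms
proof (induction X)
  case (insert a X)
  then obtain \<zeta> where \<zeta>: "\<forall>x\<in>X. \<zeta> x \<in> C_inf_on UNIV \<and> (\<forall>y. \<zeta> x y \<noteq> 0 \<longrightarrow> \<beta> x y \<noteq> 0)"
    "\<forall>y. (\<Sum>x\<in>X. \<zeta> x y) = 1 - (\<Prod>x\<in>X. 1 - \<beta> x y)" by auto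
  define \<zeta>' where "\<zeta>' = \<zeta>(a := (\<lambda>y. \<beta> a y * (\<Prod>x\<in>X. 1 - \<beta> x y)))"
  have "\<zeta>' a \<in> C_inf_on UNIV"
    using insert.prems by (auto simp: \<zeta>'_def intro!: C_inf_mult C_inf_prod C_inf_diff)
  moreover have "(\<Sum>x\<in>X. \<zeta>' x y) = (\<Sum>x\<in>X. \<zeta> x y)" for y
    using insert.hyps(2) by (intro sum.cong) (auto simp: \<zeta>'_def)
  then have "(\<Sum>x\<in>insert a X. \<zeta>' x y) = 1 - (\<Prod>x\<in>insert a X. 1 - \<beta> x y)" for y
    using insert.hyps \<zeta>(2) by (simp add: \<zeta>'_def algebra_simps)
  ultimately show ?case
    using \<zeta>(1) insert.hyps(2) by (intro exI[of _ \<zeta>']) (auto simp: \<zeta>'_def)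
qed auto

text \<open>The concentric balls of radius r/3, on which the cutoffs equal 1, already cover K. At
  each point of K some factor 1 - \<beta> vanishes, and the telescoped sum is 1.\<close>

lemma smooth_partition:
  fixes K :: "(real^'n) set"
  assumes K: "compact K" and r: "\<And>x. x \<in> K \<Longrightarrow> r x > 0"
  shows "\<exists>X \<zeta>. finite X \<and> X \<subseteq> K \<and> (\<forall>x\<in>X. \<zeta> x \<in> C_inf_on UNIV \<and> (\<forall>y. \<zeta> x y \<noteq> 0 \<longrightarrow> y \<in> cball x (r x))) \<and>
    (\<forall>y\<in>K. (\<Sum>x\<in>X. \<zeta> x y) = (1::real))"
proof -
  have "\<forall>x\<in>K. \<exists>\<beta>. \<beta> \<in> C_inf_on UNIV \<and> (\<forall>y. \<beta> y \<noteq> 0 \<longrightarrow> y \<in> cball x (r x)) \<and> (\<forall>y\<in>cball x (r x / 3). \<beta> y = 1)"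
    using cutoff_exists r by blast
  then obtain \<beta> where \<beta>: "\<And>x. x \<in> K \<Longrightarrow> \<beta> x \<in> C_inf_on UNIV"
    "\<And>x y. x \<in> K \<Longrightarrow> \<beta> x y \<noteq> 0 \<Longrightarrow> y \<in> cball x (r x)"
    "\<And>x y. x \<in> K \<Longrightarrow> y \<in> cball x (r x / 3) \<Longrightarrow> \<beta> x y = 1"
    by (metis (no_types, lifting) bchoice)
  have "K \<subseteq> (\<Union>x\<in>K. ball x (r x / 3))" using r by force
  then obtain X where X: "X \<subseteq> K" "finite X" "K \<subseteq> (\<Union>x\<in>X. ball x (r x / 3))"
    using compactE_image[OF K, of K "\<lambda>x. ball x (r x / 3)"] by (metis open_ball)
  obtain \<zeta> where \<zeta>: "\<forall>x\<in>X. \<zeta> x \<in> C_inf_on UNIV \<and> (\<forall>y. \<zeta> x y \<noteq> 0 \<longrightarrow> \<beta> x y \<noteq> 0)"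
    "\<forall>y. (\<Sum>x\<in>X. \<zeta> x y) = 1 - (\<Prod>x\<in>X. 1 - \<beta> x y)"
    using partition_of_cutoffs[OF X(2), of \<beta>] X(1) \<beta>(1) by blast
  have "(\<Sum>x\<in>X. \<zeta> x y) = 1" if y: "y \<in> K" for y
  proof -
    obtain x where "x \<in> X" "y \<in> ball x (r x / 3)" using X(3) y by blast
    then have "1 - \<beta> x y = 0" using \<beta>(3)[of x y] X(1) by auto
    then have "(\<Prod>x\<in>X. 1 - \<beta> x y) = 0" using \<open>x \<in> X\<close> X(2) by (intro prod_zero) auto
    then show ?thesis using \<zeta>(2) by simp
  qed
  then show ?thesis using \<zeta>(1) \<beta>(2) X(1,2) by (intro exI[of _ X] exI[of _ \<zeta>]) blast
qed

section \<open>Limits of derivatives in \<open>L\<^sup>p\<close>\<close>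

lemma Lp_tendsto_mono:
  assumes "(u \<longlongrightarrow> 0) F" "c < (\<infinity>::ennreal)" "\<And>m. v m \<le> c * u m"
  shows "(v \<longlongrightarrow> 0) F"
proof (rule tendsto_sandwich[OF _ _ tendsto_const])
  have "((\<lambda>m. c * u m) \<longlongrightarrow> c * 0) F"
    using assms(1,2) by (intro ennreal_tendsto_cmult) auto
  then show "((\<lambda>m. c * u m) \<longlongrightarrow> 0) F" by simp
qed (use assms(3) in auto)

lemma Lp_tendsto_add:
  assumes [measurable]: "S \<in> sets borel" "\<And>m. u m \<in> borel_measurable borel" "\<And>m. v m \<in> borel_measurable borel"
      "G \<in> borel_measurable borel" "H \<in> borel_measurable borel"
    and p: "p \<ge> 1"
    and u: "(\<lambda>m. Lp_pow p S (\<lambda>x. u m x - G x)) \<longlonglongrightarrow> 0" and v: "(\<lambda>m. Lp_pow p S (\<lambda>x. v m x - H x)) \<longlonglongrightarrow> 0"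
  shows "(\<lambda>m. Lp_pow p S (\<lambda>x. u m x + v m x - (G x + H x))) \<longlonglongrightarrow> 0"
proof (rule Lp_tendsto_mono)
  show "(\<lambda>m. Lp_pow p S (\<lambda>x. u m x - G x) + Lp_pow p S (\<lambda>x. v m x - H x)) \<longlonglongrightarrow> 0"
    using tendsto_add[OF u v] by simp
  show "ennreal (2 powr p) < \<infinity>" by simp
  fix m
  have "Lp_pow p S (\<lambda>x. u m x + v m x - (G x + H x)) = Lp_pow p S (\<lambda>x. (u m x - G x) + (v m x - H x))"
    by (simp add: algebra_simps)
  also have "\<dots> \<le> ennreal (2 powr p) * (Lp_pow p S (\<lambda>x. u m x - G x) + Lp_pow p S (\<lambda>x. v m x - H x))"
    using p by (intro Lp_pow_add) auto
  finally show "Lp_pow p S (\<lambda>x. u m x + v m x - (G x + H x))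
    \<le> ennreal (2 powr p) * (Lp_pow p S (\<lambda>x. u m x - G x) + Lp_pow p S (\<lambda>x. v m x - H x))" .
qed

lemma Lp_tendsto_sum:
  assumes "finite A" "S \<in> sets borel" "p \<ge> 1"
    and "\<And>a m. a \<in> A \<Longrightarrow> u a m \<in> borel_measurable borel" "\<And>a. a \<in> A \<Longrightarrow> G a \<in> borel_measurable borel"
    and "\<And>a. a \<in> A \<Longrightarrow> (\<lambda>m. Lp_pow p S (\<lambda>x. u a m x - G a x)) \<longlonglongrightarrow> 0"
  shows "(\<lambda>m. Lp_pow p S (\<lambda>x. (\<Sum>a\<in>A. u a m x) - (\<Sum>a\<in>A. G a x))) \<longlonglongrightarrow> 0"
  using assms(1,4-6)
proof (induction A)
  case empty
  then show ?case by (simp add: Lp_pow_def)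
next
  case (insert a A)
  have "(\<lambda>m. Lp_pow p S (\<lambda>x. u a m x + (\<Sum>a\<in>A. u a m x) - (G a x + (\<Sum>a\<in>A. G a x)))) \<longlonglongrightarrow> 0"
    using insert by (intro Lp_tendsto_add assms(2,3) borel_measurable_sum insert.IH) auto
  then show ?case using insert.hyps by simp
qed

text \<open>Convergence is demanded only on the ball that supports the multiplier: a boundary chart
  gives no more than that.\<close>

lemma Lp_tendsto_mult:
  assumes [measurable]: "S \<in> sets borel" "\<And>m. h m \<in> borel_measurable borel" "G \<in> borel_measurable borel"
    and p: "p \<ge> 1" and \<zeta>: "\<zeta> \<in> C_inf_on UNIV" "\<And>y. \<zeta> y \<noteq> 0 \<Longrightarrow> y \<in> cball a r"
    and h: "(\<lambda>m. Lp_pow p (S \<inter> cball a r) (\<lambda>x. h m x - G x)) \<longlonglongrightarrow> 0"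
  shows "(\<lambda>m. Lp_pow p S (\<lambda>x. \<zeta> x * h m x - \<zeta> x * G x)) \<longlonglongrightarrow> 0"
proof -
  obtain B where B: "B \<ge> 0" "\<And>x. \<bar>\<zeta> x\<bar> \<le> B" using C_inf_bounded[OF \<zeta>] by blast
  show ?thesis
  proof (rule Lp_tendsto_mono[OF h])
    show "ennreal (B powr p) < \<infinity>" by simp
    fix m
    have "Lp_pow p S (\<lambda>x. \<zeta> x * h m x - \<zeta> x * G x) = Lp_pow p (S \<inter> cball a r) (\<lambda>x. \<zeta> x * (h m x - G x))"
      unfolding Lp_pow_def
      by (intro nn_integral_cong) (use \<zeta>(2) p in \<open>force simp: indicator_def right_diff_distrib\<close>)
    also have "\<dots> \<le> ennreal (B powr p) * Lp_pow p (S \<inter> cball a r) (\<lambda>x. h m x - G x)"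
      using p B by (intro Lp_pow_mult) auto
    finally show "Lp_pow p S (\<lambda>x. \<zeta> x * h m x - \<zeta> x * G x)
        \<le> ennreal (B powr p) * Lp_pow p (S \<inter> cball a r) (\<lambda>x. h m x - G x)" .
  qed
qed

text \<open>A qualitative Leibniz rule: only the existence of the limit is claimed. The limit itself is
  later identified through the uniqueness of weak derivatives.\<close>

lemma Lp_convergent_partials_mult:
  assumes S: "S \<in> sets borel" and p: "p \<ge> 1"
    and "\<zeta> \<in> C_inf_on UNIV" "\<And>y. \<zeta> y \<noteq> 0 \<Longrightarrow> y \<in> cball a r" "\<And>m. h m \<in> C_inf_on UNIV"
    and "\<And>js. subseq js is \<Longrightarrow> \<exists>G\<in>borel_measurable borel.
      (\<lambda>m. Lp_pow p (S \<inter> cball a r) (\<lambda>x. foldr partial js (h m) x - G x)) \<longlonglongrightarrow> 0"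
  shows "\<exists>G\<in>borel_measurable borel.
    (\<lambda>m. Lp_pow p S (\<lambda>x. foldr partial is (\<lambda>x. \<zeta> x * h m x) x - G x)) \<longlonglongrightarrow> 0"
  using assms(3-)
\<comment> \<open>Reverse induction peels off the innermost derivative. It acts on the product
  itself and leaves two products of the same shape, one with a differentiated cutoff and one with a
  differentiated sequence.\<close>
proof (induction "is" arbitrary: \<zeta> h rule: rev_induct)
  case Nil
  from Nil(4)[of "[]"] obtain G where G: "G \<in> borel_measurable borel"
    "(\<lambda>m. Lp_pow p (S \<inter> cball a r) (\<lambda>x. h m x - G x)) \<longlonglongrightarrow> 0" by auto
  show ?case
    using Lp_tendsto_mult[OF S C_inf_borel[OF Nil(3)] G(1) p Nil(1,2) G(2)] G(1) C_inf_borel[OF Nil(1)]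
    by (intro bexI[of _ "\<lambda>x. \<zeta> x * G x"]) auto
next
  case (snoc i "is")
  note \<zeta>' = C_inf_partial[OF snoc(2), of i] and h' = C_inf_partial[OF snoc(4), of i]
  have supp: "y \<in> cball a r" if "partial i \<zeta> y \<noteq> 0" for y
    by (rule partial_closed_support[OF closed_cball snoc(3) that])
  have "\<exists>G\<in>borel_measurable borel.
      (\<lambda>m. Lp_pow p S (\<lambda>x. foldr partial is (\<lambda>x. partial i \<zeta> x * h m x) x - G x)) \<longlonglongrightarrow> 0"
    by (rule snoc.IH[OF \<zeta>' supp snoc(4)])
      (auto intro!: snoc(5) intro: subseq_order.trans)
  then obtain G1 where G1: "G1 \<in> borel_measurable borel"
      "(\<lambda>m. Lp_pow p S (\<lambda>x. foldr partial is (\<lambda>x. partial i \<zeta> x * h m x) x - G1 x)) \<longlonglongrightarrow> 0" by blast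
  have "\<exists>G\<in>borel_measurable borel.
      (\<lambda>m. Lp_pow p S (\<lambda>x. foldr partial is (\<lambda>x. \<zeta> x * partial i (h m) x) x - G x)) \<longlonglongrightarrow> 0"
  proof (rule snoc.IH[OF snoc(2,3) h'])
    fix js assume "subseq js is"
    then have "subseq (js @ [i]) (is @ [i])" by simp
    from snoc(5)[OF this] show "\<exists>G\<in>borel_measurable borel.
        (\<lambda>m. Lp_pow p (S \<inter> cball a r) (\<lambda>x. foldr partial js (partial i (h m)) x - G x)) \<longlonglongrightarrow> 0" by simp
  qed
  then obtain G2 where G2: "G2 \<in> borel_measurable borel"
      "(\<lambda>m. Lp_pow p S (\<lambda>x. foldr partial is (\<lambda>x. \<zeta> x * partial i (h m) x) x - G2 x)) \<longlonglongrightarrow> 0" by blast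
  have "(\<lambda>m. Lp_pow p S (\<lambda>x. foldr partial is (\<lambda>x. partial i \<zeta> x * h m x) x
      + foldr partial is (\<lambda>x. \<zeta> x * partial i (h m) x) x - (G1 x + G2 x))) \<longlonglongrightarrow> 0"
    by (intro Lp_tendsto_add S p G1 G2 C_inf_borel C_inf_partials C_inf_mult \<zeta>' h' snoc(2,4))
  moreover have "foldr partial (is @ [i]) (\<lambda>x. \<zeta> x * h m x) x
      = foldr partial is (\<lambda>x. partial i \<zeta> x * h m x) x + foldr partial is (\<lambda>x. \<zeta> x * partial i (h m) x) x" for m x
    using partials_add[OF C_inf_mult[OF \<zeta>' snoc(4)[of m]] C_inf_mult[OF snoc(2) h'[of m]], of "is"]
    by (simp add: partial_mult[OF snoc(2,4)])
  ultimately show ?case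
    using G1(1) G2(1) by (intro bexI[of _ "\<lambda>x. G1 x + G2 x"]) simp_all
qed

text \<open>Replaces Hoelder's inequality by a split at level l: either |u| <= l, or |u| = |u|^(1-p)
  |u|^p <= l^(1-p) |u|^p.\<close>

lemma Lp_pow_1_le:
  assumes [measurable]: "S \<in> sets borel" "u \<in> borel_measurable borel" and p: "p \<ge> 1" and l: "l > 0"
  shows "Lp_pow 1 S u \<le> ennreal l * emeasure lborel S + ennreal (l powr (1 - p)) * Lp_pow p S u"
proof -
  have "Lp_pow 1 S u \<le> (\<integral>\<^sup>+x. ennreal l * indicator S x + ennreal (l powr (1 - p)) * (ennreal (\<bar>u x\<bar> powr p) * indicator S x) \<partial>lborel)"
    unfolding Lp_pow_def
  proof (rule nn_integral_mono)
    fix x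
    have "\<bar>u x\<bar> \<le> l + l powr (1 - p) * \<bar>u x\<bar> powr p"
    proof (cases "\<bar>u x\<bar> \<le> l")
      case False
      then have "\<bar>u x\<bar> = \<bar>u x\<bar> powr (1 - p) * \<bar>u x\<bar> powr p"
        using l by (simp flip: powr_add)
      also have "\<dots> \<le> l powr (1 - p) * \<bar>u x\<bar> powr p"
        using False l p by (intro mult_right_mono powr_mono2') auto
      finally show ?thesis using l by linarith
    qed (use l in \<open>simp add: add_increasing2\<close>)
    then show "ennreal (\<bar>u x\<bar> powr 1) * indicator S x
        \<le> ennreal l * indicator S x + ennreal (l powr (1 - p)) * (ennreal (\<bar>u x\<bar> powr p) * indicator S x)"
      using l by (auto simp: indicator_def ennreal_leI simp flip: ennreal_mult ennreal_plus)
  qed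
  also have "\<dots> = ennreal l * emeasure lborel S + ennreal (l powr (1 - p)) * Lp_pow p S u"
    unfolding Lp_pow_def by (simp add: nn_integral_add nn_integral_cmult)
  finally show ?thesis .
qed

lemma Lp_tendsto_imp_L1:
  assumes S: "S \<in> sets borel" "emeasure lborel S < \<infinity>" and u: "\<And>m. u m \<in> borel_measurable borel" and p: "p \<ge> 1"
    and lim: "(\<lambda>m. Lp_pow p S (u m)) \<longlonglongrightarrow> 0"
  shows "(\<lambda>m. Lp_pow 1 S (u m)) \<longlonglongrightarrow> 0"
proof (rule ennreal_tendsto_0I)
  fix e :: real assume e: "e > 0"
  define M where "M = measure lborel S"
  \<comment> \<open>Chosen so that l M <= e/2, with M + 1 instead of M to avoid a zero denominator.
    The bound b on the p-th power integral is then what makes the second term e/2.\<close>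
  define l where "l = e / (2 * (M + 1))"
  have M: "M \<ge> 0" by (simp add: M_def)
  have l: "l > 0" using e M by (simp add: l_def)
  define b where "b = e / 2 / l powr (1 - p)"
  have b: "b > 0" using e l by (simp add: b_def)
  have "\<forall>\<^sub>F m in sequentially. Lp_pow p S (u m) < ennreal b"
    by (rule order_tendstoD(2)[OF lim]) (use b in simp)
  then show "\<forall>\<^sub>F m in sequentially. Lp_pow 1 S (u m) \<le> ennreal e"
  proof eventually_elim
    case (elim m)
    have "Lp_pow 1 S (u m) \<le> ennreal l * emeasure lborel S + ennreal (l powr (1 - p)) * Lp_pow p S (u m)"
      by (rule Lp_pow_1_le[OF S(1) u p l])
    also have "\<dots> \<le> ennreal l * ennreal M + ennreal (l powr (1 - p)) * ennreal b"
      using S(2) elim by (intro add_mono mult_left_mono) (auto simp: M_def emeasure_eq_ennreal_measure less_top)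
    also have "\<dots> = ennreal (l * M + e / 2)" using l M b e by (simp add: b_def flip: ennreal_mult ennreal_plus)
    also have "\<dots> \<le> ennreal e"
    proof (rule ennreal_leI)
      have "l * M \<le> l * (M + 1)" using l by simp
      also have "\<dots> = e / 2" using M by (simp add: l_def field_simps)
      finally show "l * M + e / 2 \<le> e" by simp
    qed
    finally show ?case .
  qed
qed

text \<open>Lets a pairing with a bounded function pass to the limit. Only measurability of
  \<open>G\<close> is given, so integrability of the limit pairing is obtained too, by subtracting
  the error of a single late term.\<close>

lemma L1_tendsto_integral:
  assumes S: "S \<in> sets borel" and u: "\<And>m. u m \<in> borel_measurable borel" "\<And>m. integrable lborel (\<lambda>x. u m x * \<phi> x)"
    and G: "G \<in> borel_measurable borel" and \<phi>: "\<phi> \<in> borel_measurable borel" "\<And>x. \<bar>\<phi> x\<bar> \<le> B" "\<And>x. \<phi> x \<noteq> 0 \<Longrightarrow> x \<in> S"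
    and lim: "(\<lambda>m. Lp_pow 1 S (\<lambda>x. u m x - G x)) \<longlonglongrightarrow> 0"
  shows "integrable lborel (\<lambda>x. G x * \<phi> x) \<and> (\<lambda>m. LINT x|lborel. u m x * \<phi> x) \<longlonglongrightarrow> (LINT x|lborel. G x * \<phi> x)"
proof -
  note [measurable] = S u(1) G \<phi>(1)
  have B: "B \<ge> 0" using \<phi>(2)[of undefined] by linarith
  have le: "(\<integral>\<^sup>+x. norm (u m x * \<phi> x - G x * \<phi> x) \<partial>lborel) \<le> ennreal B * Lp_pow 1 S (\<lambda>x. u m x - G x)" for m
  proof -
    have "(\<integral>\<^sup>+x. norm (u m x * \<phi> x - G x * \<phi> x) \<partial>lborel) = Lp_pow 1 S (\<lambda>x. \<phi> x * (u m x - G x))"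
      unfolding Lp_pow_def
      by (intro nn_integral_cong) (use \<phi>(3) in \<open>auto simp: indicator_def algebra_simps\<close>)
    also have "\<dots> \<le> ennreal (B powr 1) * Lp_pow 1 S (\<lambda>x. u m x - G x)"
      using B \<phi>(2) by (intro Lp_pow_mult) auto
    finally show ?thesis using B by simp
  qed
  have lim': "(\<lambda>m. \<integral>\<^sup>+x. norm (u m x * \<phi> x - G x * \<phi> x) \<partial>lborel) \<longlonglongrightarrow> 0"
    by (rule Lp_tendsto_mono[OF lim _ le]) simp
  have "\<forall>\<^sub>F m in sequentially. (\<integral>\<^sup>+x. norm (u m x * \<phi> x - G x * \<phi> x) \<partial>lborel) < ennreal 1"
    by (rule order_tendstoD(2)[OF lim']) simp
  then obtain m where m: "(\<integral>\<^sup>+x. norm (u m x * \<phi> x - G x * \<phi> x) \<partial>lborel) < ennreal 1"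
    by (auto simp: eventually_sequentially)
  have "integrable lborel (\<lambda>x. u m x * \<phi> x - G x * \<phi> x)"
    by (rule integrableI_bounded) (use order.strict_trans[OF m, of \<infinity>] in auto)
  from Bochner_Integration.integrable_diff[OF u(2)[of m] this]
  have int: "integrable lborel (\<lambda>x. G x * \<phi> x)" by simp
  show ?thesis using int tendsto_L1_int[OF u(2) int lim'] by simp
qed

section \<open>The fundamental lemma and boundary charts\<close>

text \<open>Here the off-centre support takes effect: as a function of y, the reflected kernel is
  supported around x - w instead of x, which may lie well inside \<Omega> although x is close to the
  boundary.\<close>

lemma mollifier_reflect_test:
  assumes \<kappa>: "\<kappa> \<in> mollifier w \<delta>" and sub: "cball (x - w) \<delta> \<subseteq> \<Omega>"
  shows "(\<lambda>y. \<kappa> (x - y)) \<in> test_functions \<Omega>"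
    and "foldr partial is (\<lambda>y. \<kappa> (x - y)) = (\<lambda>y. (-1) ^ length is * foldr partial is \<kappa> (x - y))"
proof -
  show "(\<lambda>y. \<kappa> (x - y)) \<in> test_functions \<Omega>"
  proof (rule test_functionsI[OF _ _ compact_cball sub])
    show "(\<lambda>y. \<kappa> (x - y)) \<in> C_inf_on UNIV"
      using C_inf_affine[OF mollifierD(1)[OF \<kappa>], of x "-1"] by simp
    fix y assume "\<kappa> (x - y) \<noteq> 0"
    then have "x - y \<in> cball w \<delta>" by (rule mollifierD(3)[OF \<kappa>])
    then show "y \<in> cball (x - w) \<delta>" by (simp add: dist_norm norm_minus_commute algebra_simps)
  qed
  show "foldr partial is (\<lambda>y. \<kappa> (x - y)) = (\<lambda>y. (-1) ^ length is * foldr partial is \<kappa> (x - y))"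
    using partials_affine[OF mollifierD(1)[OF \<kappa>], of "is" x "-1"] by simp
qed

text \<open>Test the weak derivative against the reflected kernel: the sign produced by reflection
  cancels the sign in the weak formulation.\<close>

lemma conv_weak_partial:
  assumes \<kappa>: "\<kappa> \<in> mollifier w \<delta>" and sub: "cball (x - w) \<delta> \<subseteq> \<Omega>"
    and weak: "\<And>\<phi>. \<phi> \<in> test_functions \<Omega> \<Longrightarrow>
      (LINT y|lborel. g y * foldr partial is \<phi> y) = (-1) ^ length is * (LINT y|lborel. g' y * \<phi> y)"
  shows "conv (foldr partial is \<kappa>) g x = conv \<kappa> g' x"
proof -
  have "(-1) ^ length is * conv (foldr partial is \<kappa>) g x
      = (LINT y|lborel. g y * ((-1) ^ length is * foldr partial is \<kappa> (x - y)))"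
    unfolding conv_def by (subst Bochner_Integration.integral_mult_right_zero[symmetric]) (simp add: mult_ac)
  also have "\<dots> = (-1) ^ length is * conv \<kappa> g' x"
    using weak[OF mollifier_reflect_test(1)[OF \<kappa> sub]]
    unfolding mollifier_reflect_test(2)[OF \<kappa> sub] conv_def by (simp add: mult.commute)
  finally show ?thesis by simp
qed

text \<open>Near a point of \<Omega> the mollifications of h are pairings with test functions, hence
  0, while they converge to h in L^1. So h vanishes almost everywhere on a small ball, and
  negligibility is a local property.\<close>

lemma fundamental_lemma_borel:
  fixes h :: "real^'n \<Rightarrow> real"
  assumes "open \<Omega>" and h: "integrable lborel h"
    and test: "\<And>\<phi>. \<phi> \<in> test_functions \<Omega> \<Longrightarrow> (LINT x|lborel. h x * \<phi> x) = 0"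
  shows "AE x in lborel. x \<in> \<Omega> \<longrightarrow> h x = 0"
proof -
  have [measurable]: "h \<in> borel_measurable borel" "\<Omega> \<in> sets borel" using h assms(1) by auto
  have "negligible {x\<in>\<Omega>. h x \<noteq> 0}"
  proof (subst locally_negligible_alt, rule ballI)
    fix x0 assume x0: "x0 \<in> {x\<in>\<Omega>. h x \<noteq> 0}"
    then have "x0 \<in> \<Omega>" by simp
    then obtain r' where r': "r' > 0" "cball x0 r' \<subseteq> \<Omega>"
      using assms(1) unfolding open_contains_cball by blast
    \<comment> \<open>Halving leaves room for the kernel: around points of the ball of radius r,
      supports of radius at most r remain in the ball of radius 2r.\<close>
    define r where "r = r' / 2"
    have r: "r > 0" "cball x0 (2 * r) \<subseteq> \<Omega>" using r' by (auto simp: r_def)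
    have "\<exists>\<kappa>. \<kappa> \<in> mollifier (0::real^'n) (r * inverse (real (Suc m)))" for m
    proof -
      have "r * inverse (real (Suc m)) > 0" using r(1) by simp
      from mollifier_exists[OF this, of "0::real^'n"] show ?thesis by blast
    qed
    then obtain \<kappa> where \<kappa>: "\<And>m. \<kappa> m \<in> mollifier (0::real^'n) (r * inverse (real (Suc m)))" by metis
    have zero: "conv (\<kappa> m) h x = 0" if x: "x \<in> ball x0 r" for m x
    proof -
      have le: "r * inverse (real (Suc m)) \<le> r" using r(1) by (simp add: field_simps)
      have "cball x (r * inverse (real (Suc m))) \<subseteq> cball x0 (2 * r)"
        using x le by (intro cball_subset_cball_iff[THEN iffD2]) (auto simp: dist_commute)
      then have "(\<lambda>y. \<kappa> m (x - y)) \<in> test_functions \<Omega>"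
        using mollifier_reflect_test(1)[OF \<kappa>, of x m \<Omega>] r(2) by auto
      from test[OF this] show ?thesis by (simp add: conv_def mult.commute)
    qed
    have "(\<lambda>m. r * inverse (real (Suc m))) \<longlonglongrightarrow> 0"
      using tendsto_mult_right_zero[OF LIMSEQ_inverse_real_of_nat, of r] by simp
    moreover have "Lp_pow 1 UNIV h < \<infinity>"
      using h by (simp add: Lp_pow_def integrable_iff_bounded)
    ultimately have "(\<lambda>m. Lp_pow 1 UNIV (\<lambda>x. conv (\<kappa> m) h x - h x)) \<longlonglongrightarrow> 0"
      using conv_tendsto_Lp[OF h _ _ \<kappa>, of 1] by simp
    then have "(\<lambda>m. Lp_pow 1 (ball x0 r) h) \<longlonglongrightarrow> 0"
    proof (rule Lp_tendsto_mono[where c = 1])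
      fix m
      have "Lp_pow 1 (ball x0 r) h = Lp_pow 1 (ball x0 r) (\<lambda>x. h x - conv (\<kappa> m) h x)"
        by (rule Lp_pow_cong) (simp add: zero)
      also have "\<dots> \<le> Lp_pow 1 UNIV (\<lambda>x. conv (\<kappa> m) h x - h x)"
        unfolding Lp_pow_minus_commute[of _ _ h] by (rule Lp_pow_mono) simp
      finally show "Lp_pow 1 (ball x0 r) h \<le> 1 * Lp_pow 1 UNIV (\<lambda>x. conv (\<kappa> m) h x - h x)" by simp
    qed simp
    then have "Lp_pow 1 (ball x0 r) h = 0" by (simp add: LIMSEQ_const_iff)
    moreover have [measurable]: "ball x0 r \<in> sets borel" by simp
    have "(\<lambda>x. ennreal (\<bar>h x\<bar> powr 1) * indicator (ball x0 r) x) \<in> borel_measurable lborel"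
      by measurable
    ultimately have "AE x in lborel. ennreal (\<bar>h x\<bar> powr 1) * indicator (ball x0 r) x = 0"
      using nn_integral_0_iff_AE unfolding Lp_pow_def by blast
    then have "AE x in lborel. \<not> (x \<in> ball x0 r \<and> h x \<noteq> 0)"
      by eventually_elim (auto simp: indicator_def)
    then have "{x \<in> ball x0 r. h x \<noteq> 0} \<in> null_sets lborel"
      by (subst AE_iff_null_sets) (auto elim!: eventually_mono)
    then have "negligible {x \<in> ball x0 r. h x \<noteq> 0}"
      by (simp add: negligible_iff_null_sets null_sets_completionI)
    then have "negligible ({x\<in>\<Omega>. h x \<noteq> 0} \<inter> ball x0 r)" by (rule negligible_subset) auto
    moreover have "openin (top_of_set {x\<in>\<Omega>. h x \<noteq> 0}) ({x\<in>\<Omega>. h x \<noteq> 0} \<inter> ball x0 r)"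
      by (intro openin_open_Int) auto
    ultimately show "\<exists>U. openin (top_of_set {x\<in>\<Omega>. h x \<noteq> 0}) U \<and> x0 \<in> U \<and> negligible U"
      using x0 r(1) by (intro exI[of _ "{x\<in>\<Omega>. h x \<noteq> 0} \<inter> ball x0 r"]) auto
  qed
  then have "{x\<in>\<Omega>. h x \<noteq> 0} \<in> null_sets lborel"
    by (simp add: negligible_iff_null_sets null_sets_completion_iff)
  then have "AE x in lborel. x \<notin> {x\<in>\<Omega>. h x \<noteq> 0}" by (rule AE_not_in)
  then show ?thesis by eventually_elim auto
qed

text \<open>The segment property in the form needed for kernels: one radius \<open>s\<close> works
  for all \<rho>, and the kernel centre \<open>w\<close> and radius \<delta> serve all points of
  \<Omega> in that ball at once. Since a convolution looks at x - w, an upward shift by t v means w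
  = -t v.\<close>

lemma boundary_chart:
  fixes \<Omega> :: "(real^'n) set"
  assumes "open \<Omega>" "C1_boundary \<Omega>" and x0: "x0 \<in> closure \<Omega>"
  shows "\<exists>s>0. \<forall>\<rho>>0. \<exists>w \<delta>. \<delta> > 0 \<and> norm w + \<delta> \<le> \<rho> \<and> (\<forall>x\<in>\<Omega> \<inter> cball x0 s. cball (x - w) \<delta> \<subseteq> \<Omega>)"
proof (cases "x0 \<in> \<Omega>")
  case True
  then obtain s' where s': "s' > 0" "cball x0 s' \<subseteq> \<Omega>"
    using assms(1) unfolding open_contains_cball by blast
  show ?thesis
  proof (intro exI[of _ "s' / 2"] conjI allI impI)
    fix \<rho> :: real assume "\<rho> > 0"
    have "cball (x - 0) (min \<rho> (s' / 2)) \<subseteq> \<Omega>" if "x \<in> \<Omega> \<inter> cball x0 (s' / 2)" for x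
    proof -
      have "cball x (min \<rho> (s' / 2)) \<subseteq> cball x0 s'"
        using that by (intro cball_subset_cball_iff[THEN iffD2]) (auto simp: dist_commute)
      with s'(2) show ?thesis by auto
    qed
    then show "\<exists>w \<delta>. \<delta> > 0 \<and> norm w + \<delta> \<le> \<rho> \<and> (\<forall>x\<in>\<Omega> \<inter> cball x0 (s' / 2). cball (x - w) \<delta> \<subseteq> \<Omega>)"
      using \<open>\<rho> > 0\<close> s'(1) by (intro exI[of _ 0] exI[of _ "min \<rho> (s' / 2)"]) auto
  qed (use s' in simp)
next
  case False
  then have "x0 \<in> frontier \<Omega>" using x0 assms(1) by (simp add: frontier_def interior_open)
  from bspec[OF assms(2)[unfolded C1_boundary_def] this]
  obtain r v \<gamma> \<gamma>' where r: "r > 0" and v: "norm v = 1" and deriv: "\<forall>x. GDERIV \<gamma> x :> \<gamma>' x"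
    and inv: "\<forall>x t. \<gamma> (x + t *\<^sub>R v) = \<gamma> x"
    and chart: "\<Omega> \<inter> ball x0 r = {x \<in> ball x0 r. x \<bullet> v > \<gamma> x}"
    by (elim exE conjE) (rule that)
  have cont: "continuous_on UNIV \<gamma>"
    using deriv has_derivative_continuous unfolding gderiv_def
    by (intro continuous_at_imp_continuous_on) blast
  \<comment> \<open>A point within s of x0, shifted by at most s, stays within 2r/3 and so inside
    the chart.\<close>
  define s where "s = r / 3"
  have s: "s > 0" using r by (simp add: s_def)
  show ?thesis
  proof (intro exI[of _ s] conjI allI impI s)
    fix \<rho> :: real assume \<rho>: "\<rho> > 0"
    \<comment> \<open>The other half of \<rho> is reserved for the radius of the kernel.\<close>
    define t where "t = min s (\<rho> / 2)"
    have t: "t > 0" "t \<le> s" "t \<le> \<rho> / 2" using s \<rho> by (auto simp: t_def)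
    \<comment> \<open>On the closure the chart inequality holds only weakly. Because \<gamma> is
      constant along v, the shift by t v makes it strict, so the compact shifted set lies in the
      open set \<Omega>.\<close>
    let ?C = "closure (\<Omega> \<inter> cball x0 s)"
    have "bounded (\<Omega> \<inter> cball x0 s)" by (intro bounded_Int) auto
    then have "compact ?C" by (simp add: compact_closure)
    then have comp: "compact ((\<lambda>y. t *\<^sub>R v + y) ` ?C)" by (rule compact_translation)
    have "closed {y. \<gamma> y \<le> y \<bullet> v}"
      by (intro closed_Collect_le cont continuous_intros)
    moreover have "\<Omega> \<inter> cball x0 s \<subseteq> {y. \<gamma> y \<le> y \<bullet> v}"
    proof
      fix y assume "y \<in> \<Omega> \<inter> cball x0 s"
      then have "y \<in> \<Omega> \<inter> ball x0 r" using r by (auto simp: s_def)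
      then show "y \<in> {y. \<gamma> y \<le> y \<bullet> v}" unfolding chart by simp
    qed
    ultimately have C1: "?C \<subseteq> {y. \<gamma> y \<le> y \<bullet> v}" by (intro closure_minimal)
    have C2: "?C \<subseteq> cball x0 s" by (intro closure_minimal) auto
    have "(\<lambda>y. t *\<^sub>R v + y) ` ?C \<subseteq> \<Omega>"
    proof
      fix z assume "z \<in> (\<lambda>y. t *\<^sub>R v + y) ` ?C"
      then obtain y where y: "z = y + t *\<^sub>R v" "y \<in> ?C" by (auto simp: add.commute)
      have "dist x0 z \<le> dist x0 y + dist y z" by (rule dist_triangle)
      also have "\<dots> \<le> s + t" using y C2 t(1) v by (intro add_mono) (auto simp: dist_norm)
      also have "\<dots> < r" using t s r by (simp add: s_def)
      finally have "z \<in> ball x0 r" by simp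
      moreover have "v \<bullet> v = 1" using v by (simp add: dot_square_norm)
      then have "\<gamma> z < z \<bullet> v" using y C1 t(1) by (auto simp: inv inner_add_left)
      ultimately have "z \<in> \<Omega> \<inter> ball x0 r" unfolding chart by simp
      then show "z \<in> \<Omega>" by simp
    qed
    \<comment> \<open>Compactness yields one radius for all shifted points; this uniformity is what
      lets a single kernel serve the whole chart.\<close>
    then obtain \<epsilon> where \<epsilon>: "\<epsilon> > 0" "(\<Union>z\<in>(\<lambda>y. t *\<^sub>R v + y) ` ?C. cball z \<epsilon>) \<subseteq> \<Omega>"
      using compact_subset_open_imp_cball_epsilon_subset[OF comp assms(1)] by metis
    have "cball (x - (- t *\<^sub>R v)) (min \<epsilon> (\<rho> / 2)) \<subseteq> \<Omega>" if x: "x \<in> \<Omega> \<inter> cball x0 s" for x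
    proof -
      have "cball (x - (- t *\<^sub>R v)) (min \<epsilon> (\<rho> / 2)) \<subseteq> cball (t *\<^sub>R v + x) \<epsilon>"
        by (simp add: add.commute subset_cball)
      moreover have "x \<in> ?C" using subsetD[OF closure_subset x] .
      ultimately show ?thesis using \<epsilon>(2) by blast
    qed
    moreover have "norm (- t *\<^sub>R v) + min \<epsilon> (\<rho> / 2) \<le> \<rho>" using t v by simp
    ultimately show "\<exists>w \<delta>. \<delta> > 0 \<and> norm w + \<delta> \<le> \<rho> \<and> (\<forall>x\<in>\<Omega> \<inter> cball x0 s. cball (x - w) \<delta> \<subseteq> \<Omega>)"
      using \<epsilon>(1) \<rho> by (intro exI[of _ "- t *\<^sub>R v"] exI[of _ "min \<epsilon> (\<rho> / 2)"]) auto
  qed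
qed

section \<open>Approximation up to the boundary\<close>

lemma integrable_of_Lp_pow:
  assumes [measurable]: "S \<in> sets borel" "g \<in> borel_measurable borel" and S: "emeasure lborel S < \<infinity>"
    and p: "p \<ge> 1" and fin: "Lp_pow p S g < \<infinity>" and zero: "\<And>x. x \<notin> S \<Longrightarrow> g x = 0"
  shows "integrable lborel g"
proof (rule integrableI_bounded)
  have "(\<integral>\<^sup>+x. ennreal (norm (g x)) \<partial>lborel) = Lp_pow 1 S g"
    unfolding Lp_pow_def by (intro nn_integral_cong) (use zero in \<open>auto simp: indicator_def\<close>)
  also have "\<dots> \<le> ennreal 1 * emeasure lborel S + ennreal (1 powr (1 - p)) * Lp_pow p S g"
    by (rule Lp_pow_1_le) (use p in auto)
  also have "\<dots> < \<infinity>" using S fin by simp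
  finally show "(\<integral>\<^sup>+x. ennreal (norm (g x)) \<partial>lborel) < \<infinity>" .
qed measurable

text \<open>The family \<open>G\<close> consists of Borel representatives of the weak derivatives,
  extended by zero, with \<open>G (\<lambda>_. 0)\<close> in the role of the function itself. One
  sequence has to approximate all orders at once.\<close>

lemma smooth_approximation:
  fixes \<Omega> :: "(real^'n::{finite,linorder}) set" and G :: "('n \<Rightarrow> nat) \<Rightarrow> real^'n::_ \<Rightarrow> real"
  assumes \<Omega>: "open \<Omega>" "bounded \<Omega>" "C1_boundary \<Omega>" and p: "p \<ge> 1"
    and G: "\<And>j. multi_order j \<le> k \<Longrightarrow> G j \<in> borel_measurable borel"
      "\<And>j. multi_order j \<le> k \<Longrightarrow> Lp_pow p \<Omega> (G j) < \<infinity>"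
      "\<And>j x. multi_order j \<le> k \<Longrightarrow> x \<notin> \<Omega> \<Longrightarrow> G j x = 0"
    and weak: "\<And>j \<phi>. multi_order j \<le> k \<Longrightarrow> \<phi> \<in> test_functions \<Omega> \<Longrightarrow>
      (LINT x|lborel. G (\<lambda>_. 0) x * multi_partial j \<phi> x) = (-1) ^ multi_order j * (LINT x|lborel. G j x * \<phi> x)"
  shows "\<exists>\<psi>. (\<forall>m. \<psi> m \<in> C_inf_on UNIV) \<and>
    (\<forall>j. multi_order j \<le> k \<longrightarrow> (\<lambda>m::nat. Lp_pow p \<Omega> (\<lambda>x. multi_partial j (\<psi> m) x - G j x)) \<longlonglongrightarrow> 0)"
proof -
  have S [measurable]: "\<Omega> \<in> sets borel" using \<Omega>(1) by simp
  have fin: "emeasure lborel \<Omega> < \<infinity>" using emeasure_bounded_finite[OF \<Omega>(2)] .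
  let ?z = "\<lambda>_::'n. 0::nat"
  have z: "multi_order ?z \<le> k" by simp
  have mlz: "multi_list ?z = []" using length_multi_list[of ?z] by simp
  have int: "integrable lborel (G j)" if "multi_order j \<le> k" for j
    by (rule integrable_of_Lp_pow[OF S G(1) fin p G(2,3)]) (use that in auto)
  have LpU: "Lp_pow p UNIV (G j) < \<infinity>" if "multi_order j \<le> k" for j
  proof -
    have "Lp_pow p UNIV (G j) = Lp_pow p \<Omega> (G j)"
      unfolding Lp_pow_def by (intro nn_integral_cong) (use G(3)[OF that] in \<open>auto simp: indicator_def\<close>)
    then show ?thesis using G(2)[OF that] by simp
  qed
  have "\<forall>x0\<in>closure \<Omega>. \<exists>s>0. \<forall>\<rho>>0. \<exists>w \<delta>. \<delta> > 0 \<and> norm w + \<delta> \<le> \<rho> \<and> (\<forall>x\<in>\<Omega> \<inter> cball x0 s. cball (x - w) \<delta> \<subseteq> \<Omega>)"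
    using boundary_chart[OF \<Omega>(1,3)] by blast
  from bchoice[OF this] obtain s where s: "\<And>x0. x0 \<in> closure \<Omega> \<Longrightarrow> s x0 > 0"
    and chart: "\<And>x0 \<rho>. x0 \<in> closure \<Omega> \<Longrightarrow> \<rho> > 0 \<Longrightarrow> \<exists>w \<delta>. \<delta> > 0 \<and> norm w + \<delta> \<le> \<rho> \<and>
      (\<forall>x\<in>\<Omega> \<inter> cball x0 (s x0). cball (x - w) \<delta> \<subseteq> \<Omega>)"
    by blast
  have "\<exists>w \<delta> \<kappa>. \<kappa> \<in> mollifier w \<delta> \<and> norm w + \<delta> \<le> inverse (real (Suc m)) \<and> norm w + \<delta> \<ge> 0 \<and>
      (\<forall>x\<in>\<Omega> \<inter> cball x0 (s x0). cball (x - w) \<delta> \<subseteq> \<Omega>)" if "x0 \<in> closure \<Omega>" for x0 m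
  proof -
    have "inverse (real (Suc m)) > 0" by simp
    from chart[OF that this] obtain w \<delta> where w: "\<delta> > 0" "norm w + \<delta> \<le> inverse (real (Suc m))"
      "\<forall>x\<in>\<Omega> \<inter> cball x0 (s x0). cball (x - w) \<delta> \<subseteq> \<Omega>" by blast
    obtain \<kappa> where "\<kappa> \<in> mollifier w \<delta>" using mollifier_exists[OF w(1), of w] by blast
    moreover have "norm w + \<delta> \<ge> 0" using w(1) by simp
    ultimately show ?thesis using w(2,3) by blast
  qed
  then have "\<forall>x0 m. \<exists>w \<delta> \<kappa>. x0 \<in> closure \<Omega> \<longrightarrow> \<kappa> \<in> mollifier w \<delta> \<and> norm w + \<delta> \<le> inverse (real (Suc m)) \<and> norm w + \<delta> \<ge> 0 \<and>
      (\<forall>x\<in>\<Omega> \<inter> cball x0 (s x0). cball (x - w) \<delta> \<subseteq> \<Omega>)" by blast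
  then obtain w \<delta> \<kappa> where "\<forall>x0 m. x0 \<in> closure \<Omega> \<longrightarrow> \<kappa> x0 m \<in> mollifier (w x0 m) (\<delta> x0 m) \<and>
      norm (w x0 m) + \<delta> x0 m \<le> inverse (real (Suc m)) \<and> norm (w x0 m) + \<delta> x0 m \<ge> 0 \<and>
      (\<forall>x\<in>\<Omega> \<inter> cball x0 (s x0). cball (x - w x0 m) (\<delta> x0 m) \<subseteq> \<Omega>)"
    unfolding choice_iff by (elim exE) (rule that)
  then have \<kappa>: "\<And>x0 m. x0 \<in> closure \<Omega> \<Longrightarrow> \<kappa> x0 m \<in> mollifier (w x0 m) (\<delta> x0 m)"
    and w: "\<And>x0 m. x0 \<in> closure \<Omega> \<Longrightarrow> norm (w x0 m) + \<delta> x0 m \<le> inverse (real (Suc m))"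
      "\<And>x0 m. x0 \<in> closure \<Omega> \<Longrightarrow> norm (w x0 m) + \<delta> x0 m \<ge> 0"
    and sub: "\<And>x0 m x. x0 \<in> closure \<Omega> \<Longrightarrow> x \<in> \<Omega> \<inter> cball x0 (s x0) \<Longrightarrow> cball (x - w x0 m) (\<delta> x0 m) \<subseteq> \<Omega>"
    by blast+
  have wlim: "(\<lambda>m. norm (w x0 m) + \<delta> x0 m) \<longlonglongrightarrow> 0" if "x0 \<in> closure \<Omega>" for x0
    by (rule tendsto_sandwich[OF _ _ tendsto_const LIMSEQ_inverse_real_of_nat])
      (use w[OF that] in auto)
  have "compact (closure \<Omega>)" using \<Omega>(2) by (simp add: compact_closure)
  then have "\<exists>X \<zeta>. finite X \<and> X \<subseteq> closure \<Omega> \<and>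
      (\<forall>x\<in>X. \<zeta> x \<in> C_inf_on UNIV \<and> (\<forall>y. \<zeta> x y \<noteq> 0 \<longrightarrow> y \<in> cball x (s x))) \<and>
      (\<forall>y\<in>closure \<Omega>. (\<Sum>x\<in>X. \<zeta> x y) = (1::real))"
    by (rule smooth_partition) (rule s)
  then obtain X \<zeta> where X: "finite X" "X \<subseteq> closure \<Omega>"
    and \<zeta>: "\<forall>x\<in>X. \<zeta> x \<in> C_inf_on UNIV \<and> (\<forall>y. \<zeta> x y \<noteq> 0 \<longrightarrow> y \<in> cball x (s x))"
    and \<zeta>1: "\<forall>y\<in>closure \<Omega>. (\<Sum>x\<in>X. \<zeta> x y) = (1::real)"
    by (elim exE conjE) (rule that)
  define h where "h x0 m = conv (\<kappa> x0 m) (G ?z)" for x0 m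
  have Xc: "x0 \<in> closure \<Omega>" if "x0 \<in> X" for x0 using X(2) that by blast
  have h: "h x0 m \<in> C_inf_on UNIV" if "x0 \<in> X" for x0 m
    unfolding h_def by (rule C_inf_conv[OF mollifierD(1,3)[OF \<kappa>[OF Xc[OF that]]] int[OF z]])
  \<comment> \<open>Inside the chart the derivatives of the mollified function are the mollified
    weak derivatives, so convergence on the whole space can be restricted to the chart.\<close>
  have hlim: "(\<lambda>m. Lp_pow p (\<Omega> \<inter> cball x0 (s x0)) (\<lambda>x. foldr partial (multi_list j) (h x0 m) x - G j x)) \<longlonglongrightarrow> 0"
    if x0: "x0 \<in> X" and j: "multi_order j \<le> k" for x0 j
  proof (rule Lp_tendsto_mono[where c = 1])
    show "(\<lambda>m. Lp_pow p UNIV (\<lambda>x. conv (\<kappa> x0 m) (G j) x - G j x)) \<longlonglongrightarrow> 0"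
      by (rule conv_tendsto_Lp[OF int[OF j] LpU[OF j] p \<kappa>[OF Xc[OF x0]] wlim[OF Xc[OF x0]]])
    fix m
    have "Lp_pow p (\<Omega> \<inter> cball x0 (s x0)) (\<lambda>x. foldr partial (multi_list j) (h x0 m) x - G j x)
        = Lp_pow p (\<Omega> \<inter> cball x0 (s x0)) (\<lambda>x. conv (\<kappa> x0 m) (G j) x - G j x)"
    proof (rule Lp_pow_cong)
      fix x assume x: "x \<in> \<Omega> \<inter> cball x0 (s x0)"
      have "foldr partial (multi_list j) (h x0 m) x = conv (foldr partial (multi_list j) (\<kappa> x0 m)) (G ?z) x"
        unfolding h_def
        by (rule fun_cong[OF partials_conv[OF mollifierD(1,3)[OF \<kappa>[OF Xc[OF x0], of m]] int[OF z]]])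
      also have "\<dots> = conv (\<kappa> x0 m) (G j) x"
        by (rule conv_weak_partial[OF \<kappa>[OF Xc[OF x0]] sub[OF Xc[OF x0] x]])
          (use weak[OF j] in \<open>simp add: multi_partial_eq length_multi_list\<close>)
      finally show "foldr partial (multi_list j) (h x0 m) x - G j x = conv (\<kappa> x0 m) (G j) x - G j x" by simp
    qed
    also have "\<dots> \<le> Lp_pow p UNIV (\<lambda>x. conv (\<kappa> x0 m) (G j) x - G j x)" by (rule Lp_pow_mono) simp
    finally show "Lp_pow p (\<Omega> \<inter> cball x0 (s x0)) (\<lambda>x. foldr partial (multi_list j) (h x0 m) x - G j x)
        \<le> 1 * Lp_pow p UNIV (\<lambda>x. conv (\<kappa> x0 m) (G j) x - G j x)" by simp
  qed simp
  define \<psi> where "\<psi> m y = (\<Sum>x0\<in>X. \<zeta> x0 y * h x0 m y)" for m y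
  have summand: "(\<lambda>y. \<zeta> x0 y * h x0 m y) \<in> C_inf_on UNIV" if "x0 \<in> X" for x0 m
    using \<zeta> h that by (intro C_inf_mult) auto
  have \<psi>: "\<psi> m \<in> C_inf_on UNIV" for m
    unfolding \<psi>_def by (intro C_inf_sum summand)
  \<comment> \<open>At order zero the limit can be computed, as the cutoffs sum to 1 on \<Omega>.
    This is the anchor by which the limits of the higher derivatives are identified.\<close>
  have "(\<lambda>m. Lp_pow p \<Omega> (\<lambda>y. (\<Sum>x0\<in>X. \<zeta> x0 y * h x0 m y) - (\<Sum>x0\<in>X. \<zeta> x0 y * G ?z y))) \<longlonglongrightarrow> 0"
  proof (rule Lp_tendsto_sum[OF X(1) S p])
    fix x0 assume x0: "x0 \<in> X"
    show "(\<lambda>y. \<zeta> x0 y * h x0 m y) \<in> borel_measurable borel" for m by (rule C_inf_borel[OF summand[OF x0]])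
    have "\<zeta> x0 \<in> borel_measurable borel" using \<zeta> x0 by (intro C_inf_borel) auto
    then show "(\<lambda>y. \<zeta> x0 y * G ?z y) \<in> borel_measurable borel" using G(1)[OF z] by simp
    show "(\<lambda>m. Lp_pow p \<Omega> (\<lambda>y. \<zeta> x0 y * h x0 m y - \<zeta> x0 y * G ?z y)) \<longlonglongrightarrow> 0"
      using \<zeta> x0 hlim[OF x0 z]
      by (intro Lp_tendsto_mult[OF S C_inf_borel[OF h[OF x0]] G(1)[OF z] p]) (auto simp: mlz)
  qed
  moreover have "Lp_pow p \<Omega> (\<lambda>y. (\<Sum>x0\<in>X. \<zeta> x0 y * h x0 m y) - (\<Sum>x0\<in>X. \<zeta> x0 y * G ?z y))
      = Lp_pow p \<Omega> (\<lambda>y. \<psi> m y - G ?z y)" for m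
  proof (rule Lp_pow_cong)
    fix y assume "y \<in> \<Omega>"
    then have "(\<Sum>x0\<in>X. \<zeta> x0 y) = 1" using \<zeta>1 closure_subset by blast
    then show "(\<Sum>x0\<in>X. \<zeta> x0 y * h x0 m y) - (\<Sum>x0\<in>X. \<zeta> x0 y * G ?z y) = \<psi> m y - G ?z y"
      by (simp add: \<psi>_def flip: sum_distrib_right)
  qed
  ultimately have lim0: "(\<lambda>m. Lp_pow p \<Omega> (\<lambda>y. \<psi> m y - G ?z y)) \<longlonglongrightarrow> 0" by simp
  have "(\<lambda>m. Lp_pow p \<Omega> (\<lambda>x. multi_partial j (\<psi> m) x - G j x)) \<longlonglongrightarrow> 0" if j: "multi_order j \<le> k" for j
  proof -
    let ?D = "foldr partial (multi_list j)"
    have "\<exists>H\<in>borel_measurable borel. (\<lambda>m. Lp_pow p \<Omega> (\<lambda>x. ?D (\<lambda>y. \<zeta> x0 y * h x0 m y) x - H x)) \<longlonglongrightarrow> 0"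
      if x0: "x0 \<in> X" for x0
    proof (rule Lp_convergent_partials_mult[OF S p _ _ h[OF x0]])
      fix js assume "subseq js (multi_list j)"
      then obtain j' where j': "js = multi_list j'" "multi_order j' \<le> multi_order j"
        using subseq_multi_list by blast
      then have "multi_order j' \<le> k" using j by simp
      from hlim[OF x0 this] G(1)[OF this]
      show "\<exists>H\<in>borel_measurable borel. (\<lambda>m. Lp_pow p (\<Omega> \<inter> cball x0 (s x0)) (\<lambda>x. foldr partial js (h x0 m) x - H x)) \<longlonglongrightarrow> 0"
        unfolding j'(1) by blast
    qed (use \<zeta> x0 in auto)
    then have "\<forall>x0\<in>X. \<exists>H. H \<in> borel_measurable borel \<and>
        (\<lambda>m. Lp_pow p \<Omega> (\<lambda>x. ?D (\<lambda>y. \<zeta> x0 y * h x0 m y) x - H x)) \<longlonglongrightarrow> 0" by blast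
    from bchoice[OF this] obtain H' where H': "\<And>x0. x0 \<in> X \<Longrightarrow> H' x0 \<in> borel_measurable borel"
      "\<And>x0. x0 \<in> X \<Longrightarrow> (\<lambda>m. Lp_pow p \<Omega> (\<lambda>x. ?D (\<lambda>y. \<zeta> x0 y * h x0 m y) x - H' x0 x)) \<longlonglongrightarrow> 0"
      by blast
    define H where "H x = (\<Sum>x0\<in>X. H' x0 x)" for x
    have Hm [measurable]: "H \<in> borel_measurable borel" unfolding H_def by (intro borel_measurable_sum H')
    have D\<psi>: "?D (\<psi> m) = (\<lambda>x. \<Sum>x0\<in>X. ?D (\<lambda>y. \<zeta> x0 y * h x0 m y) x)" for m
      unfolding \<psi>_def by (intro partials_sum summand)
    have limH: "(\<lambda>m. Lp_pow p \<Omega> (\<lambda>x. ?D (\<psi> m) x - H x)) \<longlonglongrightarrow> 0"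
      unfolding D\<psi> H_def
      by (intro Lp_tendsto_sum[OF X(1) S p] C_inf_borel C_inf_partials summand H')
    have D\<psi>m [measurable]: "?D (\<psi> m) \<in> borel_measurable borel" for m
      by (intro C_inf_borel C_inf_partials \<psi>)
    have \<psi>m [measurable]: "\<psi> m \<in> borel_measurable borel" for m by (intro C_inf_borel \<psi>)
    have Gm [measurable]: "G j \<in> borel_measurable borel" "G ?z \<in> borel_measurable borel" using G(1) j z by auto
    \<comment> \<open>The discrepancy between the limit found and the expected weak derivative.
      Cutting off outside \<Omega> makes it integrable over the whole space, as the fundamental
      lemma requires.\<close>
    define K where "K x = indicator \<Omega> x * (H x - G j x)" for x
    have L1H: "(\<lambda>m. Lp_pow 1 \<Omega> (\<lambda>x. ?D (\<psi> m) x - H x)) \<longlonglongrightarrow> 0"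
      by (rule Lp_tendsto_imp_L1[OF S fin _ p limH]) measurable
    have L10: "(\<lambda>m. Lp_pow 1 \<Omega> (\<lambda>x. \<psi> m x - G ?z x)) \<longlonglongrightarrow> 0"
      by (rule Lp_tendsto_imp_L1[OF S fin _ p lim0]) measurable
    \<comment> \<open>Pairing with the indicator of \<Omega> extracts integrability of
      \<open>H\<close> over \<Omega>.\<close>
    have "integrable lborel (\<lambda>x. H x * indicator \<Omega> x) \<and>
       (\<lambda>m. LINT x|lborel. ?D (\<psi> m) x * indicator \<Omega> x) \<longlonglongrightarrow> (LINT x|lborel. H x * indicator \<Omega> x)"
    proof (rule L1_tendsto_integral[OF S _ _ Hm _ _ _ L1H, of _ 1])
      fix m
      have "set_integrable lborel (closure \<Omega>) (?D (\<psi> m))"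
        using \<Omega>(2) unfolding set_integrable_def
        by (intro borel_integrable_compact C_inf_continuous C_inf_partials \<psi>) (simp add: compact_closure)
      then have "set_integrable lborel \<Omega> (?D (\<psi> m))"
        by (rule set_integrable_subset) (auto intro: closure_subset[THEN subsetD])
      then show "integrable lborel (\<lambda>x. ?D (\<psi> m) x * indicator \<Omega> x)"
        by (simp add: set_integrable_def mult.commute)
    qed (auto simp: indicator_def split: if_splits)
    then have intH: "integrable lborel (\<lambda>x. H x * indicator \<Omega> x)" by simp
    have intK: "integrable lborel K"
    proof -
      have "K = (\<lambda>x. H x * indicator \<Omega> x - G j x)"
        unfolding K_def using G(3)[OF j] by (auto simp: indicator_def)
      then show ?thesis using intH int[OF j] by simp
    qed
    have Ktest: "(LINT x|lborel. K x * \<phi> x) = 0" if \<phi>: "\<phi> \<in> test_functions \<Omega>" for \<phi>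
    proof -
      obtain r where r: "\<And>x. \<phi> x \<noteq> 0 \<Longrightarrow> x \<in> cball 0 r" using test_functionsD(2)[OF \<phi>] by blast
      note \<phi>s = test_functionsD(1)[OF \<phi>] and \<phi>0 = test_functionsD(3)[OF \<phi>]
      note D\<phi> = test_functions_partials[OF \<phi>, of "multi_list j"]
      have D\<phi>r: "x \<in> cball 0 r" if "?D \<phi> x \<noteq> 0" for x
        by (rule partials_closed_support[OF closed_cball r that])
      obtain B where B: "\<And>x. \<bar>\<phi> x\<bar> \<le> B" using C_inf_bounded[OF \<phi>s r] by blast
      obtain B' where B': "\<And>x. \<bar>?D \<phi> x\<bar> \<le> B'" using C_inf_bounded[OF test_functionsD(1)[OF D\<phi>] D\<phi>r] by blast
      have 1: "integrable lborel (\<lambda>x. H x * \<phi> x) \<and>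
          (\<lambda>m. LINT x|lborel. ?D (\<psi> m) x * \<phi> x) \<longlonglongrightarrow> (LINT x|lborel. H x * \<phi> x)"
        by (rule L1_tendsto_integral[OF S D\<psi>m C_inf_mult_integrable[OF C_inf_partials[OF \<psi>] \<phi>s r] Hm
              C_inf_borel[OF \<phi>s] B \<phi>0 L1H])
      have 2: "integrable lborel (\<lambda>x. G ?z x * ?D \<phi> x) \<and>
          (\<lambda>m. LINT x|lborel. \<psi> m x * ?D \<phi> x) \<longlonglongrightarrow> (LINT x|lborel. G ?z x * ?D \<phi> x)"
        by (rule L1_tendsto_integral[OF S \<psi>m C_inf_mult_integrable[OF \<psi> test_functionsD(1)[OF D\<phi>] D\<phi>r] Gm(2)
              C_inf_borel[OF test_functionsD(1)[OF D\<phi>]] B' test_functionsD(3)[OF D\<phi>] L10])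
      \<comment> \<open>Both sides have limits: the left gives the pairing of the function with the
        differentiated test function, the right gives, up to sign, the pairing of \<open>H\<close>
        with the test function. Hence \<open>H\<close> acts on test functions like the weak
        derivative.\<close>
      have parts: "(LINT x|lborel. \<psi> m x * ?D \<phi> x)
          = (-1) ^ length (multi_list j) * (LINT x|lborel. ?D (\<psi> m) x * \<phi> x)" for m
        by (rule integration_by_parts[OF \<psi> \<phi>s r])
      have "(\<lambda>m. (-1) ^ multi_order j * (LINT x|lborel. ?D (\<psi> m) x * \<phi> x))
          \<longlonglongrightarrow> (-1) ^ multi_order j * (LINT x|lborel. H x * \<phi> x)"
        using 1 by (intro tendsto_mult_left) simp
      moreover have "(\<lambda>m. (-1) ^ multi_order j * (LINT x|lborel. ?D (\<psi> m) x * \<phi> x))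
          \<longlonglongrightarrow> (-1) ^ multi_order j * (LINT x|lborel. G j x * \<phi> x)"
        using 2 weak[OF j \<phi>] parts by (simp add: multi_partial_eq length_multi_list)
      ultimately have "(-1) ^ multi_order j * (LINT x|lborel. H x * \<phi> x)
          = (-1) ^ multi_order j * (LINT x|lborel. G j x * \<phi> x)"
        by (rule LIMSEQ_unique)
      then have eq: "(LINT x|lborel. H x * \<phi> x) = (LINT x|lborel. G j x * \<phi> x)" by simp
      have "integrable lborel (\<lambda>x. \<phi> x * G j x)"
        by (rule Bochner_Integration.integrable_bound[of _ "\<lambda>x. B * G j x"])
          (use int[OF j] B C_inf_borel[OF \<phi>s] in \<open>auto simp: abs_mult intro!: mult_mono intro: order_trans[OF B abs_ge_self]\<close>)
      then have "integrable lborel (\<lambda>x. G j x * \<phi> x)" by (simp add: mult.commute)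
      moreover have "(\<lambda>x. K x * \<phi> x) = (\<lambda>x. H x * \<phi> x - G j x * \<phi> x)"
      proof (rule ext)
        fix x show "K x * \<phi> x = H x * \<phi> x - G j x * \<phi> x"
          using \<phi>0[of x] by (cases "x \<in> \<Omega>") (auto simp: K_def left_diff_distrib)
      qed
      ultimately show ?thesis using 1 eq by simp
    qed
    have "AE x in lborel. x \<in> \<Omega> \<longrightarrow> K x = 0"
      by (rule fundamental_lemma_borel[OF \<Omega>(1) intK Ktest])
    then have "AE x in lborel. x \<in> \<Omega> \<longrightarrow> H x = G j x"
      by eventually_elim (auto simp: K_def)
    then have "Lp_pow p \<Omega> (\<lambda>x. ?D (\<psi> m) x - H x) = Lp_pow p \<Omega> (\<lambda>x. ?D (\<psi> m) x - G j x)" for m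
      unfolding Lp_pow_def by (intro nn_integral_cong_AE) (auto elim!: eventually_mono simp: indicator_def)
    then show ?thesis using limH by (simp add: multi_partial_eq)
  qed
  then show ?thesis using \<psi> by blast
qed

section \<open>Weak derivatives and Sobolev norms\<close>

text \<open>Sobolev functions are merely Lebesgue measurable, while translation and Tonelli
  arguments are carried out for Borel functions over \<open>lborel\<close>.\<close>

lemma borel_representative:
  fixes \<Omega> :: "(real^'n) set"
  assumes \<Omega>: "open \<Omega>" and g: "g \<in> borel_measurable (lebesgue_on \<Omega>)"
  obtains G where "G \<in> borel_measurable borel" "\<And>x. x \<notin> \<Omega> \<Longrightarrow> G x = 0" "AE x in lborel. indicator \<Omega> x * g x = (G x :: real)"
proof -
  have "(\<lambda>x. indicator \<Omega> x * g x) \<in> borel_measurable lebesgue"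
    using g \<Omega> by (simp add: borel_measurable_restrict_space_iff)
  from completion_ex_borel_measurable_real[OF this]
  obtain G' where G': "G' \<in> borel_measurable lborel" "AE x in lborel. indicator \<Omega> x * g x = G' x" by blast
  have [measurable]: "G' \<in> borel_measurable borel" "\<Omega> \<in> sets borel" using G'(1) \<Omega> by auto
  \<comment> \<open>A second multiplication by the indicator makes the representative vanish
    everywhere outside \<Omega>, not just almost everywhere.\<close>
  show ?thesis
  proof (rule that[of "\<lambda>x. indicator \<Omega> x * G' x"])
    show "AE x in lborel. indicator \<Omega> x * g x = indicator \<Omega> x * G' x"
      using G'(2) by eventually_elim (auto simp: indicator_def)
  qed auto
qed

lemma integral_borel_representative:
  fixes \<Omega> :: "(real^'n) set" and g G \<eta> :: "real^'n \<Rightarrow> real"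
  assumes \<Omega>: "open \<Omega>" and g: "g \<in> borel_measurable (lebesgue_on \<Omega>)"
    and G: "G \<in> borel_measurable borel" "AE x in lborel. indicator \<Omega> x * g x = G x"
    and \<eta>: "\<eta> \<in> borel_measurable borel"
  shows "(LINT x|lebesgue_on \<Omega>. g x * \<eta> x) = (LINT x|lborel. G x * \<eta> x)"
proof -
  have [measurable]: "(\<lambda>x. indicator \<Omega> x * g x) \<in> borel_measurable lebesgue"
    using g \<Omega> by (simp add: borel_measurable_restrict_space_iff)
  have [measurable]: "\<eta> \<in> borel_measurable lebesgue" "G \<in> borel_measurable lebesgue"
    using \<eta> G(1) by (auto intro: measurable_completion)
  have "(LINT x|lebesgue_on \<Omega>. g x * \<eta> x) = (LINT x|lebesgue. indicator \<Omega> x * g x * \<eta> x)"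
    using \<Omega> by (simp add: integral_restrict_space mult.assoc)
  also have "\<dots> = (LINT x|lebesgue. G x * \<eta> x)"
    by (rule integral_cong_AE) (use AE_completion[OF G(2)] in \<open>auto elim: eventually_mono\<close>)
  also have "\<dots> = (LINT x|lborel. G x * \<eta> x)"
    using G(1) \<eta> by (intro integral_completion) simp
  finally show ?thesis .
qed

lemma locally_integrable_mult_test:
  assumes \<Omega>: "open \<Omega>" and g: "locally_integrable \<Omega> g" and \<phi>: "\<phi> \<in> test_functions \<Omega>"
  shows "integrable (lebesgue_on \<Omega>) (\<lambda>x. g x * \<phi> x)"
proof -
  define K where "K = closure {x. \<phi> x \<noteq> 0}"
  have K: "compact K" "K \<subseteq> \<Omega>" using \<phi> by (auto simp: K_def test_functions_def)
  have "integrable (lebesgue_on K) g" using g K by (simp add: locally_integrable_def)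
  then have int: "integrable lebesgue (\<lambda>x. indicator K x * g x)"
    using K(1) by (simp add: integrable_restrict_space borel_compact)
  obtain r where r: "\<And>x. \<phi> x \<noteq> 0 \<Longrightarrow> x \<in> cball 0 r" using test_functionsD(2)[OF \<phi>] by blast
  obtain B where B: "B \<ge> 0" "\<And>x. \<bar>\<phi> x\<bar> \<le> B" using C_inf_bounded[OF test_functionsD(1)[OF \<phi>] r] by blast
  have \<phi>l: "\<phi> \<in> borel_measurable lebesgue"
    using C_inf_borel[OF test_functionsD(1)[OF \<phi>]] by (auto intro: measurable_completion)
  have "integrable lebesgue (\<lambda>x. indicator K x * g x * \<phi> x)"
  proof (rule Bochner_Integration.integrable_bound)
    show "integrable lebesgue (\<lambda>x. B * (indicator K x * g x))" using int by simp
    show "AE x in lebesgue. norm (indicator K x * g x * \<phi> x) \<le> norm (B * (indicator K x * g x))"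
      using B by (intro AE_I2) (auto simp: abs_mult mult.commute[of B] intro!: mult_left_mono)
    show "(\<lambda>x. indicator K x * g x * \<phi> x) \<in> borel_measurable lebesgue"
      by (rule borel_measurable_times[OF borel_measurable_integrable[OF int] \<phi>l])
  qed
  moreover have "indicator K x * g x * \<phi> x = indicator \<Omega> x *\<^sub>R (g x * \<phi> x)" for x
  proof (cases "\<phi> x = 0")
    case False
    then have "x \<in> K" unfolding K_def by (intro subsetD[OF closure_subset]) simp
    with K(2) show ?thesis by auto
  qed simp
  ultimately show ?thesis using \<Omega> by (simp add: integrable_restrict_space)
qed

lemma test_functions_mono: "S \<subseteq> T \<Longrightarrow> test_functions S \<subseteq> test_functions T"
  by (auto simp: test_functions_def)

text \<open>Needed because \<open>weak_deriv\<close> is a choice. The two candidates are only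
  locally integrable, so their difference is first cut off to a ball inside \<Omega>, replaced by an
  integrable Borel representative, and then handed to the fundamental lemma.\<close>

lemma has_weak_deriv_unique:
  fixes \<Omega> :: "(real^'n::{finite,linorder}) set"
  assumes \<Omega>: "open \<Omega>" and g1: "has_weak_deriv \<Omega> j f g1" and g2: "has_weak_deriv \<Omega> j f g2"
  shows "AE x in lebesgue. x \<in> \<Omega> \<longrightarrow> g1 x = g2 x"
proof -
  have loc: "locally_integrable \<Omega> g1" "locally_integrable \<Omega> g2" using g1 g2 by (auto simp: has_weak_deriv_def)
  have eq: "(LINT x|lebesgue_on \<Omega>. g1 x * \<phi> x) = (LINT x|lebesgue_on \<Omega>. g2 x * \<phi> x)"
    if "\<phi> \<in> test_functions \<Omega>" for \<phi>
  proof -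
    have "(LINT x|lebesgue_on \<Omega>. f x * multi_partial j \<phi> x) = (-1) ^ multi_order j * (LINT x|lebesgue_on \<Omega>. g1 x * \<phi> x)"
      "(LINT x|lebesgue_on \<Omega>. f x * multi_partial j \<phi> x) = (-1) ^ multi_order j * (LINT x|lebesgue_on \<Omega>. g2 x * \<phi> x)"
      using g1 g2 that unfolding has_weak_deriv_def by blast+
    then show ?thesis by simp
  qed
  have "negligible {x\<in>\<Omega>. g1 x \<noteq> g2 x}"
  proof (subst locally_negligible_alt, rule ballI)
    fix x0 assume x0: "x0 \<in> {x\<in>\<Omega>. g1 x \<noteq> g2 x}"
    then have "x0 \<in> \<Omega>" by simp
    then obtain r where r: "r > 0" "cball x0 r \<subseteq> \<Omega>"
      using \<Omega> unfolding open_contains_cball by blast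
    have "integrable (lebesgue_on (cball x0 r)) g1" "integrable (lebesgue_on (cball x0 r)) g2"
      using loc r(2) by (auto simp: locally_integrable_def)
    then have "integrable (lebesgue_on (cball x0 r)) (\<lambda>x. g1 x - g2 x)" by auto
    then have "integrable lebesgue (\<lambda>x. indicator (cball x0 r) x *\<^sub>R (g1 x - g2 x))"
      by (subst (asm) integrable_restrict_space) auto
    then have d: "integrable lebesgue (\<lambda>x. indicator (cball x0 r) x * (g1 x - g2 x))" by simp
    obtain D where D: "D \<in> borel_measurable lborel" "AE x in lborel. indicator (cball x0 r) x * (g1 x - g2 x) = D x"
      using completion_ex_borel_measurable_real[OF borel_measurable_integrable[OF d]] by blast
    have Dl [measurable]: "D \<in> borel_measurable lebesgue" using D(1) by (rule measurable_completion)
    have [measurable]: "(\<lambda>x. indicator (cball x0 r) x * (g1 x - g2 x)) \<in> borel_measurable lebesgue"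
      using d by (rule borel_measurable_integrable)
    have "integrable lebesgue D"
      using integrable_cong_AE[THEN iffD1, OF _ _ AE_completion[OF D(2)] d] by simp
    then have Dint: "integrable lborel D" using D(1) by (simp add: integrable_completion)
    have zero: "(LINT x|lborel. D x * \<phi> x) = 0" if \<phi>: "\<phi> \<in> test_functions (ball x0 r)" for \<phi>
    proof -
      have \<phi>': "\<phi> \<in> test_functions \<Omega>"
        using test_functions_mono[of "ball x0 r" \<Omega>] \<phi> r(2) ball_subset_cball by blast
      have [measurable]: "\<phi> \<in> borel_measurable lebesgue" "\<phi> \<in> borel_measurable lborel"
        using C_inf_borel[OF test_functionsD(1)[OF \<phi>]] by (auto intro: measurable_completion)
      have "(LINT x|lborel. D x * \<phi> x) = (LINT x|lebesgue. D x * \<phi> x)"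
        using D(1) by (intro integral_completion[symmetric]) simp
      also have "\<dots> = (LINT x|lebesgue. indicator (cball x0 r) x * (g1 x - g2 x) * \<phi> x)"
        by (rule integral_cong_AE) (use AE_completion[OF D(2)] in \<open>auto elim: eventually_mono\<close>)
      also have "\<dots> = (LINT x|lebesgue. indicator \<Omega> x *\<^sub>R (g1 x * \<phi> x - g2 x * \<phi> x))"
      proof (rule Bochner_Integration.integral_cong[OF refl])
        fix x
        show "indicator (cball x0 r) x * (g1 x - g2 x) * \<phi> x = indicator \<Omega> x *\<^sub>R (g1 x * \<phi> x - g2 x * \<phi> x)"
        proof (cases "\<phi> x = 0")
          case False
          then have "x \<in> ball x0 r" by (rule test_functionsD(3)[OF \<phi>])
          then have "x \<in> cball x0 r" "x \<in> \<Omega>" using r(2) by auto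
          then show ?thesis by (simp add: left_diff_distrib)
        qed simp
      qed
      also have "\<dots> = (LINT x|lebesgue_on \<Omega>. g1 x * \<phi> x - g2 x * \<phi> x)"
        using \<Omega> by (simp add: integral_restrict_space)
      also have "\<dots> = 0"
        using locally_integrable_mult_test[OF \<Omega> loc(1) \<phi>'] locally_integrable_mult_test[OF \<Omega> loc(2) \<phi>'] eq[OF \<phi>']
        by simp
      finally show ?thesis .
    qed
    have "AE x in lborel. x \<in> ball x0 r \<longrightarrow> D x = 0"
      by (rule fundamental_lemma_borel[OF open_ball Dint zero])
    with D(2) have "AE x in lborel. \<not> (x \<in> ball x0 r \<and> g1 x \<noteq> g2 x)"
      by eventually_elim (auto simp: indicator_def)
    then have "AE x in lebesgue. x \<notin> {x. x \<in> ball x0 r \<and> g1 x \<noteq> g2 x}"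
      by (intro AE_completion) simp
    then have "negligible {x. x \<in> ball x0 r \<and> g1 x \<noteq> g2 x}"
      by (simp add: negligible_iff_null_sets completion.AE_iff_null_sets)
    then have "negligible ({x\<in>\<Omega>. g1 x \<noteq> g2 x} \<inter> ball x0 r)" by (rule negligible_subset) auto
    moreover have "openin (top_of_set {x\<in>\<Omega>. g1 x \<noteq> g2 x}) ({x\<in>\<Omega>. g1 x \<noteq> g2 x} \<inter> ball x0 r)"
      by (intro openin_open_Int) auto
    ultimately show "\<exists>U. openin (top_of_set {x\<in>\<Omega>. g1 x \<noteq> g2 x}) U \<and> x0 \<in> U \<and> negligible U"
      using x0 r(1) by (intro exI[of _ "{x\<in>\<Omega>. g1 x \<noteq> g2 x} \<inter> ball x0 r"]) auto
  qed
  then have "AE x in lebesgue. x \<notin> {x\<in>\<Omega>. g1 x \<noteq> g2 x}"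
    unfolding negligible_iff_null_sets by (rule AE_not_in)
  then show ?thesis by eventually_elim auto
qed

section \<open>Classical derivatives as weak derivatives\<close>

lemma C_inf_locally_integrable:
  assumes "f \<in> C_inf_on UNIV"
  shows "locally_integrable \<Omega> f"
  unfolding locally_integrable_def
proof (intro allI impI)
  fix K assume "compact K \<and> K \<subseteq> \<Omega>"
  then have K: "compact K" by simp
  have "integrable lborel (\<lambda>x. indicator K x *\<^sub>R f x)"
    by (rule borel_integrable_compact[OF K C_inf_continuous[OF assms]])
  then have "integrable lebesgue (\<lambda>x. indicator K x *\<^sub>R f x)"
    by (subst integrable_completion) auto
  then show "integrable (lebesgue_on K) f"
    using K by (simp add: integrable_restrict_space borel_compact)
qed

lemma C_inf_has_weak_deriv:
  assumes \<Omega>: "open \<Omega>" and f: "f \<in> C_inf_on UNIV"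
  shows "has_weak_deriv \<Omega> j f (multi_partial j f)"
proof -
  have "(LINT x|lebesgue_on \<Omega>. f x * multi_partial j \<phi> x)
      = (-1) ^ multi_order j * (LINT x|lebesgue_on \<Omega>. multi_partial j f x * \<phi> x)"
    if \<phi>: "\<phi> \<in> test_functions \<Omega>" for \<phi>
  proof -
    obtain r where r: "\<And>x. \<phi> x \<noteq> 0 \<Longrightarrow> x \<in> cball 0 r" using test_functionsD(2)[OF \<phi>] by blast
    have eq: "(LINT x|lebesgue_on \<Omega>. u x * \<eta> x) = (LINT x|lborel. u x * \<eta> x)"
      if "u \<in> C_inf_on UNIV" "\<eta> \<in> test_functions \<Omega>" for u \<eta>
    proof -
      have "(LINT x|lebesgue_on \<Omega>. u x * \<eta> x) = (LINT x|lebesgue. indicator \<Omega> x *\<^sub>R (u x * \<eta> x))"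
        using \<Omega> by (simp add: integral_restrict_space)
      also have "(\<lambda>x. indicator \<Omega> x *\<^sub>R (u x * \<eta> x)) = (\<lambda>x. u x * \<eta> x)"
        using test_functionsD(3)[OF that(2)] by (fastforce simp: indicator_def)
      also have "(LINT x|lebesgue. u x * \<eta> x) = (LINT x|lborel. u x * \<eta> x)"
        using C_inf_borel[OF that(1)] C_inf_borel[OF test_functionsD(1)[OF that(2)]]
        by (intro integral_completion) simp
      finally show ?thesis .
    qed
    show ?thesis
      unfolding multi_partial_eq eq[OF f test_functions_partials[OF \<phi>]] eq[OF C_inf_partials[OF f] \<phi>]
      using integration_by_parts[OF f test_functionsD(1)[OF \<phi>] r] by (simp add: length_multi_list)
  qed
  moreover have "locally_integrable \<Omega> f" "locally_integrable \<Omega> (multi_partial j f)"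
    unfolding multi_partial_eq by (intro C_inf_locally_integrable C_inf_partials f)+
  ultimately show ?thesis by (simp add: has_weak_deriv_def)
qed

lemma has_weak_deriv_diff:
  assumes \<Omega>: "open \<Omega>" and "has_weak_deriv \<Omega> j f g" "has_weak_deriv \<Omega> j f' g'"
  shows "has_weak_deriv \<Omega> j (\<lambda>x. f x - f' x) (\<lambda>x. g x - g' x)"
proof -
  have loc: "locally_integrable \<Omega> f" "locally_integrable \<Omega> g" "locally_integrable \<Omega> f'" "locally_integrable \<Omega> g'"
    using assms by (auto simp: has_weak_deriv_def)
  have "(LINT x|lebesgue_on \<Omega>. (f x - f' x) * multi_partial j \<phi> x)
      = (-1) ^ multi_order j * (LINT x|lebesgue_on \<Omega>. (g x - g' x) * \<phi> x)"
    if \<phi>: "\<phi> \<in> test_functions \<Omega>" for \<phi>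
  proof -
    note int = loc[THEN locally_integrable_mult_test[OF \<Omega> _ \<phi>]]
      loc[THEN locally_integrable_mult_test[OF \<Omega> _ test_functions_partials[OF \<phi>]]]
    have "(LINT x|lebesgue_on \<Omega>. f x * multi_partial j \<phi> x) = (-1) ^ multi_order j * (LINT x|lebesgue_on \<Omega>. g x * \<phi> x)"
      "(LINT x|lebesgue_on \<Omega>. f' x * multi_partial j \<phi> x) = (-1) ^ multi_order j * (LINT x|lebesgue_on \<Omega>. g' x * \<phi> x)"
      using assms(2,3) \<phi> by (auto simp: has_weak_deriv_def)
    then show ?thesis using int by (simp add: left_diff_distrib right_diff_distrib multi_partial_eq)
  qed
  moreover have "locally_integrable \<Omega> (\<lambda>x. f x - f' x)" "locally_integrable \<Omega> (\<lambda>x. g x - g' x)"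
    using loc by (auto simp: locally_integrable_def)
  ultimately show ?thesis by (simp add: has_weak_deriv_def)
qed

text \<open>Bridge from the estimates, which concern \<open>Lp_pow\<close> of Borel functions, to
  the real-valued norm of a function that is determined only almost everywhere on \<Omega>.\<close>

lemma Lp_norm_representative:
  fixes \<Omega> :: "(real^'n) set" and u U :: "real^'n \<Rightarrow> real"
  assumes \<Omega>: "open \<Omega>" and U: "U \<in> borel_measurable borel" "AE x in lebesgue. x \<in> \<Omega> \<longrightarrow> u x = U x"
    and fin: "Lp_pow p \<Omega> U < \<infinity>"
  shows "u \<in> Lp_space p \<Omega>" "Lp_norm p \<Omega> u = enn2real (Lp_pow p \<Omega> U) powr (1 / p)"
proof -
  have [measurable]: "\<Omega> \<in> sets borel" "U \<in> borel_measurable borel" using \<Omega> U(1) by auto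
  let ?V = "\<lambda>x. indicator \<Omega> x * \<bar>U x\<bar> powr p"
  have "(\<lambda>x. indicator \<Omega> x * U x) \<in> borel_measurable lebesgue"
    by (rule measurable_completion) simp
  moreover have "AE x in lebesgue. indicator \<Omega> x * U x = indicator \<Omega> x * u x"
    using U(2) by eventually_elim (auto simp: indicator_def)
  ultimately have ul: "(\<lambda>x. indicator \<Omega> x * u x) \<in> borel_measurable lebesgue"
    by (rule borel_measurable_AE)
  then have um: "u \<in> borel_measurable (lebesgue_on \<Omega>)"
    using \<Omega> by (simp add: borel_measurable_restrict_space_iff)
  have V: "integrable lborel ?V"
    by (rule integrableI_nonneg)
      (use fin in \<open>auto simp: Lp_pow_def ennreal_mult' ennreal_indicator mult.commute\<close>)
  have Vint: "integral\<^sup>L lborel ?V = enn2real (Lp_pow p \<Omega> U)"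
    by (subst integral_eq_nn_integral) (auto simp: Lp_pow_def ennreal_mult' ennreal_indicator mult.commute)
  have Vl: "integrable lebesgue ?V" "integral\<^sup>L lebesgue ?V = integral\<^sup>L lborel ?V"
    using V by (auto simp: integrable_completion integral_completion)
  have Vm: "?V \<in> borel_measurable lebesgue" using Vl(1) by auto
  have ae: "AE x in lebesgue. ?V x = indicator \<Omega> x *\<^sub>R \<bar>u x\<bar> powr p"
    using U(2) by eventually_elim (auto simp: indicator_def)
  have um': "(\<lambda>x. indicator \<Omega> x *\<^sub>R \<bar>u x\<bar> powr p) \<in> borel_measurable lebesgue"
    by (rule borel_measurable_AE[OF Vm ae])
  have "integrable lebesgue (\<lambda>x. indicator \<Omega> x *\<^sub>R \<bar>u x\<bar> powr p)"
    using integrable_cong_AE[THEN iffD1, OF Vm um' ae Vl(1)] .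
  then show "u \<in> Lp_space p \<Omega>"
    using um \<Omega> by (simp add: Lp_space_def integrable_restrict_space)
  have "(LINT x|lebesgue_on \<Omega>. \<bar>u x\<bar> powr p) = (LINT x|lebesgue. indicator \<Omega> x *\<^sub>R \<bar>u x\<bar> powr p)"
    using \<Omega> by (simp add: integral_restrict_space)
  also have "\<dots> = integral\<^sup>L lebesgue ?V"
    by (rule integral_cong_AE[OF um' Vm]) (use ae in \<open>auto elim: eventually_mono\<close>)
  finally show "Lp_norm p \<Omega> u = enn2real (Lp_pow p \<Omega> U) powr (1 / p)"
    by (simp add: Lp_norm_def Vl(2) Vint)
qed

text \<open>For order zero, \<open>sobolev\<close> supplies some L^p function that agrees with
  \<open>f\<close> in all pairings with test functions. This allows it to replace \<open>f\<close>
  in the weak formulation.\<close>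

lemma has_weak_deriv_0_test:
  assumes "has_weak_deriv \<Omega> (\<lambda>_. 0) f g" "\<phi> \<in> test_functions \<Omega>"
  shows "(LINT x|lebesgue_on \<Omega>. f x * \<phi> x) = (LINT x|lebesgue_on \<Omega>. g x * \<phi> x)"
proof -
  have "multi_list (\<lambda>_::'a. 0::nat) = []" using length_multi_list[of "\<lambda>_::'a. 0::nat"] by simp
  then have "multi_partial (\<lambda>_. 0) \<phi> = \<phi>" by (simp add: multi_partial_eq)
  then show ?thesis using assms by (auto simp: has_weak_deriv_def)
qed

lemma sobolev_norm_powr:
  assumes "p > 0"
  shows "sobolev_norm p k \<Omega> f powr p = (\<Sum>j | multi_order j \<le> k. Lp_norm p \<Omega> (weak_deriv \<Omega> j f) powr p)"
  using assms by (simp add: sobolev_norm_def powr_powr sum_nonneg)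

text \<open>Membership of the difference in \<open>sobolev\<close> is carried along since the
  real-valued norm is meaningful only there. The bound is on the p-th power because these powers add
  up over derivatives and components.\<close>

lemma sobolev_smooth_approximation:
  fixes \<Omega> :: "(real^'n::{finite,linorder}) set" and f :: "real^'n::_ \<Rightarrow> real"
  assumes \<Omega>: "open \<Omega>" "bounded \<Omega>" "C1_boundary \<Omega>" and p: "p \<ge> 1"
    and f: "f \<in> sobolev p k \<Omega>" and e: "e > 0"
  shows "\<exists>\<psi>\<in>C_inf_on UNIV. (\<lambda>x. f x - \<psi> x) \<in> sobolev p k \<Omega> \<and>
    sobolev_norm p k \<Omega> (\<lambda>x. f x - \<psi> x) powr p \<le> e"
proof -
  let ?z = "\<lambda>_::'n. 0::nat"
  let ?J = "{j :: 'n \<Rightarrow> nat. multi_order j \<le> k}"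
  have z: "multi_order ?z \<le> k" by simp
  have S [measurable]: "\<Omega> \<in> sets borel" using \<Omega>(1) by simp
  have "\<forall>j\<in>?J. \<exists>g. g \<in> Lp_space p \<Omega> \<and> has_weak_deriv \<Omega> j f g"
    using f unfolding sobolev_def by blast
  from bchoice[OF this] obtain g where g: "\<And>j. multi_order j \<le> k \<Longrightarrow> g j \<in> Lp_space p \<Omega>"
    "\<And>j. multi_order j \<le> k \<Longrightarrow> has_weak_deriv \<Omega> j f (g j)" by blast
  have gm: "g j \<in> borel_measurable (lebesgue_on \<Omega>)" if "multi_order j \<le> k" for j
    using g(1)[OF that] by (simp add: Lp_space_def)
  have "\<forall>j\<in>?J. \<exists>G. G \<in> borel_measurable borel \<and> (\<forall>x. x \<notin> \<Omega> \<longrightarrow> G x = 0) \<and>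
      (AE x in lborel. indicator \<Omega> x * g j x = G x)"
  proof
    fix j assume "j \<in> ?J"
    then have "g j \<in> borel_measurable (lebesgue_on \<Omega>)" using gm by simp
    then obtain G where "G \<in> borel_measurable borel" "\<And>x. x \<notin> \<Omega> \<Longrightarrow> G x = 0"
      "AE x in lborel. indicator \<Omega> x * g j x = G x"
      by (rule borel_representative[OF \<Omega>(1)]) (rule that)
    then show "\<exists>G. G \<in> borel_measurable borel \<and> (\<forall>x. x \<notin> \<Omega> \<longrightarrow> G x = 0) \<and>
      (AE x in lborel. indicator \<Omega> x * g j x = G x)" by blast
  qed
  from bchoice[OF this] obtain G where G: "\<And>j. multi_order j \<le> k \<Longrightarrow> G j \<in> borel_measurable borel"
    "\<And>j x. multi_order j \<le> k \<Longrightarrow> x \<notin> \<Omega> \<Longrightarrow> G j x = 0"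
    "\<And>j. multi_order j \<le> k \<Longrightarrow> AE x in lborel. indicator \<Omega> x * g j x = G j x" by blast
  have Gae: "AE x in lebesgue. x \<in> \<Omega> \<longrightarrow> g j x = G j x" if "multi_order j \<le> k" for j
    using AE_completion[OF G(3)[OF that]] by eventually_elim (auto simp: indicator_def)
  have fin: "Lp_pow p \<Omega> (G j) < \<infinity>" if j: "multi_order j \<le> k" for j
  proof -
    have "integrable lebesgue (\<lambda>x. indicator \<Omega> x *\<^sub>R \<bar>g j x\<bar> powr p)"
      using g(1)[OF j] \<Omega>(1) by (simp add: Lp_space_def integrable_restrict_space)
    then have "(\<integral>\<^sup>+x. ennreal (norm (indicator \<Omega> x *\<^sub>R \<bar>g j x\<bar> powr p)) \<partial>lebesgue) < \<infinity>"
      unfolding integrable_iff_bounded by blast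
    also have "(\<integral>\<^sup>+x. ennreal (norm (indicator \<Omega> x *\<^sub>R \<bar>g j x\<bar> powr p)) \<partial>lebesgue)
        = (\<integral>\<^sup>+x. ennreal (\<bar>G j x\<bar> powr p) * indicator \<Omega> x \<partial>lebesgue)"
      by (rule nn_integral_cong_AE) (use Gae[OF j] in \<open>eventually_elim, auto simp: indicator_def\<close>)
    also have "\<dots> = Lp_pow p \<Omega> (G j)" by (simp add: Lp_pow_def nn_integral_completion)
    finally show ?thesis .
  qed
  have weak: "(LINT x|lborel. G ?z x * multi_partial j \<phi> x) = (-1) ^ multi_order j * (LINT x|lborel. G j x * \<phi> x)"
    if j: "multi_order j \<le> k" and \<phi>: "\<phi> \<in> test_functions \<Omega>" for j \<phi>
  proof -
    have D\<phi>: "multi_partial j \<phi> \<in> test_functions \<Omega>"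
      unfolding multi_partial_eq by (rule test_functions_partials[OF \<phi>])
    have "(LINT x|lborel. G ?z x * multi_partial j \<phi> x) = (LINT x|lebesgue_on \<Omega>. g ?z x * multi_partial j \<phi> x)"
      by (rule integral_borel_representative[OF \<Omega>(1) gm[OF z] G(1)[OF z] G(3)[OF z]
            C_inf_borel[OF test_functionsD(1)[OF D\<phi>]], symmetric])
    also have "\<dots> = (LINT x|lebesgue_on \<Omega>. f x * multi_partial j \<phi> x)"
      by (rule has_weak_deriv_0_test[OF g(2)[OF z] D\<phi>, symmetric])
    also have "\<dots> = (-1) ^ multi_order j * (LINT x|lebesgue_on \<Omega>. g j x * \<phi> x)"
      using g(2)[OF j] \<phi> unfolding has_weak_deriv_def by blast
    also have "(LINT x|lebesgue_on \<Omega>. g j x * \<phi> x) = (LINT x|lborel. G j x * \<phi> x)"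
      by (rule integral_borel_representative[OF \<Omega>(1) gm[OF j] G(1)[OF j] G(3)[OF j]
            C_inf_borel[OF test_functionsD(1)[OF \<phi>]]])
    finally show ?thesis .
  qed
  have "\<exists>\<psi>. (\<forall>m. \<psi> m \<in> C_inf_on UNIV) \<and>
    (\<forall>j. multi_order j \<le> k \<longrightarrow> (\<lambda>m::nat. Lp_pow p \<Omega> (\<lambda>x. multi_partial j (\<psi> m) x - G j x)) \<longlonglongrightarrow> 0)"
    by (rule smooth_approximation[OF \<Omega> p G(1) fin G(2) weak])
  then obtain \<psi> where \<psi>: "\<And>m. \<psi> m \<in> C_inf_on UNIV"
    "\<And>j. multi_order j \<le> k \<Longrightarrow> (\<lambda>m::nat. Lp_pow p \<Omega> (\<lambda>x. multi_partial j (\<psi> m) x - G j x)) \<longlonglongrightarrow> 0" by blast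
  \<comment> \<open>The tolerance is shared equally among the finitely many multi-indices.\<close>
  define N where "N = real (card ?J)"
  have "?J \<noteq> {}" using z by blast
  then have N: "N > 0" using finite_multi_indices[of k, where 'n = 'n] by (simp add: N_def card_gt_0_iff)
  have "\<forall>\<^sub>F m in sequentially. \<forall>j\<in>?J. Lp_pow p \<Omega> (\<lambda>x. multi_partial j (\<psi> m) x - G j x) < ennreal (e / N)"
    using e N by (intro eventually_ball_finite[OF finite_multi_indices] ballI order_tendstoD(2)[OF \<psi>(2)]) auto
  then obtain m where m: "\<And>j. multi_order j \<le> k \<Longrightarrow> Lp_pow p \<Omega> (\<lambda>x. multi_partial j (\<psi> m) x - G j x) < ennreal (e / N)"
    by (auto simp: eventually_sequentially)
  let ?d = "\<lambda>x. f x - \<psi> m x"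
  let ?U = "\<lambda>j x. G j x - multi_partial j (\<psi> m) x"
  have U: "?U j \<in> borel_measurable borel" if "multi_order j \<le> k" for j
    using G(1)[OF that] C_inf_borel[OF C_inf_partials[OF \<psi>(1)]] by (simp add: multi_partial_eq)
  have Ulp: "Lp_pow p \<Omega> (?U j) < ennreal (e / N)" if "multi_order j \<le> k" for j
    using m[OF that] by (subst Lp_pow_minus_commute)
  then have Ufin: "Lp_pow p \<Omega> (?U j) < \<infinity>" if "multi_order j \<le> k" for j
    using that less_trans[OF _ ennreal_less_top] by fastforce
  have wd: "has_weak_deriv \<Omega> j ?d (\<lambda>x. g j x - multi_partial j (\<psi> m) x)" if "multi_order j \<le> k" for j
    by (rule has_weak_deriv_diff[OF \<Omega>(1) g(2)[OF that] C_inf_has_weak_deriv[OF \<Omega>(1) \<psi>(1)]])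
  have ae: "AE x in lebesgue. x \<in> \<Omega> \<longrightarrow> g j x - multi_partial j (\<psi> m) x = ?U j x" if "multi_order j \<le> k" for j
    using Gae[OF that] by eventually_elim auto
  have "?d \<in> sobolev p k \<Omega>"
    unfolding sobolev_def
    using Lp_norm_representative(1)[OF \<Omega>(1) U ae Ufin] wd by blast
  moreover have "sobolev_norm p k \<Omega> ?d powr p \<le> e"
  proof -
    have "Lp_norm p \<Omega> (weak_deriv \<Omega> j ?d) powr p \<le> e / N" if j: "j \<in> ?J" for j
    proof -
      from j have j: "multi_order j \<le> k" by simp
      \<comment> \<open>A concrete weak derivative shows that the choice is not vacuous; uniqueness
        then identifies the chosen function with the concrete one.\<close>
      have "has_weak_deriv \<Omega> j ?d (weak_deriv \<Omega> j ?d)"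
        unfolding weak_deriv_def using wd[OF j] by (rule someI[where P = "has_weak_deriv \<Omega> j ?d"])
      from has_weak_deriv_unique[OF \<Omega>(1) this wd[OF j]] ae[OF j]
      have "AE x in lebesgue. x \<in> \<Omega> \<longrightarrow> weak_deriv \<Omega> j ?d x = ?U j x"
        by eventually_elim auto
      from Lp_norm_representative(2)[OF \<Omega>(1) U[OF j] this Ufin[OF j]]
      have "Lp_norm p \<Omega> (weak_deriv \<Omega> j ?d) powr p = enn2real (Lp_pow p \<Omega> (?U j))"
        using p by (simp add: powr_powr)
      also have "\<dots> \<le> e / N"
        using Ulp[OF j] e N by (intro enn2real_leI) auto
      finally show ?thesis .
    qed
    then have "(\<Sum>j\<in>?J. Lp_norm p \<Omega> (weak_deriv \<Omega> j ?d) powr p) \<le> (\<Sum>j\<in>?J. e / N)" by (rule sum_mono)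
    also have "\<dots> = e" using N by (simp add: N_def)
    finally show ?thesis using p by (simp add: sobolev_norm_powr)
  qed
  ultimately show ?thesis using \<psi>(1) by blast
qed

section \<open>From real components to Clifford-valued functions\<close>

lemma C_inf_imp_upto_boundary:
  assumes "f \<in> C_inf_on UNIV"
  shows "f \<in> C_inf_upto_boundary \<Omega>"
proof -
  have "f \<in> C_inf_on \<Omega>"
    using assms differentiable_on_subset unfolding C_inf_on_def by blast
  moreover have "continuous_on (closure \<Omega>) (multi_partial j f)" for j
    unfolding multi_partial_eq by (intro C_inf_continuous C_inf_partials assms)
  ultimately show ?thesis unfolding C_inf_upto_boundary_def by blast
qed

theorem proposition3:
  fixes \<Omega> :: "(real^'n::{finite,linorder}) set"
    and f :: "real^'n::_ \<Rightarrow> 'n clifford"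
    and p \<epsilon> :: real and k :: nat
  assumes "is_domain \<Omega>" and "bounded \<Omega>" and "C1_boundary \<Omega>"
    and "1 < p"
    and "f \<in> cl_sobolev p k \<Omega>"
    and "\<epsilon> > 0"
  shows "\<exists>\<Psi> \<in> cl_C_inf_upto_boundary \<Omega>.
           (\<lambda>x. f x - \<Psi> x) \<in> cl_sobolev p k \<Omega> \<and>
           cl_sobolev_norm p k \<Omega> (\<lambda>x. f x - \<Psi> x) < \<epsilon>"
proof -
  have \<Omega>: "open \<Omega>" using assms(1) by (simp add: is_domain_def)
  define N where "N = real (card (UNIV :: 'n set set))"
  have N: "N > 0" by (simp add: N_def card_gt_0_iff)
  \<comment> \<open>Summed over the N components this gives at most half of \<epsilon>^p, and the
    factor 1/2 turns the weak bounds into a strict inequality.\<close>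
  define e where "e = \<epsilon> powr p / (2 * N)"
  have e: "e > 0" using assms(6) N by (simp add: e_def)
  have "\<forall>A. \<exists>\<psi>. \<psi> \<in> C_inf_on UNIV \<and> (\<lambda>x. cl_comp (f x) A - \<psi> x) \<in> sobolev p k \<Omega> \<and>
      sobolev_norm p k \<Omega> (\<lambda>x. cl_comp (f x) A - \<psi> x) powr p \<le> e"
  proof
    fix A
    have "(\<lambda>x. cl_comp (f x) A) \<in> sobolev p k \<Omega>" using assms(5) by (simp add: cl_sobolev_def)
    from sobolev_smooth_approximation[OF \<Omega> assms(2,3) less_imp_le[OF assms(4)] this e]
    show "\<exists>\<psi>. \<psi> \<in> C_inf_on UNIV \<and> (\<lambda>x. cl_comp (f x) A - \<psi> x) \<in> sobolev p k \<Omega> \<and>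
      sobolev_norm p k \<Omega> (\<lambda>x. cl_comp (f x) A - \<psi> x) powr p \<le> e" by blast
  qed
  from choice[OF this] obtain \<psi> where \<psi>: "\<And>A. \<psi> A \<in> C_inf_on UNIV"
    "\<And>A. (\<lambda>x. cl_comp (f x) A - \<psi> A x) \<in> sobolev p k \<Omega>"
    "\<And>A. sobolev_norm p k \<Omega> (\<lambda>x. cl_comp (f x) A - \<psi> A x) powr p \<le> e" by blast
  define \<Psi> where "\<Psi> x = Clifford (\<lambda>A. \<psi> A x)" for x
  have "\<Psi> \<in> cl_C_inf_upto_boundary \<Omega>"
    using \<psi>(1) by (simp add: cl_C_inf_upto_boundary_def \<Psi>_def C_inf_imp_upto_boundary)
  moreover have "(\<lambda>x. f x - \<Psi> x) \<in> cl_sobolev p k \<Omega>"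
    using \<psi>(2) by (simp add: cl_sobolev_def \<Psi>_def)
  moreover have "cl_sobolev_norm p k \<Omega> (\<lambda>x. f x - \<Psi> x) < \<epsilon>"
  proof -
    let ?s = "\<Sum>A\<in>UNIV. sobolev_norm p k \<Omega> (\<lambda>x. cl_comp (f x - \<Psi> x) A) powr p"
    have "?s \<le> (\<Sum>A\<in>(UNIV :: 'n set set). e)"
      by (rule sum_mono) (use \<psi>(3) in \<open>simp add: \<Psi>_def\<close>)
    also have "\<dots> = N * e" by (simp add: N_def)
    also have "\<dots> = \<epsilon> powr p / 2" using N by (simp add: e_def)
    also have "\<dots> < \<epsilon> powr p" using assms(6) by simp
    finally have "?s < \<epsilon> powr p" .
    moreover have "?s \<ge> 0" by (intro sum_nonneg) simp
    ultimately have "?s powr (1 / p) < (\<epsilon> powr p) powr (1 / p)"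
      using assms(4) by (intro powr_less_mono2) auto
    then show ?thesis using assms(4,6) by (simp add: cl_sobolev_norm_def powr_powr)
  qed
  ultimately show ?thesis by blast
qed

end
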